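(* Let $\kappa\in\mathbb{R}$, let $(W_t)_{t\ge0}$ be a standard one-dimensional Brownian motion, and let $(X_t)_{t\ge0}$ be the real-valued process solving $$dX_t=-\kappa X_t\,dt+\sigma_t\,dW_t,$$ where $(\sigma_t)_{t\ge0}$ is a predictable real-valued process. Assume that there exists $M>0$ such that $$\sup_{t\ge0}\|\sigma_t\|_{L^\infty}\le M.$$ Assume that $X_0$ is distributed according to a probability measure $\mu_0$ on $\mathbb{R}$ satisfying $\mathrm{GCBS}(D_0)$. Then for all $t>0$ there exists $D_t>0$ such that the distribution of $X_t$ satisfies $\mathrm{GCBS}(D_t)$. Moreover, if $\kappa>0$, then all weak limit points of $(X_t)_{t\ge0}$ (limits in distribution as $t\to\infty$) satisfy $\mathrm{GCBS}(D_\infty)$ for some $D_\infty>0$.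
   Context: $\mathrm{GCBS}(D)$, $D\ge0$, for a Borel probability measure $\mu$ on $\mathbb{R}$: $\log\mu(e^{f-\mu(f)})\le D\,\mathrm{lip}(f)^2$ for all $\mathcal{C}^\infty$ compactly supported $f:\mathbb{R}\to\mathbb{R}$, where $\mathrm{lip}(f)$ is the Lipschitz constant of $f$ and $\mu(f)=\int f\,d\mu$. The process $\sigma$ is predictable with respect to a filtration for which $W$ is a Brownian motion and $X_0$ is measurable at time $0$. *)

theory Defs
  imports "HOL-Probability.Probability"
begin

definition smooth_compact_support :: "(real \<Rightarrow> real) \<Rightarrow> bool" where
  "smooth_compact_support f \<longleftrightarrow>
     (\<forall>k x. ((deriv ^^ k) f) differentiable (at x)) \<and> compact (closure {x. f x \<noteq> 0})"

definition lip :: "(real \<Rightarrow> real) \<Rightarrow> real" where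
  "lip f = Inf {L. L-lipschitz_on UNIV f}"

text \<open>The inequality is only meant for Borel probability measures on the line, i.e. under
  \<^term>\<open>real_distribution \<mu>\<close>.\<close>

definition GCBS :: "real \<Rightarrow> real measure \<Rightarrow> bool" where
  "GCBS D \<mu> \<longleftrightarrow> (\<forall>f. smooth_compact_support f \<longrightarrow>
     ln (\<integral>x. exp (f x - (\<integral>y. f y \<partial>\<mu>)) \<partial>\<mu>) \<le> D * (lip f)\<^sup>2)"

text \<open>Time is indexed by \<^typ>\<open>real\<close> and only times \<open>t \<ge> 0\<close> are meaningful. The filtration is
  nevertheless given for all real indices, to match the library locale; this is no restriction, as
  any filtration on the half line can be extended by \<open>F t = F 0\<close> for \<open>t < 0\<close>.\<close>

definition filtered_prob_space :: "'a measure \<Rightarrow> (real \<Rightarrow> 'a measure) \<Rightarrow> bool" where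
  "filtered_prob_space P F \<longleftrightarrow>
     prob_space P \<and> filtration (space P) F \<and> (\<forall>t. subalgebra P (F t))"

definition brownian_motion ::
  "'a measure \<Rightarrow> (real \<Rightarrow> 'a measure) \<Rightarrow> (real \<Rightarrow> 'a \<Rightarrow> real) \<Rightarrow> bool" where
  "brownian_motion P F W \<longleftrightarrow>
     (\<forall>t\<ge>0. W t \<in> borel_measurable (F t)) \<and>
     (AE \<omega> in P. W 0 \<omega> = 0) \<and>
     (AE \<omega> in P. continuous_on {0..} (\<lambda>t. W t \<omega>)) \<and>
     (\<forall>s t. 0 \<le> s \<and> s < t \<longrightarrow>
        distributed P lborel (\<lambda>\<omega>. W t \<omega> - W s \<omega>) (normal_density 0 (sqrt (t - s))) \<and>
        prob_space.indep_set P (sets (F s))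
          (sets (vimage_algebra (space P) (\<lambda>\<omega>. W t \<omega> - W s \<omega>) borel)))"

definition predictable_algebra :: "'a set \<Rightarrow> (real \<Rightarrow> 'a measure) \<Rightarrow> (real \<times> 'a) measure" where
  "predictable_algebra \<Omega> F = sigma ({0..} \<times> \<Omega>)
     ({{0} \<times> A | A. A \<in> sets (F 0)} \<union>
      {{s<..t} \<times> A | s t A. 0 \<le> s \<and> s < t \<and> A \<in> sets (F s)})"

definition predictable ::
  "'a measure \<Rightarrow> (real \<Rightarrow> 'a measure) \<Rightarrow> (real \<Rightarrow> 'a \<Rightarrow> real) \<Rightarrow> bool" where
  "predictable P F \<sigma> \<longleftrightarrow>
     (\<lambda>(t, \<omega>). \<sigma> t \<omega>) \<in> borel_measurable (predictable_algebra (space P) F)"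

text \<open>A triple \<open>(n, \<tau>, \<xi>)\<close> encodes the simple process
  \<open>\<Sum>i<n. \<xi>\<^sub>i 1\<^bsub>(\<tau>\<^sub>i, \<tau>\<^sub>i\<^sub>+\<^sub>1]\<^esub>\<close>
  with deterministic times and \<open>\<xi>\<^sub>i\<close> bounded and known at time \<open>\<tau>\<^sub>i\<close>.\<close>

type_synonym 'a simple_process = "nat \<times> (nat \<Rightarrow> real) \<times> (nat \<Rightarrow> 'a \<Rightarrow> real)"

fun simple_process :: "(real \<Rightarrow> 'a measure) \<Rightarrow> 'a simple_process \<Rightarrow> bool" where
  "simple_process F (n, \<tau>, \<xi>) \<longleftrightarrow>
     0 \<le> \<tau> 0 \<and>
     (\<forall>i<n. \<tau> i \<le> \<tau> (Suc i) \<and> \<xi> i \<in> borel_measurable (F (\<tau> i)) \<and>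
        (\<exists>C. \<forall>\<omega>\<in>space (F (\<tau> i)). \<bar>\<xi> i \<omega>\<bar> \<le> C))"

fun simple_value :: "'a simple_process \<Rightarrow> real \<Rightarrow> 'a \<Rightarrow> real" where
  "simple_value (n, \<tau>, \<xi>) s \<omega> = (\<Sum>i<n. \<xi> i \<omega> * indicator {\<tau> i<..\<tau> (Suc i)} s)"

fun simple_integral_wrt ::
  "(real \<Rightarrow> 'a \<Rightarrow> real) \<Rightarrow> 'a simple_process \<Rightarrow> real \<Rightarrow> 'a \<Rightarrow> real" where
  "simple_integral_wrt W (n, \<tau>, \<xi>) t \<omega> =
     (\<Sum>i<n. \<xi> i \<omega> * (W (min t (\<tau> (Suc i))) \<omega> - W (min t (\<tau> i)) \<omega>))"

text \<open>\<open>I\<close> is a continuous version of the Ito integral process \<open>(\<integral>\<^sub>0\<^sup>t \<sigma>\<^sub>s dW\<^sub>s)\<^sub>t\<close>, for integrands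
  that are square integrable on each \<open>[0, t]\<close>: the square-mean limit of the integrals of simple
  processes which approximate \<open>\<sigma>\<close> in square mean on \<open>[0, t]\<close>. By the Ito isometry the limit does
  not depend on the approximating sequence. The integrals are \<^typ>\<open>ennreal\<close>-valued so that an
  infinite norm is not read as 0.\<close>

definition ito_integral ::
  "'a measure \<Rightarrow> (real \<Rightarrow> 'a measure) \<Rightarrow> (real \<Rightarrow> 'a \<Rightarrow> real) \<Rightarrow> (real \<Rightarrow> 'a \<Rightarrow> real)
     \<Rightarrow> (real \<Rightarrow> 'a \<Rightarrow> real) \<Rightarrow> bool" where
  "ito_integral P F W \<sigma> I \<longleftrightarrow>
     (AE \<omega> in P. continuous_on {0..} (\<lambda>t. I t \<omega>)) \<and>
     (\<forall>t\<ge>0. I t \<in> borel_measurable P \<and>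
        (\<exists>\<phi> :: nat \<Rightarrow> 'a simple_process.
           (\<forall>k. simple_process F (\<phi> k)) \<and>
           (\<lambda>k. \<integral>\<^sup>+\<omega>. (\<integral>\<^sup>+s\<in>{0..t}. ennreal ((simple_value (\<phi> k) s \<omega> - \<sigma> s \<omega>)\<^sup>2) \<partial>lborel) \<partial>P)
             \<longlonglongrightarrow> 0 \<and>
           (\<lambda>k. \<integral>\<^sup>+\<omega>. ennreal ((simple_integral_wrt W (\<phi> k) t \<omega> - I t \<omega>)\<^sup>2) \<partial>P) \<longlonglongrightarrow> 0))"

text \<open>The equation \<open>dX = - \<kappa> X dt + \<sigma> dW\<close> in integral form. Almost sure continuity of \<open>X\<close>, and
  its adaptedness to the completed filtration when \<open>X 0\<close> is measurable at time 0, are consequences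
  of the equation.\<close>

definition solves_sde ::
  "'a measure \<Rightarrow> (real \<Rightarrow> 'a measure) \<Rightarrow> (real \<Rightarrow> 'a \<Rightarrow> real) \<Rightarrow> real \<Rightarrow> (real \<Rightarrow> 'a \<Rightarrow> real)
     \<Rightarrow> (real \<Rightarrow> 'a \<Rightarrow> real) \<Rightarrow> bool" where
  "solves_sde P F W \<kappa> \<sigma> X \<longleftrightarrow>
     (\<forall>t\<ge>0. X t \<in> borel_measurable P) \<and>
     (AE \<omega> in P. \<forall>t\<ge>0. set_integrable lborel {0..t} (\<lambda>s. X s \<omega>)) \<and>
     (\<exists>I. ito_integral P F W \<sigma> I \<and>
        (AE \<omega> in P. \<forall>t\<ge>0. X t \<omega> = X 0 \<omega> + (LINT s:{0..t}|lborel. - \<kappa> * X s \<omega>) + I t \<omega>))"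

text \<open>Sequences of times suffice, since weak convergence of probability measures on the line is
  metrizable.\<close>

definition weak_limit_point :: "'a measure \<Rightarrow> (real \<Rightarrow> 'a \<Rightarrow> real) \<Rightarrow> real measure \<Rightarrow> bool" where
  "weak_limit_point P X \<nu> \<longleftrightarrow>
     real_distribution \<nu> \<and>
     (\<exists>t :: nat \<Rightarrow> real. (\<forall>n. 0 \<le> t n) \<and> filterlim t at_top sequentially \<and>
        weak_conv_m (\<lambda>n. distr P borel (X (t n))) \<nu>)"

end

theory Submission
  imports Defs
begin

text \<open>
  On the real line the Gaussian concentration bound carries the same information as a Gaussian
  bound on the exponential moments, \<open>\<integral> exp (l x) d\<mu> \<le> A exp (B l\<^sup>2)\<close> for all real \<open>l\<close>
  (\<open>GCBS_imp_subgaussian\<close>, \<open>subgaussian_imp_GCBS\<close>), and the concentration constant can be chosen as a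
  function of \<open>A\<close> and \<open>B\<close>. The second property is stable under sums without any independence: \<open>exp (a + b + c) \<le> exp (3 a) + exp (3 b) + exp (3 c)\<close>.
  This matters because \<open>X\<^sub>0\<close> and the noise may be dependent through \<open>\<sigma>\<close>.

  Let \<open>I\<close> be the stochastic integral of \<open>\<sigma>\<close>. Solving the linear equation path by path gives
  \<open>X\<^sub>t = e\<^sup>-\<^sup>\<kappa>\<^sup>t X\<^sub>0 + e\<^sup>-\<^sup>\<kappa>\<^sup>t (I\<^sub>t - I\<^sub>0) + \<integral>\<^sub>0\<^sup>t \<kappa> exp (- \<kappa> (t - s)) (I\<^sub>t - I\<^sub>s) ds\<close>
  (\<open>linear_equation_solution\<close>), where only increments of \<open>I\<close> occur. Each increment satisfies
  \<open>E exp (l (I\<^sub>t - I\<^sub>s)) \<le> exp (l\<^sup>2 M\<^sup>2 (t - s) / 2)\<close> (\<open>increment_exponential_moment\<close>): for a simple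
  integrand bounded by \<open>M\<close> the Brownian increments are integrated out one after the other, latest
  first, and Fatou's lemma passes to the limit. For this the approximating simple processes are
  truncated at \<open>M\<close>, which does not take them farther from \<open>\<sigma>\<close>, and the Ito isometry shows that one
  approximating sequence serves all times up to \<open>t\<close>.

  The time integral is a limit of Riemann sums, and convexity of the exponential bounds the
  exponential moment of a weighted sum by those of its terms
  (\<open>weighted_integral_exponential_moment\<close>). For fixed \<open>t\<close> uniform weights are enough. For \<open>\<kappa> > 0\<close>
  half of the decay of the kernel is used as the weight and the other half is left to beat the growth
  \<open>t - s\<close> of the variance of the increments, so that the constants do not depend on \<open>t\<close>. A bound that is
  uniform in \<open>t\<close> passes to weak limits, since only bounded continuous test functions are involved.
\<close>

section \<open>Smooth cut-offs of linear functions\<close>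

text \<open>The powers of \<open>1 / y\<close> are there because they make the family closed under differentiation.\<close>

definition flat_exp :: "nat \<Rightarrow> real \<Rightarrow> real" where
  "flat_exp k y = (if y > 0 then exp (- (1 / y)) / y ^ k else 0)"

lemma flat_exp_bound: "0 \<le> flat_exp k y" "flat_exp k y \<le> fact k"
proof -
  show "0 \<le> flat_exp k y" by (simp add: flat_exp_def)
  show "flat_exp k y \<le> fact k"
  proof (cases "y > 0")
    case True
    define z where "z = 1 / y"
    have z: "z > 0" using True by (simp add: z_def)
    have "(\<lambda>n. z ^ n /\<^sub>R fact n) sums exp z" by (rule exp_converges)
    then have s: "summable (\<lambda>n. z ^ n /\<^sub>R fact n)" "(\<Sum>n. z ^ n /\<^sub>R fact n) = exp z"
      by (auto simp: sums_iff)
    have "(\<Sum>n\<in>{k}. z ^ n /\<^sub>R fact n) \<le> (\<Sum>n. z ^ n /\<^sub>R fact n)"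
      by (rule sum_le_suminf) (use s z in auto)
    then have "z ^ k \<le> fact k * exp z" using s by (simp add: field_simps)
    then have "z ^ k * exp (- z) \<le> fact k" by (simp add: exp_minus field_simps)
    moreover have "flat_exp k y = z ^ k * exp (- z)"
      using True by (simp add: flat_exp_def z_def field_simps)
    ultimately show ?thesis by simp
  qed (simp add: flat_exp_def)
qed

lemma flat_exp_shift: "flat_exp k y = y * flat_exp (Suc k) y" "flat_exp k y = y\<^sup>2 * flat_exp (k + 2) y"
  by (auto simp: flat_exp_def power2_eq_square)

text \<open>At the origin the difference quotient is \<open>h\<close> times a bounded function, by \<open>flat_exp_shift\<close>.\<close>

lemma DERIV_flat_exp:
  "(flat_exp k has_real_derivative (flat_exp (k + 2) y - real k * flat_exp (Suc k) y)) (at y)"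
proof -
  consider "y > 0" | "y < 0" | "y = 0" by linarith
  then show ?thesis
  proof cases
    case 1
    have "((\<lambda>y. exp (- (1 / y)) / y ^ k) has_real_derivative
        (flat_exp (k + 2) y - real k * flat_exp (Suc k) y)) (at y)"
      using 1 apply (auto intro!: derivative_eq_intros simp: flat_exp_def)
      apply (cases k)
       apply (auto simp: field_simps power2_eq_square)
      done
    then show ?thesis
      by (rule has_field_derivative_transform_within_open[where S = "{0<..}"])
        (use 1 in \<open>auto simp: flat_exp_def\<close>)
  next
    case 2
    have "((\<lambda>y. 0) has_real_derivative (flat_exp (k + 2) y - real k * flat_exp (Suc k) y)) (at y)"
      using 2 by (simp add: flat_exp_def)
    then show ?thesis
      by (rule has_field_derivative_transform_within_open[where S = "{..<0}"])
        (use 2 in \<open>auto simp: flat_exp_def\<close>)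
  next
    case 3
    have "((\<lambda>h. h * flat_exp (k + 2) h) \<longlongrightarrow> 0) (at 0)"
    proof (rule Lim_null_comparison)
      show "eventually (\<lambda>h. norm (h * flat_exp (k + 2) h) \<le> \<bar>h\<bar> * fact (k + 2)) (at 0)"
        by (intro always_eventually) (use flat_exp_bound[of "k + 2"] in
          \<open>auto simp: abs_mult simp del: fact_Suc intro!: mult_left_mono\<close>)
      show "((\<lambda>h::real. \<bar>h\<bar> * fact (k + 2)) \<longlongrightarrow> 0) (at 0)"
        by (auto intro!: tendsto_eq_intros simp del: fact_Suc)
    qed
    moreover have "flat_exp k h / h = h * flat_exp (k + 2) h" for h
      by (subst flat_exp_shift(2)) (auto simp: power2_eq_square)
    ultimately show ?thesis using 3 by (simp add: DERIV_def flat_exp_def[of _ 0])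
  qed
qed

text \<open>For \<open>c > 0\<close> these functions vanish outside \<open>[- 1 / sqrt c, 1 / sqrt c]\<close>. The polynomial factor is
  arbitrary so that iterated derivatives stay within the family.\<close>

definition bump :: "real \<Rightarrow> real poly \<Rightarrow> nat \<Rightarrow> real \<Rightarrow> real" where
  "bump c p k x = poly p x * flat_exp k (1 - c * x\<^sup>2)"

text \<open>With \<open>r = 1 - c x\<^sup>2\<close>, the chain rule produces \<open>flat_exp\<close> of orders \<open>k\<close>, \<open>k + 1\<close> and \<open>k + 2\<close> at \<open>r\<close>;
  by \<open>flat_exp_shift\<close> the first two are \<open>r\<^sup>2\<close> and \<open>r\<close> times the third, which leaves a single polynomial
  factor.\<close>

lemma DERIV_bump:
  "\<exists>q. \<forall>x. (bump c p k has_real_derivative bump c q (k + 2) x) (at x)"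
proof (intro exI allI)
  fix x
  define r where "r = [:1, 0, - c:]"
  let ?q = "pderiv p * [:1, 0, - c:]\<^sup>2 + p * [:0, - 2 * c:] * (1 - smult (real k) [:1, 0, - c:])"
  have r: "poly r x = 1 - c * x\<^sup>2" by (simp add: r_def power2_eq_square)
  have *: "((\<lambda>x. flat_exp k (1 - c * x\<^sup>2)) has_real_derivative
      (flat_exp (k + 2) (1 - c * x\<^sup>2) - real k * flat_exp (Suc k) (1 - c * x\<^sup>2)) * (- (2 * c * x))) (at x)"
    by (rule DERIV_chain2[OF DERIV_flat_exp]) (auto intro!: derivative_eq_intros)
  have "(bump c p k has_real_derivative
      poly (pderiv p) x * flat_exp k (1 - c * x\<^sup>2) +
      (flat_exp (k + 2) (1 - c * x\<^sup>2) - real k * flat_exp (Suc k) (1 - c * x\<^sup>2)) * (- (2 * c * x)) * poly p x) (at x)"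
    unfolding bump_def by (rule DERIV_mult[OF poly_DERIV *])
  moreover have "flat_exp k (1 - c * x\<^sup>2) = (1 - c * x\<^sup>2)\<^sup>2 * flat_exp (k + 2) (1 - c * x\<^sup>2)"
    by (rule flat_exp_shift)
  moreover have "flat_exp (Suc k) (1 - c * x\<^sup>2) = (1 - c * x\<^sup>2) * flat_exp (k + 2) (1 - c * x\<^sup>2)"
    by (subst flat_exp_shift(1)) simp
  ultimately show "(bump c p k has_real_derivative bump c ?q (k + 2) x) (at x)"
    unfolding bump_def[of c ?q] unfolding r_def[symmetric] by (simp add: r poly_power algebra_simps)
qed

lemma iterated_deriv_bump: "\<exists>q m. (deriv ^^ n) (bump c p k) = bump c q m"
proof (induction n)
  case 0 then show ?case by auto
next
  case (Suc n)
  then obtain q m where qm: "(deriv ^^ n) (bump c p k) = bump c q m" by auto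
  obtain q' where "\<And>x. (bump c q m has_real_derivative bump c q' (m + 2) x) (at x)"
    using DERIV_bump by blast
  then have "deriv (bump c q m) = bump c q' (m + 2)" by (intro ext DERIV_imp_deriv)
  then show ?case using qm by auto
qed

lemma smooth_compact_support_bump:
  assumes "c > 0"
  shows "smooth_compact_support (bump c p k)"
  unfolding smooth_compact_support_def
proof (intro conjI allI)
  fix n x
  obtain q m where "(deriv ^^ n) (bump c p k) = bump c q m" using iterated_deriv_bump by blast
  then show "(deriv ^^ n) (bump c p k) differentiable (at x)"
    using DERIV_bump[of c q m] by (auto simp: real_differentiable_def)
next
  have "{x. bump c p k x \<noteq> 0} \<subseteq> cball 0 (1 / sqrt c)"
  proof
    fix x assume "x \<in> {x. bump c p k x \<noteq> 0}"
    then have "c * x\<^sup>2 < 1" by (auto simp: bump_def flat_exp_def split: if_splits)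
    then have "sqrt (x\<^sup>2) < sqrt (1 / c)" using assms by (subst real_sqrt_less_iff) (simp add: field_simps)
    then show "x \<in> cball 0 (1 / sqrt c)" by (simp add: real_sqrt_divide)
  qed
  then show "compact (closure {x. bump c p k x \<noteq> 0})"
    by (meson bounded_cball bounded_subset compact_closure)
qed

text \<open>The factor \<open>exp 1\<close> makes the slope at the origin equal to \<open>l\<close>, so the functions tend to \<open>l x\<close> as
  \<open>c\<close> tends to 0.\<close>

definition soft_linear :: "real \<Rightarrow> real \<Rightarrow> real \<Rightarrow> real" where
  "soft_linear l c = bump c [:0, l * exp 1:] 0"

text \<open>The bound does not depend on \<open>c\<close>: in the derivative \<open>c\<close> occurs only through \<open>c x\<^sup>2\<close>, which is
  less than 1 wherever the function does not vanish.\<close>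

lemma soft_linear_lipschitz:
  assumes "c > 0"
  shows "(5 * exp 1 * \<bar>l\<bar>)-lipschitz_on UNIV (soft_linear l c)"
proof -
  have d: "(soft_linear l c has_real_derivative
      l * exp 1 * (flat_exp 0 (1 - c * x\<^sup>2) - 2 * (c * x\<^sup>2) * flat_exp 2 (1 - c * x\<^sup>2))) (at x)" for x
  proof -
    have *: "((\<lambda>x. flat_exp 0 (1 - c * x\<^sup>2)) has_real_derivative
      (flat_exp 2 (1 - c * x\<^sup>2)) * (- (2 * c * x))) (at x)"
      by (rule DERIV_chain2[OF DERIV_flat_exp[of 0, simplified, folded numeral_2_eq_2]]) (auto intro!: derivative_eq_intros)
    show ?thesis unfolding soft_linear_def bump_def
      using DERIV_mult[OF poly_DERIV[of "[:0, l * exp 1:]" x] *]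
      by (simp add: power2_eq_square algebra_simps pderiv_pCons)
  qed
  have b: "\<bar>flat_exp 0 (1 - c * x\<^sup>2) - 2 * (c * x\<^sup>2) * flat_exp 2 (1 - c * x\<^sup>2)\<bar> \<le> 5" for x
  proof (cases "c * x\<^sup>2 < 1")
    case True
    have "0 \<le> c * x\<^sup>2" using assms by simp
    then have "0 \<le> (c * x\<^sup>2) * flat_exp 2 (1 - c * x\<^sup>2)"
      using flat_exp_bound(1)[of 2 "1 - c * x\<^sup>2"] by (rule mult_nonneg_nonneg)
    moreover have "(c * x\<^sup>2) * flat_exp 2 (1 - c * x\<^sup>2) \<le> 1 * 2"
      by (rule mult_mono) (use True flat_exp_bound[of 2 "1 - c * x\<^sup>2"] in \<open>auto simp: fact_2\<close>)
    ultimately have "\<bar>flat_exp 0 (1 - c * x\<^sup>2) - 2 * ((c * x\<^sup>2) * flat_exp 2 (1 - c * x\<^sup>2))\<bar> \<le> 5"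
      using flat_exp_bound[of 0 "1 - c * x\<^sup>2"] by simp
    then show ?thesis by (simp add: mult.assoc)
  next
    case False
    then show ?thesis by (simp add: flat_exp_def)
  qed
  show ?thesis
  proof (rule bounded_derivative_imp_lipschitz[where f' = "\<lambda>x h. h *
      (l * exp 1 * (flat_exp 0 (1 - c * x\<^sup>2) - 2 * (c * x\<^sup>2) * flat_exp 2 (1 - c * x\<^sup>2)))"])
    show "(soft_linear l c has_derivative (\<lambda>h. h *
      (l * exp 1 * (flat_exp 0 (1 - c * x\<^sup>2) - 2 * (c * x\<^sup>2) * flat_exp 2 (1 - c * x\<^sup>2))))) (at x within UNIV)" for x
      using d[of x] by (simp add: has_field_derivative_def mult_commute_abs)
    show "onorm (\<lambda>h. h * (l * exp 1 * (flat_exp 0 (1 - c * x\<^sup>2) - 2 * (c * x\<^sup>2) * flat_exp 2 (1 - c * x\<^sup>2)))) \<le> 5 * exp 1 * \<bar>l\<bar>" for x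
    proof (rule onorm_bound)
      fix h
      have "\<bar>h\<bar> * \<bar>l * exp 1\<bar> * \<bar>flat_exp 0 (1 - c * x\<^sup>2) - 2 * (c * x\<^sup>2) * flat_exp 2 (1 - c * x\<^sup>2)\<bar> \<le> \<bar>h\<bar> * \<bar>l * exp 1\<bar> * 5"
        by (intro mult_left_mono b) auto
      then show "norm (h * (l * exp 1 * (flat_exp 0 (1 - c * x\<^sup>2) - 2 * (c * x\<^sup>2) * flat_exp 2 (1 - c * x\<^sup>2)))) \<le> 5 * exp 1 * \<bar>l\<bar> * norm h"
        unfolding real_norm_def abs_mult by (simp add: abs_mult mult_ac)
    qed auto
  qed auto
qed

lemma soft_linear_0 [simp]: "soft_linear l c 0 = 0"
  by (simp add: soft_linear_def bump_def)

lemma soft_linear_tendsto: "(\<lambda>n. soft_linear l (inverse (real (Suc n))) x) \<longlonglongrightarrow> l * x"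
proof -
  have "isCont (flat_exp 0) 1" using DERIV_flat_exp DERIV_isCont by blast
  moreover have "(\<lambda>n. 1 - inverse (real (Suc n)) * x\<^sup>2) \<longlonglongrightarrow> 1 - 0 * x\<^sup>2"
    by (intro tendsto_intros LIMSEQ_inverse_real_of_nat)
  ultimately have "(\<lambda>n. flat_exp 0 (1 - inverse (real (Suc n)) * x\<^sup>2)) \<longlonglongrightarrow> flat_exp 0 1"
    by (intro isCont_tendsto_compose[where g = "flat_exp 0"]) simp_all
  then have "(\<lambda>n. (x * (l * exp 1)) * flat_exp 0 (1 - inverse (real (Suc n)) * x\<^sup>2)) \<longlonglongrightarrow> (x * (l * exp 1)) * flat_exp 0 1"
    by (intro tendsto_intros)
  then show ?thesis by (simp add: soft_linear_def bump_def flat_exp_def[of 0 1] exp_minus field_simps)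
qed

text \<open>The derivative is bounded because it is continuous and vanishes off a compact set. So the set
  whose infimum defines \<^const>\<open>lip\<close> is not empty, and the infimum is itself a Lipschitz constant.\<close>

lemma smooth_compact_support_lip:
  assumes "smooth_compact_support f"
  shows "0 \<le> lip f" "\<bar>f x - f y\<bar> \<le> lip f * \<bar>x - y\<bar>"
proof -
  have df: "(deriv ^^ k) f differentiable (at x)" for k x
    using assms by (auto simp: smooth_compact_support_def)
  have d: "(f has_real_derivative deriv f x) (at x)" for x
    using df[of 0 x] by (simp add: DERIV_deriv_iff_real_differentiable)
  have "continuous_on UNIV (deriv f)"
    using df[of 1] by (intro continuous_at_imp_continuous_on) (auto simp: differentiable_imp_continuous_within)
  then have "compact (deriv f ` closure {x. f x \<noteq> 0})"
    using assms by (intro compact_continuous_image) (auto simp: smooth_compact_support_def intro: continuous_on_subset)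
  from compact_imp_bounded[OF this]
  obtain B where B: "\<And>x. x \<in> closure {x. f x \<noteq> 0} \<Longrightarrow> \<bar>deriv f x\<bar> \<le> B"
    unfolding bounded_iff by (metis imageI real_norm_def)
  have B': "\<bar>deriv f x\<bar> \<le> \<bar>B\<bar>" for x
  proof (cases "x \<in> closure {x. f x \<noteq> 0}")
    case True then show ?thesis using B[of x] by linarith
  next
    case False
    have "(f has_real_derivative 0) (at x)"
      by (rule has_field_derivative_transform_within_open[where S = "- closure {x. f x \<noteq> 0}" and f = "\<lambda>_. 0"])
        (use False closure_subset[of "{x. f x \<noteq> 0}"] in auto)
    then show ?thesis by (simp add: DERIV_imp_deriv)
  qed
  have lp: "\<bar>B\<bar>-lipschitz_on UNIV f"
  proof (rule bounded_derivative_imp_lipschitz[where f' = "\<lambda>x h. deriv f x * h"])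
    show "onorm (\<lambda>h. deriv f x * h) \<le> \<bar>B\<bar>" for x
      by (rule onorm_bound) (auto simp: abs_mult intro!: mult_right_mono B')
  qed (use d in \<open>auto simp: has_field_derivative_def\<close>)
  show "0 \<le> lip f" unfolding lip_def
  proof (rule cInf_greatest)
    show "{L. L-lipschitz_on UNIV f} \<noteq> {}" using lp by blast
  qed (auto simp: lipschitz_on_def)
  show "\<bar>f x - f y\<bar> \<le> lip f * \<bar>x - y\<bar>"
  proof (cases "x = y")
    case False
    have "\<bar>f x - f y\<bar> / \<bar>x - y\<bar> \<le> lip f" unfolding lip_def
    proof (rule cInf_greatest)
      fix L assume "L \<in> {L. L-lipschitz_on UNIV f}"
      then have "\<bar>f x - f y\<bar> \<le> L * \<bar>x - y\<bar>"
        by (auto simp: lipschitz_on_def dist_real_def)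
      then show "\<bar>f x - f y\<bar> / \<bar>x - y\<bar> \<le> L" using False by (simp add: field_simps)
    qed (use lp in auto)
    then show ?thesis using False by (simp add: field_simps)
  qed simp
qed

lemma lip_le: "L-lipschitz_on UNIV f \<Longrightarrow> lip f \<le> L"
  unfolding lip_def by (intro cInf_lower bdd_belowI[of _ 0]) (auto simp: lipschitz_on_def)

lemma smooth_compact_support_continuous:
  assumes "smooth_compact_support f"
  shows "isCont f x" "\<exists>B. \<forall>x. \<bar>f x\<bar> \<le> B"
proof -
  have df: "(deriv ^^ k) f differentiable (at x)" for k x
    using assms by (auto simp: smooth_compact_support_def)
  show c: "isCont f x" for x using df[of 0 x] by (simp add: differentiable_imp_continuous_within)
  then have "compact (f ` closure {x. f x \<noteq> 0})"
    using assms by (intro compact_continuous_image)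
      (auto simp: smooth_compact_support_def intro: continuous_at_imp_continuous_on)
  from compact_imp_bounded[OF this]
  obtain B where B: "\<And>x. x \<in> closure {x. f x \<noteq> 0} \<Longrightarrow> \<bar>f x\<bar> \<le> B"
    unfolding bounded_iff by (metis imageI real_norm_def)
  then have "\<bar>f x\<bar> \<le> \<bar>B\<bar>" for x
    using closure_subset[of "{x. f x \<noteq> 0}"] by (cases "f x = 0") force+
  then show "\<exists>B. \<forall>x. \<bar>f x\<bar> \<le> B" by blast
qed

section \<open>Gaussian concentration and exponential moments\<close>

text \<open>The factor \<open>A\<close> makes room for laws that are not centred.\<close>

definition subgaussian :: "real \<Rightarrow> real \<Rightarrow> real measure \<Rightarrow> bool" where
  "subgaussian A B \<mu> \<longleftrightarrow>
     (\<forall>l. (\<integral>\<^sup>+x. ennreal (exp (l * x)) \<partial>\<mu>) \<le> ennreal (A * exp (B * l\<^sup>2)))"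

lemma nn_integral_limit_le:
  fixes u :: "nat \<Rightarrow> 'a \<Rightarrow> ennreal"
  assumes [measurable]: "\<And>n. u n \<in> borel_measurable M"
    and lim: "AE x in M. (\<lambda>n. u n x) \<longlonglongrightarrow> v x"
    and le: "\<And>n. (\<integral>\<^sup>+x. u n x \<partial>M) \<le> K"
  shows "(\<integral>\<^sup>+x. v x \<partial>M) \<le> K"
proof -
  have "(\<integral>\<^sup>+x. v x \<partial>M) = (\<integral>\<^sup>+x. liminf (\<lambda>n. u n x) \<partial>M)"
    by (rule nn_integral_cong_AE) (use lim in \<open>auto elim!: eventually_mono dest!: lim_imp_Liminf[rotated]\<close>)
  also have "\<dots> \<le> liminf (\<lambda>n. \<integral>\<^sup>+x. u n x \<partial>M)" by (rule nn_integral_liminf) simp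
  also have "\<dots> \<le> limsup (\<lambda>n. \<integral>\<^sup>+x. u n x \<partial>M)" by (rule Liminf_le_Limsup) simp
  also have "\<dots> \<le> K" by (rule Limsup_bounded) (simp add: le)
  finally show ?thesis .
qed

lemma exp_le_quadratic: "exp u \<le> 1 + u + u\<^sup>2 * exp \<bar>u\<bar>" for u :: real
proof -
  obtain t where t: "\<bar>t\<bar> \<le> \<bar>u\<bar>" "exp u = (\<Sum>m<2. (u ^ m) / fact m) + (exp t / fact 2) * u ^ 2"
    using Maclaurin_exp_le[of u 2] by blast
  have "exp t * u\<^sup>2 \<le> exp \<bar>u\<bar> * u\<^sup>2" using t(1) by (intro mult_right_mono) auto
  moreover have "0 \<le> exp \<bar>u\<bar> * u\<^sup>2" by simp
  ultimately show ?thesis using t(2) by (simp add: numeral_2_eq_2 algebra_simps)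
qed

lemma square_le_exp_abs: "u\<^sup>2 \<le> 2 * exp \<bar>u\<bar>" for u :: real
  using exp_lower_Taylor_quadratic[of "\<bar>u\<bar>"] by simp

text \<open>After centring at \<open>f 0\<close> one has \<open>|f x| \<le> L |x|\<close>. For \<open>L \<ge> 1\<close> crude bounds are absorbed by
  \<open>exp (D L\<^sup>2)\<close>. For small \<open>L\<close> they are not, and a second order expansion of the exponential
  is needed: with \<open>m = \<integral> (f - f 0) d\<mu>\<close>, the linear part \<open>e\<^sup>-\<^sup>m (1 + m)\<close> is at most 1 and the remainder is of
  order \<open>L\<^sup>2\<close>. The constant is obtained before the law is fixed, so that it serves a whole family of
  laws.\<close>

lemma subgaussian_imp_GCBS:
  assumes A: "A \<ge> 1" and B: "B \<ge> 0"
  obtains D where "D > 0" "\<And>\<mu>. real_distribution \<mu> \<Longrightarrow> subgaussian A B \<mu> \<Longrightarrow> GCBS D \<mu>"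
proof -
  define K where "K = 2 * A * exp B"
  define K2 where "K2 = 4 * A * exp (4 * B)"
  define D where "D = K2 * exp K + (K + ln (2 * A) + B)"
  have pos: "K > 0" "K2 > 0" "ln (2 * A) \<ge> 0" using A by (auto simp: K_def K2_def)
  have "D > 0" unfolding D_def using pos B by (intro add_pos_nonneg) auto
  moreover have "GCBS D \<mu>" if rd: "real_distribution \<mu>" and sg: "subgaussian A B \<mu>" for \<mu>
    unfolding GCBS_def
  proof (intro allI impI)
    fix f assume f: "smooth_compact_support f"
    interpret real_distribution \<mu> by (rule rd)
    have ie: "integrable \<mu> (\<lambda>x. exp (l * x))" for l
    proof (rule integrableI_bounded)
      have "(\<integral>\<^sup>+x. ennreal (norm (exp (l * x))) \<partial>\<mu>) \<le> ennreal (A * exp (B * l\<^sup>2))"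
        using sg by (simp add: subgaussian_def)
      then show "(\<integral>\<^sup>+x. ennreal (norm (exp (l * x))) \<partial>\<mu>) < \<infinity>"
        by (rule le_less_trans) simp
    qed measurable
    have be: "(\<integral>x. exp (l * x) \<partial>\<mu>) \<le> A * exp (B * l\<^sup>2)" for l
    proof -
      have "ennreal (\<integral>x. exp (l * x) \<partial>\<mu>) = (\<integral>\<^sup>+x. ennreal (exp (l * x)) \<partial>\<mu>)"
        by (rule nn_integral_eq_integral[symmetric, OF ie]) simp
      also have "\<dots> \<le> ennreal (A * exp (B * l\<^sup>2))" using sg by (simp add: subgaussian_def)
      finally show ?thesis using A by (subst (asm) ennreal_le_iff) auto
    qed
    have sum_exp: "exp (l * \<bar>x\<bar>) \<le> exp (l * x) + exp (- l * x)" for l x :: real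
      by (cases "x \<ge> 0") (auto simp: add_increasing add_increasing2)
    have ia: "integrable \<mu> (\<lambda>x. exp (l * \<bar>x\<bar>))" for l
      by (rule Bochner_Integration.integrable_bound[OF Bochner_Integration.integrable_add[OF ie[of l] ie[of "- l"]]])
        (use sum_exp[of l] in \<open>auto intro!: order.trans[OF _ abs_ge_self]\<close>)
    have ba: "(\<integral>x. exp (l * \<bar>x\<bar>) \<partial>\<mu>) \<le> 2 * A * exp (B * l\<^sup>2)" for l
    proof -
      have "(\<integral>x. exp (l * \<bar>x\<bar>) \<partial>\<mu>) \<le> (\<integral>x. exp (l * x) + exp (- l * x) \<partial>\<mu>)"
        by (intro integral_mono ia Bochner_Integration.integrable_add ie sum_exp)
      also have "\<dots> = (\<integral>x. exp (l * x) \<partial>\<mu>) + (\<integral>x. exp (- l * x) \<partial>\<mu>)"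
        by (intro Bochner_Integration.integral_add ie)
      finally show ?thesis using be[of l] be[of "- l"] by simp
    qed
    have le_exp: "\<bar>x\<bar> \<le> exp \<bar>x\<bar>" for x :: real
      using exp_ge_add_one_self[of "\<bar>x\<bar>"] by linarith
    have iabs: "integrable \<mu> (\<lambda>x. \<bar>x\<bar>)"
      by (rule Bochner_Integration.integrable_bound[OF ia[of 1]]) (use le_exp in auto)
    have Eabs: "(\<integral>x. \<bar>x\<bar> \<partial>\<mu>) \<le> K"
    proof -
      have "(\<integral>x. \<bar>x\<bar> \<partial>\<mu>) \<le> (\<integral>x. exp (1 * \<bar>x\<bar>) \<partial>\<mu>)"
        by (intro integral_mono iabs ia) (use le_exp in simp)
      with ba[of 1] show ?thesis by (simp add: K_def)
    qed
    define L where "L = lip f"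
    have L: "L \<ge> 0" "\<And>x y. \<bar>f x - f y\<bar> \<le> L * \<bar>x - y\<bar>"
      using smooth_compact_support_lip[OF f] by (auto simp: L_def)
    obtain C where C: "\<And>x. \<bar>f x\<bar> \<le> C" using smooth_compact_support_continuous[OF f] by blast
    define g where "g x = f x - f 0" for x
    have g: "\<bar>g x\<bar> \<le> L * \<bar>x\<bar>" for x using L(2)[of x 0] by (simp add: g_def)
    have "continuous_on UNIV f" using smooth_compact_support_continuous(1)[OF f]
      by (simp add: continuous_at_imp_continuous_on)
    then have fm[measurable]: "f \<in> borel_measurable borel" by (rule borel_measurable_continuous_onI)
    then have [measurable]: "g \<in> borel_measurable borel" unfolding g_def by measurable
    have fi: "integrable \<mu> f" by (rule integrable_const_bound[of _ C]) (use C in auto)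
    then have gi: "integrable \<mu> g" by (simp add: g_def[abs_def])
    have "g x \<le> C + C" for x using C[of x] C[of 0] by (auto simp: g_def)
    then have egi: "integrable \<mu> (\<lambda>x. exp (g x))"
      by (intro integrable_const_bound[of _ "exp (C + C)"]) auto
    define m where "m = (\<integral>x. g x \<partial>\<mu>)"
    have "m = (\<integral>x. f x \<partial>\<mu>) - f 0" using fi using prob_space by (simp add: m_def g_def[abs_def])
    then have "exp (f x - (\<integral>y. f y \<partial>\<mu>)) = exp (- m) * exp (g x)" for x
      by (simp add: g_def flip: exp_add)
    then have E: "(\<integral>x. exp (f x - (\<integral>y. f y \<partial>\<mu>)) \<partial>\<mu>) = exp (- m) * (\<integral>x. exp (g x) \<partial>\<mu>)"
      by simp
    have mL: "\<bar>m\<bar> \<le> L * K"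
    proof -
      have "\<bar>m\<bar> \<le> (\<integral>x. \<bar>g x\<bar> \<partial>\<mu>)" unfolding m_def by (rule integral_abs_bound)
      also have "\<dots> \<le> (\<integral>x. L * \<bar>x\<bar> \<partial>\<mu>)" by (intro integral_mono) (use gi iabs g in auto)
      also have "\<dots> \<le> L * K" using Eabs L by (simp add: mult_left_mono)
      finally show ?thesis .
    qed
    have "exp (- m) * (\<integral>x. exp (g x) \<partial>\<mu>) \<le> exp (D * L\<^sup>2)"
    proof (cases "L \<le> 1")
      case True
      have gx: "exp (g x) \<le> 1 + g x + 2 * L\<^sup>2 * exp (2 * \<bar>x\<bar>)" for x
      proof -
        have "(g x)\<^sup>2 \<le> (L * \<bar>x\<bar>)\<^sup>2" using g[of x] by (metis abs_ge_zero power2_abs power_mono)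
        also have "\<dots> \<le> L\<^sup>2 * (2 * exp \<bar>x\<bar>)"
          using square_le_exp_abs[of x] by (simp add: power_mult_distrib mult_left_mono)
        finally have 1: "(g x)\<^sup>2 \<le> L\<^sup>2 * (2 * exp \<bar>x\<bar>)" .
        have "\<bar>g x\<bar> \<le> \<bar>x\<bar>" using g[of x] True L(1) by (metis abs_ge_zero mult_left_le_one_le order.trans)
        then have 2: "exp \<bar>g x\<bar> \<le> exp \<bar>x\<bar>" by simp
        have "(g x)\<^sup>2 * exp \<bar>g x\<bar> \<le> L\<^sup>2 * (2 * exp \<bar>x\<bar>) * exp \<bar>x\<bar>"
          using 1 2 by (intro mult_mono) auto
        also have "\<dots> = 2 * L\<^sup>2 * exp (2 * \<bar>x\<bar>)" by (simp flip: exp_add)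
        finally show ?thesis using exp_le_quadratic[of "g x"] by simp
      qed
      have "(\<integral>x. exp (g x) \<partial>\<mu>) \<le> (\<integral>x. 1 + g x + 2 * L\<^sup>2 * exp (2 * \<bar>x\<bar>) \<partial>\<mu>)"
        by (intro integral_mono gx egi) (use gi ia[of 2] in auto)
      also have "\<dots> = 1 + m + 2 * L\<^sup>2 * (\<integral>x. exp (2 * \<bar>x\<bar>) \<partial>\<mu>)"
        using gi ia[of 2] prob_space by (simp add: m_def)
      also have "\<dots> \<le> 1 + m + 2 * L\<^sup>2 * (2 * A * exp (B * 2\<^sup>2))"
        by (intro add_left_mono mult_left_mono ba) auto
      also have "\<dots> = 1 + m + L\<^sup>2 * K2" by (simp add: K2_def mult.commute)
      finally have "exp (- m) * (\<integral>x. exp (g x) \<partial>\<mu>) \<le> exp (- m) * (1 + m + L\<^sup>2 * K2)"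
        by (intro mult_left_mono) auto
      also have "\<dots> = exp (- m) * (1 + m) + exp (- m) * (L\<^sup>2 * K2)" by (simp add: algebra_simps)
      also have "\<dots> \<le> 1 + exp K * (L\<^sup>2 * K2)"
      proof (intro add_mono mult_right_mono)
        have "exp (- m) * (1 + m) \<le> exp (- m) * exp m"
          by (intro mult_left_mono) (use exp_ge_add_one_self[of m] in auto)
        then show "exp (- m) * (1 + m) \<le> 1" by (simp flip: exp_add)
        have "L * K \<le> K" using True pos by (simp add: mult_left_le_one_le L)
        then show "exp (- m) \<le> exp K" using mL by simp
      qed (use pos in auto)
      also have "\<dots> \<le> exp (exp K * (L\<^sup>2 * K2))" by (rule exp_ge_add_one_self)
      also have "\<dots> \<le> exp (D * L\<^sup>2)"
      proof -
        have "K2 * exp K * L\<^sup>2 \<le> D * L\<^sup>2"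
          unfolding D_def using pos B by (intro mult_right_mono) auto
        then show ?thesis by (simp add: algebra_simps)
      qed
      finally show ?thesis .
    next
      case False
      have "(\<integral>x. exp (g x) \<partial>\<mu>) \<le> (\<integral>x. exp (L * \<bar>x\<bar>) \<partial>\<mu>)"
        by (intro integral_mono egi ia) (use g in \<open>auto intro: order.trans[OF abs_ge_self]\<close>)
      also have "\<dots> \<le> 2 * A * exp (B * L\<^sup>2)" by (rule ba)
      finally have "exp (- m) * (\<integral>x. exp (g x) \<partial>\<mu>) \<le> exp (L * K) * (2 * A * exp (B * L\<^sup>2))"
        using mL by (intro mult_mono) auto
      also have "\<dots> = exp (L * K + ln (2 * A) + B * L\<^sup>2)"
        using A by (simp add: exp_add)
      also have "\<dots> \<le> exp (D * L\<^sup>2)"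
      proof -
        have "L \<le> L\<^sup>2" "1 \<le> L\<^sup>2" using False self_le_power[of L 2] one_le_power[of L 2] by auto
        then have "L * K \<le> L\<^sup>2 * K" "1 * ln (2 * A) \<le> L\<^sup>2 * ln (2 * A)"
          using pos by (intro mult_right_mono; simp)+
        moreover have "0 \<le> K2 * exp K * L\<^sup>2" using pos by simp
        ultimately show ?thesis by (simp add: D_def algebra_simps)
      qed
      finally show ?thesis .
    qed
    moreover have "exp (- m) * (\<integral>x. exp (g x) \<partial>\<mu>) > 0"
    proof -
      have "exp (- (C + C)) \<le> exp (g x)" for x using C[of x] C[of 0] by (auto simp: g_def)
      then have "(\<integral>x. exp (- (C + C)) \<partial>\<mu>) \<le> (\<integral>x. exp (g x) \<partial>\<mu>)"
        by (intro integral_mono egi) auto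
      then have "exp (- (C + C)) \<le> (\<integral>x. exp (g x) \<partial>\<mu>)" using prob_space by simp
      then have "0 < (\<integral>x. exp (g x) \<partial>\<mu>)" by (rule less_le_trans[OF exp_gt_zero])
      then show ?thesis by simp
    qed
    ultimately have "ln (exp (- m) * (\<integral>x. exp (g x) \<partial>\<mu>)) \<le> D * L\<^sup>2"
      by (metis ln_exp ln_le_cancel_iff exp_gt_zero)
    then show "ln (\<integral>x. exp (f x - (\<integral>y. f y \<partial>\<mu>)) \<partial>\<mu>) \<le> D * (lip f)\<^sup>2"
      by (simp add: E L_def)
  qed
  ultimately show ?thesis using that by blast
qed

text \<open>The bound is tested on the cut-offs of \<open>l x\<close>, whose Lipschitz constants are uniformly
  proportional to \<open>|l|\<close>. It controls the exponential moment of a test function up to its mean. The mean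
  is controlled by the bound for \<open>- f\<close>: on \<open>[- R, R]\<close>, which carries at least half of the mass, \<open>f\<close> is
  at most \<open>\<Lambda> R\<close>, so a larger mean would make \<open>exp (\<integral> f d\<mu> - f)\<close> large there. Fatou's lemma removes the
  cut-off.\<close>

lemma GCBS_imp_subgaussian:
  assumes rd: "real_distribution \<mu>" and D: "D \<ge> 0" and gc: "GCBS D \<mu>"
  obtains A B where "A \<ge> 1" "B \<ge> 0" "subgaussian A B \<mu>"
proof -
  interpret real_distribution \<mu> by (rule rd)
  have test: "(\<integral>x. exp (f x) \<partial>\<mu>) \<le> exp (D * L\<^sup>2 + (\<integral>x. f x \<partial>\<mu>))"
    if f: "smooth_compact_support f" and L: "L-lipschitz_on UNIV f" for f L
  proof -
    obtain C where C: "\<And>x. \<bar>f x\<bar> \<le> C" using smooth_compact_support_continuous[OF f] by blast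
    have "continuous_on UNIV f" using smooth_compact_support_continuous(1)[OF f]
      by (simp add: continuous_at_imp_continuous_on)
    then have fm[measurable]: "f \<in> borel_measurable borel" by (rule borel_measurable_continuous_onI)
    have "f x \<le> C" for x using C[of x] by simp
    then have efi: "integrable \<mu> (\<lambda>x. exp (f x))"
      by (intro integrable_const_bound[of _ "exp C"]) auto
    define m where "m = (\<integral>x. f x \<partial>\<mu>)"
    have "exp (- C) \<le> exp (f x)" for x using C[of x] by (auto simp: abs_le_iff)
    then have "(\<integral>x. exp (- C) \<partial>\<mu>) \<le> (\<integral>x. exp (f x) \<partial>\<mu>)"
      by (intro integral_mono efi) auto
    then have "exp (- C) \<le> (\<integral>x. exp (f x) \<partial>\<mu>)" using prob_space by simp
    then have p: "0 < (\<integral>x. exp (f x) \<partial>\<mu>)" by (rule less_le_trans[OF exp_gt_zero])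
    have "(\<integral>x. exp (f x - (\<integral>y. f y \<partial>\<mu>)) \<partial>\<mu>) = (\<integral>x. exp (f x) \<partial>\<mu>) / exp m"
      by (simp add: m_def exp_diff)
    then have "ln ((\<integral>x. exp (f x) \<partial>\<mu>) / exp m) \<le> D * (lip f)\<^sup>2"
      using gc[unfolded GCBS_def, rule_format, OF f] by simp
    also have "\<dots> \<le> D * L\<^sup>2"
      using lip_le[OF L] smooth_compact_support_lip(1)[OF f] D by (intro mult_left_mono power_mono)
    finally have "ln (\<integral>x. exp (f x) \<partial>\<mu>) \<le> D * L\<^sup>2 + m" using p by (simp add: ln_div)
    then have "exp (ln (\<integral>x. exp (f x) \<partial>\<mu>)) \<le> exp (D * L\<^sup>2 + m)" by simp
    then show ?thesis using p by (simp add: m_def)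
  qed
  obtain R where R: "R \<ge> 0" "measure \<mu> {-R..R} \<ge> 1/2"
  proof -
    have "(\<lambda>n. measure \<mu> {- real n..real n}) \<longlonglongrightarrow> measure \<mu> (\<Union>n. {- real n..real n})"
      by (rule finite_Lim_measure_incseq) (auto simp: incseq_def)
    moreover have "(\<Union>n. {- real n..real n}) = UNIV"
    proof (rule UNIV_eq_I[symmetric])
      fix x :: real
      obtain n where "\<bar>x\<bar> \<le> real n" using real_arch_simple by blast
      then show "x \<in> (\<Union>n. {- real n..real n})" by (auto intro!: exI[of _ n])
    qed
    ultimately have "(\<lambda>n. measure \<mu> {- real n..real n}) \<longlonglongrightarrow> 1" using prob_space by simp
    then have "eventually (\<lambda>n. measure \<mu> {- real n..real n} > 1/2) sequentially"
      by (rule order_tendstoD) simp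
    then obtain n where "measure \<mu> {- real n..real n} > 1/2" by (auto simp: eventually_sequentially)
    then show ?thesis using that[of "real n"] by simp
  qed
  define A where "A = 2 * exp (R\<^sup>2)"
  define B where "B = (2 * D + 1) * (5 * exp 1)\<^sup>2"
  have "subgaussian A B \<mu>" unfolding subgaussian_def
  proof
    fix l :: real
    define \<Lambda> where "\<Lambda> = 5 * exp 1 * \<bar>l\<bar>"
    have \<Lambda>: "\<Lambda> \<ge> 0" by (simp add: \<Lambda>_def)
    have bd: "(\<integral>\<^sup>+x. ennreal (exp (soft_linear l c x)) \<partial>\<mu>) \<le> ennreal (A * exp (B * l\<^sup>2))"
      and ms: "soft_linear l c \<in> borel_measurable borel"
      if c: "c > 0" for c
    proof -
      let ?f = "soft_linear l c"
      have neg: "soft_linear (- l) c x = - ?f x" for x by (simp add: soft_linear_def bump_def)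
      have f: "smooth_compact_support ?f" "smooth_compact_support (\<lambda>x. - ?f x)"
        using smooth_compact_support_bump[OF c, of "[:0, l * exp 1:]" 0]
          smooth_compact_support_bump[OF c, of "[:0, - l * exp 1:]" 0]
        unfolding neg[symmetric] by (auto simp: soft_linear_def[abs_def])
      have lp: "\<Lambda>-lipschitz_on UNIV ?f" "\<Lambda>-lipschitz_on UNIV (\<lambda>x. - ?f x)"
        using soft_linear_lipschitz[OF c, of l] soft_linear_lipschitz[OF c, of "- l"]
        by (auto simp: \<Lambda>_def simp flip: neg)
      obtain C where C: "\<And>x. \<bar>?f x\<bar> \<le> C" using smooth_compact_support_continuous[OF f(1)] by blast
      have "continuous_on UNIV ?f" using smooth_compact_support_continuous(1)[OF f(1)]
        by (simp add: continuous_at_imp_continuous_on)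
      then show fm[measurable]: "?f \<in> borel_measurable borel" by (rule borel_measurable_continuous_onI)
      have "?f x \<le> C" "- ?f x \<le> C" for x using C[of x] by (auto simp: abs_le_iff)
      then have efi: "integrable \<mu> (\<lambda>x. exp (?f x))" "integrable \<mu> (\<lambda>x. exp (- ?f x))"
        by (intro integrable_const_bound[of _ "exp C"]; auto)+
      define m where "m = (\<integral>x. ?f x \<partial>\<mu>)"
      have "exp (- (\<Lambda> * R)) * (1/2) \<le> exp (- (\<Lambda> * R)) * measure \<mu> {-R..R}"
        using R by (intro mult_left_mono) auto
      also have "\<dots> = (\<integral>x. exp (- (\<Lambda> * R)) * indicator {-R..R} x \<partial>\<mu>)" by simp
      also have "\<dots> \<le> (\<integral>x. exp (- ?f x) \<partial>\<mu>)"
      proof (intro integral_mono efi)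
        fix x
        show "exp (- (\<Lambda> * R)) * indicator {-R..R} x \<le> exp (- ?f x)"
        proof (cases "x \<in> {-R..R}")
          case True
          have "\<bar>?f x - ?f 0\<bar> \<le> \<Lambda> * \<bar>x - 0\<bar>"
            using lp(1) unfolding lipschitz_on_def dist_real_def by blast
          also have "\<dots> \<le> \<Lambda> * R" using True \<Lambda> by (intro mult_left_mono) auto
          finally show ?thesis using True by (auto simp: abs_le_iff)
        qed simp
      qed (auto intro!: integrable_real_indicator simp: less_top[symmetric])
      also have "\<dots> \<le> exp (D * \<Lambda>\<^sup>2 + (\<integral>x. - ?f x \<partial>\<mu>))" by (rule test[OF f(2) lp(2)])
      also have "\<dots> = exp (D * \<Lambda>\<^sup>2) * exp (- m)" by (simp add: m_def exp_add[symmetric])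
      finally have "exp m \<le> 2 * exp (D * \<Lambda>\<^sup>2) * exp (\<Lambda> * R)"
        by (simp add: exp_minus field_simps)
      then have "exp (D * \<Lambda>\<^sup>2) * exp m \<le> exp (D * \<Lambda>\<^sup>2) * (2 * exp (D * \<Lambda>\<^sup>2) * exp (\<Lambda> * R))"
        by (intro mult_left_mono) auto
      also have "\<dots> = 2 * exp (2 * D * \<Lambda>\<^sup>2 + \<Lambda> * R)" by (simp flip: exp_add)
      also have "\<dots> \<le> 2 * exp (2 * D * \<Lambda>\<^sup>2 + (\<Lambda>\<^sup>2 + R\<^sup>2))"
      proof -
        have "0 \<le> (\<Lambda> - R)\<^sup>2" "0 \<le> \<Lambda> * R" using \<Lambda> R by auto
        then have "\<Lambda> * R \<le> \<Lambda>\<^sup>2 + R\<^sup>2" by (simp add: power2_diff)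
        then show ?thesis by simp
      qed
      also have "\<dots> = A * exp (B * l\<^sup>2)"
        by (simp add: A_def B_def \<Lambda>_def power_mult_distrib algebra_simps flip: exp_add)
      finally have "(\<integral>x. exp (?f x) \<partial>\<mu>) \<le> A * exp (B * l\<^sup>2)"
        using test[OF f(1) lp(1)] by (simp add: m_def exp_add)
      then show "(\<integral>\<^sup>+x. ennreal (exp (?f x)) \<partial>\<mu>) \<le> ennreal (A * exp (B * l\<^sup>2))"
        by (subst nn_integral_eq_integral[OF efi(1)]) (auto intro: ennreal_leI)
    qed
    show "(\<integral>\<^sup>+x. ennreal (exp (l * x)) \<partial>\<mu>) \<le> ennreal (A * exp (B * l\<^sup>2))"
    proof (rule nn_integral_limit_le)
      show "(\<lambda>x. ennreal (exp (soft_linear l (inverse (real (Suc n))) x))) \<in> borel_measurable \<mu>" for n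
        using ms[of "inverse (real (Suc n))"] by measurable
      show "AE x in \<mu>. (\<lambda>n. ennreal (exp (soft_linear l (inverse (real (Suc n))) x))) \<longlonglongrightarrow> ennreal (exp (l * x))"
        by (intro always_eventually allI tendsto_ennrealI tendsto_exp soft_linear_tendsto)
    qed (rule bd, simp)
  qed
  moreover have "A \<ge> 1" using one_le_exp_iff[of "R\<^sup>2"] zero_le_power2[of R] unfolding A_def by linarith
  moreover have "B \<ge> 0" using D by (simp add: B_def)
  ultimately show ?thesis using that by blast
qed

section \<open>Brownian increments and the past\<close>

text \<open>Completing the square turns the integrand into a multiple of a shifted normal density.\<close>

lemma normal_exponential_moment:
  assumes "\<sigma> > 0"
  shows "(\<integral>\<^sup>+y. ennreal (normal_density 0 \<sigma> y) * ennreal (exp (a * y)) \<partial>lborel) = ennreal (exp (a\<^sup>2 * \<sigma>\<^sup>2 / 2))"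
proof -
  have "normal_density 0 \<sigma> y * exp (a * y) = exp (a\<^sup>2 * \<sigma>\<^sup>2 / 2) * normal_density (a * \<sigma>\<^sup>2) \<sigma> y" for y
  proof -
    have "- (y\<^sup>2) / (2 * \<sigma>\<^sup>2) + a * y = a\<^sup>2 * \<sigma>\<^sup>2 / 2 + - ((y - a * \<sigma>\<^sup>2)\<^sup>2) / (2 * \<sigma>\<^sup>2)"
      using assms by (simp add: field_simps power2_eq_square)
    then show ?thesis
      by (simp add: normal_density_def mult.left_commute mult.assoc flip: exp_add)
  qed
  then have "(\<integral>\<^sup>+y. ennreal (normal_density 0 \<sigma> y) * ennreal (exp (a * y)) \<partial>lborel) =
      (\<integral>\<^sup>+y. ennreal (exp (a\<^sup>2 * \<sigma>\<^sup>2 / 2)) * ennreal (normal_density (a * \<sigma>\<^sup>2) \<sigma> y) \<partial>lborel)"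
    by (simp flip: ennreal_mult)
  also have "\<dots> = ennreal (exp (a\<^sup>2 * \<sigma>\<^sup>2 / 2)) * (\<integral>\<^sup>+y. ennreal (normal_density (a * \<sigma>\<^sup>2) \<sigma> y) \<partial>lborel)"
    by (rule nn_integral_cmult) simp
  also have "(\<integral>\<^sup>+y. ennreal (normal_density (a * \<sigma>\<^sup>2) \<sigma> y) \<partial>lborel) = ennreal 1"
    using assms by (subst nn_integral_eq_integral) auto
  finally show ?thesis by simp
qed

locale brownian_filtration = prob_space P for P :: "'a measure" +
  fixes F :: "real \<Rightarrow> 'a measure" and W :: "real \<Rightarrow> 'a \<Rightarrow> real"
  assumes filtered: "filtered_prob_space P F" and brownian: "brownian_motion P F W"
begin

lemma space_F [simp]: "space (F t) = space P"
  using filtered by (auto simp: filtered_prob_space_def filtration_def)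

lemma subalgebra_F: "subalgebra P (F t)"
  using filtered by (auto simp: filtered_prob_space_def)

lemma measurable_F_mono:
  assumes "f \<in> measurable (F s) N" "s \<le> t" shows "f \<in> measurable (F t) N"
proof -
  have "sets (F s) \<subseteq> sets (F t)"
    using filtered assms(2) by (auto simp: filtered_prob_space_def filtration_def)
  then show ?thesis using measurable_mono[of N N "F s" "F t"] assms(1) by auto
qed

lemma measurable_F_P: "f \<in> measurable (F s) N \<Longrightarrow> f \<in> measurable P N"
  by (rule measurable_from_subalg[OF subalgebra_F])

lemma ident_measurable: "(\<lambda>\<omega>. \<omega>) \<in> P \<rightarrow>\<^sub>M F t"
  by (rule measurable_F_P[OF measurable_ident_sets[OF refl]])

definition incr :: "real \<Rightarrow> real \<Rightarrow> 'a \<Rightarrow> real" where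
  "incr a b \<omega> = W b \<omega> - W a \<omega>"

lemma incr_measurable: "0 \<le> a \<Longrightarrow> a \<le> b \<Longrightarrow> incr a b \<in> borel_measurable (F b)"
  using brownian unfolding incr_def[abs_def] brownian_motion_def
  by (intro borel_measurable_diff) (auto intro: measurable_F_mono)

lemma incr_distributed:
  "0 \<le> a \<Longrightarrow> a < b \<Longrightarrow> distributed P lborel (incr a b) (normal_density 0 (sqrt (b - a)))"
  using brownian unfolding incr_def[abs_def] brownian_motion_def by blast

lemma incr_measurable_P: "0 \<le> a \<Longrightarrow> a \<le> b \<Longrightarrow> incr a b \<in> borel_measurable P"
  by (rule measurable_F_P[OF incr_measurable])

lemma incr_indep_set:
  assumes "0 \<le> a" "a < b"
  shows "indep_set (sets (F a)) (sets (vimage_algebra (space P) (incr a b) borel))"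
  using brownian assms unfolding incr_def[abs_def] brownian_motion_def by blast

lemma incr_indep_var:
  assumes ab: "0 \<le> a" "a < b" and Z: "Z \<in> borel_measurable (F a)" and g: "g \<in> borel_measurable borel"
  shows "indep_var borel Z borel (\<lambda>\<omega>. g (incr a b \<omega>) :: real)"
proof -
  have "sigma_sets (space P) {Z -` A \<inter> space P |A. A \<in> sets borel} \<subseteq> sets (F a)"
    using sets.sigma_sets_subset[of "{Z -` A \<inter> space P |A. A \<in> sets borel}" "F a"]
      measurable_sets[OF Z] by auto
  moreover have "indep_set (sets (F a))
      (sigma_sets (space P) {incr a b -` A \<inter> space P |A. A \<in> sets borel})"
    using incr_indep_set[OF ab] by (simp add: sets_vimage_algebra)
  ultimately have "indep_set (sigma_sets (space P) {Z -` A \<inter> space P |A. A \<in> sets borel})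
      (sigma_sets (space P) {incr a b -` A \<inter> space P |A. A \<in> sets borel})"
    unfolding indep_sets2_eq by blast
  then have "indep_var borel Z borel (incr a b)"
    unfolding indep_var_eq using ab incr_measurable_P[of a b] measurable_F_P[OF Z] by simp
  from indep_var_compose[OF this measurable_ident g] show ?thesis by (simp add: comp_def)
qed

lemma distr_past_incr:
  assumes ab: "0 \<le> a" "a < b"
  shows "distr P (F a) (\<lambda>\<omega>. \<omega>) \<Otimes>\<^sub>M distr P borel (incr a b) = distr P (F a \<Otimes>\<^sub>M borel) (\<lambda>\<omega>. (\<omega>, incr a b \<omega>))"
    (is "?S \<Otimes>\<^sub>M ?T = ?J")
proof -
  have [measurable]: "incr a b \<in> borel_measurable P" "(\<lambda>\<omega>. \<omega>) \<in> P \<rightarrow>\<^sub>M F a"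
    using ab by (auto intro!: incr_measurable_P ident_measurable)
  interpret X: prob_space ?S by (rule prob_space_distr) measurable
  interpret Y: prob_space ?T by (rule prob_space_distr) measurable
  show ?thesis
  proof (rule pair_measure_eqI)
    show "sigma_finite_measure ?S" "sigma_finite_measure ?T" ..
    fix A B assume "A \<in> sets ?S" "B \<in> sets ?T"
    then have A[measurable]: "A \<in> sets (F a)" and B[measurable]: "B \<in> sets borel" by auto
    have sub: "A \<inter> space P = A" using sets.sets_into_space[OF A] by auto
    have "incr a b -` B \<inter> space P \<in> sets (vimage_algebra (space P) (incr a b) borel)"
      by (rule in_vimage_algebra[OF B])
    then have "prob (A \<inter> (incr a b -` B \<inter> space P)) = prob A * prob (incr a b -` B \<inter> space P)"
      using incr_indep_set[OF ab] A unfolding indep_sets2_eq by blast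
    then have "emeasure P (A \<inter> (incr a b -` B \<inter> space P)) = emeasure P A * emeasure P (incr a b -` B \<inter> space P)"
      by (simp add: emeasure_eq_measure ennreal_mult)
    moreover have "(\<lambda>\<omega>. (\<omega>, incr a b \<omega>)) -` (A \<times> B) \<inter> space P = A \<inter> (incr a b -` B \<inter> space P)"
      using sub by auto
    ultimately show "emeasure ?S A * emeasure ?T B = emeasure ?J (A \<times> B)"
      using sub by (simp add: emeasure_distr)
  qed simp
qed

text \<open>By independence, the increment after time \<open>a\<close> may be integrated out while everything known at
  time \<open>a\<close> is kept fixed.\<close>

lemma nn_integral_incr:
  assumes ab: "0 \<le> a" "a < b" and h[measurable]: "h \<in> borel_measurable (F a \<Otimes>\<^sub>M borel)"
  shows "(\<integral>\<^sup>+\<omega>. h (\<omega>, incr a b \<omega>) \<partial>P) =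
    (\<integral>\<^sup>+\<omega>. (\<integral>\<^sup>+y. ennreal (normal_density 0 (sqrt (b - a)) y) * h (\<omega>, y) \<partial>lborel) \<partial>P)"
proof -
  have [measurable]: "incr a b \<in> borel_measurable P" "(\<lambda>\<omega>. \<omega>) \<in> P \<rightarrow>\<^sub>M F a"
    using ab by (auto intro!: incr_measurable_P ident_measurable)
  note eq = distr_past_incr[OF ab]
  interpret Y: prob_space "distr P borel (incr a b)" by (rule prob_space_distr) measurable
  have d: "distr P borel (incr a b) = density lborel (normal_density 0 (sqrt (b - a)))"
    using incr_distributed[OF ab] by (simp add: distributed_def cong: distr_cong)
  have "(\<integral>\<^sup>+\<omega>. h (\<omega>, incr a b \<omega>) \<partial>P) = (\<integral>\<^sup>+z. h z \<partial>distr P (F a \<Otimes>\<^sub>M borel) (\<lambda>\<omega>. (\<omega>, incr a b \<omega>)))"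
    by (subst nn_integral_distr) auto
  also have "\<dots> = (\<integral>\<^sup>+z. h z \<partial>(distr P (F a) (\<lambda>\<omega>. \<omega>) \<Otimes>\<^sub>M distr P borel (incr a b)))"
    by (simp only: eq)
  also have "\<dots> = (\<integral>\<^sup>+\<omega>. (\<integral>\<^sup>+y. h (\<omega>, y) \<partial>distr P borel (incr a b)) \<partial>distr P (F a) (\<lambda>\<omega>. \<omega>))"
    by (rule Y.nn_integral_fst[symmetric]) simp
  also have "\<dots> = (\<integral>\<^sup>+\<omega>. (\<integral>\<^sup>+y. h (\<omega>, y) \<partial>distr P borel (incr a b)) \<partial>P)"
    by (subst nn_integral_distr) auto
  also have "\<dots> = (\<integral>\<^sup>+\<omega>. (\<integral>\<^sup>+y. ennreal (normal_density 0 (sqrt (b - a)) y) * h (\<omega>, y) \<partial>lborel) \<partial>P)"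
  proof (rule nn_integral_cong)
    fix \<omega> assume "\<omega> \<in> space P"
    then have "(\<lambda>y. h (\<omega>, y)) \<in> borel_measurable borel"
      by (intro measurable_compose[OF measurable_Pair1' h]) simp
    then show "(\<integral>\<^sup>+y. h (\<omega>, y) \<partial>distr P borel (incr a b)) =
      (\<integral>\<^sup>+y. ennreal (normal_density 0 (sqrt (b - a)) y) * h (\<omega>, y) \<partial>lborel)"
      unfolding d by (subst nn_integral_density) auto
  qed
  finally show ?thesis .
qed

text \<open>Given the past, the increment is normal with variance \<open>b - a\<close>, and \<open>\<xi>\<close> is a constant of size at
  most \<open>M\<close>. This is the induction step for the exponential moments of simple integrals.\<close>

lemma exponential_step:
  assumes ab: "0 \<le> a" "a \<le> b"
    and U[measurable]: "U \<in> borel_measurable (F a)" and \<xi>[measurable]: "\<xi> \<in> borel_measurable (F a)"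
    and bound: "\<And>\<omega>. \<omega> \<in> space P \<Longrightarrow> \<bar>\<xi> \<omega>\<bar> \<le> M"
  shows "(\<integral>\<^sup>+\<omega>. U \<omega> * ennreal (exp (\<xi> \<omega> * incr a b \<omega>)) \<partial>P) \<le>
    (\<integral>\<^sup>+\<omega>. U \<omega> \<partial>P) * ennreal (exp (M\<^sup>2 * (b - a) / 2))"
proof (cases "a = b")
  case True then show ?thesis by (simp add: incr_def)
next
  case False
  with ab have ab': "a < b" by simp
  have [measurable]: "U \<in> borel_measurable P" by (rule measurable_F_P[OF U])
  have "(\<integral>\<^sup>+\<omega>. U \<omega> * ennreal (exp (\<xi> \<omega> * incr a b \<omega>)) \<partial>P) =
    (\<integral>\<^sup>+\<omega>. (\<integral>\<^sup>+y. ennreal (normal_density 0 (sqrt (b - a)) y) * (U \<omega> * ennreal (exp (\<xi> \<omega> * y))) \<partial>lborel) \<partial>P)"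
    using nn_integral_incr[OF ab(1) ab', of "\<lambda>(\<omega>, y). U \<omega> * ennreal (exp (\<xi> \<omega> * y))"] by simp
  also have "\<dots> = (\<integral>\<^sup>+\<omega>. U \<omega> * (\<integral>\<^sup>+y. ennreal (normal_density 0 (sqrt (b - a)) y) * ennreal (exp (\<xi> \<omega> * y)) \<partial>lborel) \<partial>P)"
    by (simp add: mult.left_commute[of _ "U _"] nn_integral_cmult)
  also have "\<dots> = (\<integral>\<^sup>+\<omega>. U \<omega> * ennreal (exp ((\<xi> \<omega>)\<^sup>2 * (b - a) / 2)) \<partial>P)"
    using ab' by (simp add: normal_exponential_moment)
  also have "\<dots> \<le> (\<integral>\<^sup>+\<omega>. U \<omega> * ennreal (exp (M\<^sup>2 * (b - a) / 2)) \<partial>P)"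
  proof (intro nn_integral_mono mult_left_mono ennreal_leI)
    fix \<omega> assume "\<omega> \<in> space P"
    then have "(\<xi> \<omega>)\<^sup>2 \<le> M\<^sup>2" using bound by (metis abs_ge_zero power2_abs power_mono)
    then show "exp ((\<xi> \<omega>)\<^sup>2 * (b - a) / 2) \<le> exp (M\<^sup>2 * (b - a) / 2)"
      using ab by (simp add: mult_right_mono)
  qed simp
  also have "\<dots> = (\<integral>\<^sup>+\<omega>. U \<omega> \<partial>P) * ennreal (exp (M\<^sup>2 * (b - a) / 2))"
    by (rule nn_integral_multc) simp
  finally show ?thesis .
qed

lemma past_times_incr:
  assumes ab: "0 \<le> a" "a \<le> b" and Z[measurable]: "Z \<in> borel_measurable (F a)" and Zi: "integrable P Z"
  shows "integrable P (\<lambda>\<omega>. Z \<omega> * incr a b \<omega>)" "(\<integral>\<omega>. Z \<omega> * incr a b \<omega> \<partial>P) = 0"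
    "integrable P (\<lambda>\<omega>. Z \<omega> * (incr a b \<omega>)\<^sup>2)" "(\<integral>\<omega>. Z \<omega> * (incr a b \<omega>)\<^sup>2 \<partial>P) = (\<integral>\<omega>. Z \<omega> \<partial>P) * (b - a)"
proof -
  have "integrable P (\<lambda>\<omega>. Z \<omega> * incr a b \<omega>) \<and> (\<integral>\<omega>. Z \<omega> * incr a b \<omega> \<partial>P) = 0 \<and>
    integrable P (\<lambda>\<omega>. Z \<omega> * (incr a b \<omega>)\<^sup>2) \<and>
    (\<integral>\<omega>. Z \<omega> * (incr a b \<omega>)\<^sup>2 \<partial>P) = (\<integral>\<omega>. Z \<omega> \<partial>P) * (b - a)"
  proof (cases "a = b")
    case True then show ?thesis by (simp add: incr_def)
  next
    case False
  then have ab': "a < b" using ab by simp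
  define s where "s = sqrt (b - a)"
  have s: "s > 0" "s\<^sup>2 = b - a" using ab' by (auto simp: s_def)
  have d: "distributed P lborel (incr a b) (normal_density 0 s)"
    unfolding s_def by (rule incr_distributed[OF ab(1) ab'])
  have m1: "integrable P (incr a b)" "(\<integral>\<omega>. incr a b \<omega> \<partial>P) = 0"
    using distributed_integrable[OF d, of "\<lambda>y. y"] distributed_integral[OF d, of "\<lambda>y. y"]
      integrable_normal_moment[OF s(1), of 0 1] integral_normal_moment_odd[OF s(1), of 0 0] by auto
  have m2: "integrable P (\<lambda>\<omega>. (incr a b \<omega>)\<^sup>2)" "(\<integral>\<omega>. (incr a b \<omega>)\<^sup>2 \<partial>P) = b - a"
    using distributed_integrable[OF d, of "\<lambda>y. y\<^sup>2"] distributed_integral[OF d, of "\<lambda>y. y\<^sup>2"]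
      integrable_normal_moment[OF s(1), of 0 2] integral_normal_moment_even[OF s(1), of 0 1] s by auto
  have i1: "indep_var borel Z borel (incr a b)"
    using incr_indep_var[OF ab(1) ab' Z, of "\<lambda>y. y"] by simp
  have i2: "indep_var borel Z borel (\<lambda>\<omega>. (incr a b \<omega>)\<^sup>2)"
    using incr_indep_var[OF ab(1) ab' Z, of "\<lambda>y. y\<^sup>2"] by simp
  show ?thesis
    using indep_var_integrable[OF i1 Zi m1(1)] indep_var_lebesgue_integral[OF i1 Zi m1(1)]
      indep_var_integrable[OF i2 Zi m2(1)] indep_var_lebesgue_integral[OF i2 Zi m2(1)] m1 m2
    by simp
  qed
  then show "integrable P (\<lambda>\<omega>. Z \<omega> * incr a b \<omega>)" "(\<integral>\<omega>. Z \<omega> * incr a b \<omega> \<partial>P) = 0"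
    "integrable P (\<lambda>\<omega>. Z \<omega> * (incr a b \<omega>)\<^sup>2)" "(\<integral>\<omega>. Z \<omega> * (incr a b \<omega>)\<^sup>2 \<partial>P) = (\<integral>\<omega>. Z \<omega> \<partial>P) * (b - a)"
    by auto
qed

end

section \<open>The Ito isometry for simple processes\<close>

text \<open>The length of \<open>(a, b] \<inter> (c, d]\<close>.\<close>

definition overlap :: "real \<Rightarrow> real \<Rightarrow> real \<Rightarrow> real \<Rightarrow> real" where
  "overlap a b c d = max 0 (min b d - max a c)"

lemma overlap_commute: "overlap a b c d = overlap c d a b"
  by (simp add: overlap_def min.commute max.commute)

lemma nn_integral_of_has_bochner_integral:
  fixes f :: "'a \<Rightarrow> real"
  assumes "has_bochner_integral M f x" "\<And>x. 0 \<le> f x"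
  shows "(\<integral>\<^sup>+x. ennreal (f x) \<partial>M) = ennreal x"
  using assms nn_integral_eq_integral[of M f] by (auto simp: has_bochner_integral_iff)

lemma has_bochner_integral_overlap:
  "has_bochner_integral lborel (\<lambda>u. indicator {a<..b} u * indicator {c<..d} u :: real) (overlap a b c d)"
proof -
  have *: "indicator {a<..b} u * indicator {c<..d} u = (indicator {max a c<..min b d} u :: real)" for u
    by (auto simp: indicator_def)
  have "emeasure lborel {x<..y} < \<infinity>" for x y :: real
    by (cases "x \<le> y") auto
  then have "has_bochner_integral lborel (indicator {max a c<..min b d} :: real \<Rightarrow> real)
      (measure lborel {max a c<..min b d})"
    by (intro has_bochner_integral_real_indicator) auto
  moreover have "measure lborel {max a c<..min b d} = overlap a b c d"
    by (cases "max a c \<le> min b d") (auto simp: overlap_def)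
  ultimately show ?thesis unfolding * by simp
qed

context brownian_filtration
begin

lemma integrable_bounded_mult:
  fixes \<xi> Y :: "'a \<Rightarrow> real"
  assumes [measurable]: "\<xi> \<in> borel_measurable P" and Y: "integrable P Y"
    and b: "\<And>\<omega>. \<omega> \<in> space P \<Longrightarrow> \<bar>\<xi> \<omega>\<bar> \<le> C"
  shows "integrable P (\<lambda>\<omega>. \<xi> \<omega> * Y \<omega>)"
proof (rule Bochner_Integration.integrable_bound)
  show "integrable P (\<lambda>\<omega>. C * Y \<omega>)" using Y by simp
  show "(\<lambda>\<omega>. \<xi> \<omega> * Y \<omega>) \<in> borel_measurable P"
    using borel_measurable_integrable[OF Y] by measurable
  show "AE \<omega> in P. norm (\<xi> \<omega> * Y \<omega>) \<le> norm (C * Y \<omega>)"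
  proof (rule AE_I2)
    fix \<omega> assume "\<omega> \<in> space P"
    then have "\<bar>\<xi> \<omega>\<bar> \<le> \<bar>C\<bar>" using b by fastforce
    then show "norm (\<xi> \<omega> * Y \<omega>) \<le> norm (C * Y \<omega>)" by (simp add: abs_mult mult_right_mono)
  qed
qed

text \<open>If \<open>b \<le> c\<close>, then everything but \<open>incr c d\<close> is known at time \<open>c\<close>, and the expectation is 0. Otherwise
  both increments are cut at \<open>c\<close> and at \<open>min b d\<close>. In the expanded product every term but one contains an
  increment that starts when all the other factors are known; the remaining term is
  \<open>\<xi> \<zeta> (incr c m)\<^sup>2\<close>.\<close>

lemma covariance_ordered:
  assumes ab: "0 \<le> a" "a \<le> b" and cd: "a \<le> c" "c \<le> d"
    and \<xi>[measurable]: "\<xi> \<in> borel_measurable (F a)" and \<xi>b: "\<And>\<omega>. \<omega> \<in> space P \<Longrightarrow> \<bar>\<xi> \<omega>\<bar> \<le> C"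
    and \<zeta>[measurable]: "\<zeta> \<in> borel_measurable (F c)" and \<zeta>b: "\<And>\<omega>. \<omega> \<in> space P \<Longrightarrow> \<bar>\<zeta> \<omega>\<bar> \<le> C'"
  shows "has_bochner_integral P (\<lambda>\<omega>. (\<xi> \<omega> * incr a b \<omega>) * (\<zeta> \<omega> * incr c d \<omega>))
    ((\<integral>\<omega>. \<xi> \<omega> * \<zeta> \<omega> \<partial>P) * overlap a b c d)"
proof -
  have \<xi>P: "\<xi> \<in> borel_measurable P" and \<zeta>P: "\<zeta> \<in> borel_measurable P"
    by (auto intro: measurable_F_P \<xi> \<zeta>)
  have \<xi>c[measurable]: "\<xi> \<in> borel_measurable (F c)" by (rule measurable_F_mono[OF \<xi> cd(1)])
  have i\<xi>: "integrable P \<xi>" and i\<zeta>: "integrable P \<zeta>"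
    using integrable_bounded_mult[OF \<xi>P, of "\<lambda>_. 1"] integrable_bounded_mult[OF \<zeta>P, of "\<lambda>_. 1"] \<xi>b \<zeta>b by auto
  show ?thesis
  proof (cases "b \<le> c")
    case True
    let ?Z = "\<lambda>\<omega>. \<zeta> \<omega> * (\<xi> \<omega> * incr a b \<omega>)"
    have Zi: "integrable P ?Z"
      by (rule integrable_bounded_mult[OF \<zeta>P _ \<zeta>b]) (use past_times_incr[OF ab \<xi> i\<xi>] in auto)
    have [measurable]: "incr a b \<in> borel_measurable (F c)"
      using incr_measurable[OF ab] True by (rule measurable_F_mono)
    have Zm: "?Z \<in> borel_measurable (F c)" by measurable
    note past_times_incr[OF order.trans[OF ab(1) cd(1)] cd(2) Zm Zi]
    then show ?thesis using True cd ab
      by (simp add: has_bochner_integral_iff overlap_def mult_ac)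
  next
    case False
    define m where "m = min b d"
    have m: "c \<le> m" "m \<le> b" "m \<le> d" "m = b \<or> m = d" using False cd by (auto simp: m_def)
    let ?V = "\<lambda>\<omega>. \<xi> \<omega> * \<zeta> \<omega>"
    have V[measurable]: "?V \<in> borel_measurable (F c)" by measurable
    have Vi: "integrable P ?V" by (rule integrable_bounded_mult[OF \<xi>P i\<zeta> \<xi>b])
    have c0: "0 \<le> c" and m0: "0 \<le> m" using ab cd m by auto
    have acm[measurable]: "incr a c \<in> borel_measurable (F c)" using ab cd by (intro incr_measurable)
    let ?Z = "\<lambda>\<omega>. \<zeta> \<omega> * (\<xi> \<omega> * incr a c \<omega>)"
    have Zi: "integrable P ?Z"
      by (rule integrable_bounded_mult[OF \<zeta>P _ \<zeta>b]) (use past_times_incr[OF ab(1) cd(1) \<xi> i\<xi>] in auto)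
    have Zm: "?Z \<in> borel_measurable (F c)" by measurable
    note 1 = past_times_incr(1,2)[OF c0 cd(2) Zm Zi]
    note 2 = past_times_incr(3,4)[OF c0 m(1) V Vi]
    let ?Y = "\<lambda>\<omega>. ?V \<omega> * incr c m \<omega>"
    have Ym: "?Y \<in> borel_measurable (F m)"
      by (intro borel_measurable_times incr_measurable c0 m measurable_F_mono[OF \<xi>c m(1)] measurable_F_mono[OF \<zeta> m(1)])
    have Yi: "integrable P ?Y" by (rule past_times_incr(1)[OF c0 m(1) V Vi])
    note 3 = past_times_incr(1,2)[OF m0 m(3) Ym Yi]
    note 4 = past_times_incr(1,2)[OF m0 m(2) Ym Yi]
    \<comment> \<open>Since \<open>m\<close> is \<open>b\<close> or \<open>d\<close>, one of \<open>incr m b\<close> and \<open>incr m d\<close> is zero, and their product does not appear.\<close>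
    have eq: "(\<xi> \<omega> * incr a b \<omega>) * (\<zeta> \<omega> * incr c d \<omega>) =
      ?Z \<omega> * incr c d \<omega> + ?V \<omega> * (incr c m \<omega>)\<^sup>2 + ?Y \<omega> * incr m d \<omega> + ?Y \<omega> * incr m b \<omega>" for \<omega>
      using m(4) by (elim disjE) (simp_all add: incr_def power2_eq_square algebra_simps)
    have "has_bochner_integral P (\<lambda>\<omega>. (\<xi> \<omega> * incr a b \<omega>) * (\<zeta> \<omega> * incr c d \<omega>))
      (0 + (\<integral>\<omega>. ?V \<omega> \<partial>P) * (m - c) + 0 + 0)"
      unfolding eq by (intro has_bochner_integral_add; simp only: has_bochner_integral_iff 1 2 3 4 simp_thms)
    moreover have "m - c = overlap a b c d" using m cd by (simp add: overlap_def m_def)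
    ultimately show ?thesis by simp
  qed
qed

lemma covariance:
  assumes "0 \<le> a" "a \<le> b" "0 \<le> c" "c \<le> d"
    and "\<xi> \<in> borel_measurable (F a)" "\<exists>C. \<forall>\<omega>\<in>space P. \<bar>\<xi> \<omega>\<bar> \<le> C"
    and "\<zeta> \<in> borel_measurable (F c)" "\<exists>C. \<forall>\<omega>\<in>space P. \<bar>\<zeta> \<omega>\<bar> \<le> C"
  shows "has_bochner_integral P (\<lambda>\<omega>. (\<xi> \<omega> * incr a b \<omega>) * (\<zeta> \<omega> * incr c d \<omega>))
    ((\<integral>\<omega>. \<xi> \<omega> * \<zeta> \<omega> \<partial>P) * overlap a b c d)"
proof -
  obtain C C' where C: "\<And>\<omega>. \<omega> \<in> space P \<Longrightarrow> \<bar>\<xi> \<omega>\<bar> \<le> C" "\<And>\<omega>. \<omega> \<in> space P \<Longrightarrow> \<bar>\<zeta> \<omega>\<bar> \<le> C'"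
    using assms by blast
  show ?thesis
  proof (cases "a \<le> c")
    case True
    show ?thesis by (rule covariance_ordered[OF assms(1,2) True assms(4,5) C(1) assms(7) C(2)])
  next
    case False
    then have "c \<le> a" by simp
    from covariance_ordered[OF assms(3,4) this assms(2,7) C(2) assms(5) C(1)]
    show ?thesis by (simp add: overlap_commute[of c d] mult.commute)
  qed
qed

text \<open>The intervals may overlap. This makes the isometry applicable to the difference of two simple
  processes with different partitions, without a common refinement.\<close>

lemma isometry:
  fixes a b :: "'i \<Rightarrow> real" and \<xi> :: "'i \<Rightarrow> 'a \<Rightarrow> real"
  assumes S: "finite S"
    and ab: "\<And>i. i \<in> S \<Longrightarrow> 0 \<le> a i" "\<And>i. i \<in> S \<Longrightarrow> a i \<le> b i"
    and \<xi>: "\<And>i. i \<in> S \<Longrightarrow> \<xi> i \<in> borel_measurable (F (a i))"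
    and bd: "\<And>i. i \<in> S \<Longrightarrow> \<exists>C. \<forall>\<omega>\<in>space P. \<bar>\<xi> i \<omega>\<bar> \<le> C"
  shows "(\<integral>\<^sup>+\<omega>. ennreal ((\<Sum>i\<in>S. \<xi> i \<omega> * incr (a i) (b i) \<omega>)\<^sup>2) \<partial>P) =
    (\<integral>\<^sup>+\<omega>. (\<integral>\<^sup>+u. ennreal ((\<Sum>i\<in>S. \<xi> i \<omega> * indicator {a i<..b i} u)\<^sup>2) \<partial>lborel) \<partial>P)"
proof -
  define v where "v = (\<Sum>i\<in>S. \<Sum>j\<in>S. (\<integral>\<omega>. \<xi> i \<omega> * \<xi> j \<omega> \<partial>P) * overlap (a i) (b i) (a j) (b j))"
  have 1: "has_bochner_integral P (\<lambda>\<omega>. (\<Sum>i\<in>S. \<xi> i \<omega> * incr (a i) (b i) \<omega>)\<^sup>2) v"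
    unfolding v_def power2_eq_square sum_product
    by (intro has_bochner_integral_sum covariance ab \<xi> bd)
  have 2: "has_bochner_integral lborel (\<lambda>u. (\<Sum>i\<in>S. \<xi> i \<omega> * indicator {a i<..b i} u)\<^sup>2)
      (\<Sum>i\<in>S. \<Sum>j\<in>S. \<xi> i \<omega> * \<xi> j \<omega> * overlap (a i) (b i) (a j) (b j))" for \<omega>
  proof -
    have "(\<Sum>i\<in>S. \<xi> i \<omega> * indicator {a i<..b i} u)\<^sup>2 = (\<Sum>i\<in>S. \<Sum>j\<in>S. \<xi> i \<omega> * \<xi> j \<omega> *
      (indicator {a i<..b i} u * indicator {a j<..b j} u))" for u
      by (simp add: power2_eq_square sum_product mult_ac)
    then show ?thesis
      by (simp only:) (intro has_bochner_integral_sum has_bochner_integral_mult_right has_bochner_integral_overlap)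
  qed
  have 3: "has_bochner_integral P (\<lambda>\<omega>. \<Sum>i\<in>S. \<Sum>j\<in>S. \<xi> i \<omega> * \<xi> j \<omega> * overlap (a i) (b i) (a j) (b j)) v"
    unfolding v_def
  proof (intro has_bochner_integral_sum has_bochner_integral_mult_left)
    fix i j assume "i \<in> S" "j \<in> S"
    then have m: "\<xi> i \<in> borel_measurable P" "\<xi> j \<in> borel_measurable P"
      using \<xi> by (auto intro: measurable_F_P)
    obtain C C' where C: "\<And>\<omega>. \<omega> \<in> space P \<Longrightarrow> \<bar>\<xi> i \<omega>\<bar> \<le> C" "\<And>\<omega>. \<omega> \<in> space P \<Longrightarrow> \<bar>\<xi> j \<omega>\<bar> \<le> C'"
      using bd \<open>i \<in> S\<close> \<open>j \<in> S\<close> by meson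
    have "integrable P (\<lambda>\<omega>. \<xi> j \<omega> * 1)" by (rule integrable_bounded_mult[OF m(2) _ C(2)]) auto
    then have "integrable P (\<lambda>\<omega>. \<xi> i \<omega> * \<xi> j \<omega>)" by (intro integrable_bounded_mult[OF m(1) _ C(1)]) auto
    then show "has_bochner_integral P (\<lambda>\<omega>. \<xi> i \<omega> * \<xi> j \<omega>) (\<integral>\<omega>. \<xi> i \<omega> * \<xi> j \<omega> \<partial>P)"
      by (rule has_bochner_integral_integrable)
  qed
  have nn: "0 \<le> (\<Sum>i\<in>S. \<Sum>j\<in>S. \<xi> i \<omega> * \<xi> j \<omega> * overlap (a i) (b i) (a j) (b j))" for \<omega>
  proof -
    have "0 \<le> (\<integral>u. (\<Sum>i\<in>S. \<xi> i \<omega> * indicator {a i<..b i} u)\<^sup>2 \<partial>lborel)" by simp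
    then show ?thesis using has_bochner_integral_integral_eq[OF 2[of \<omega>]] by linarith
  qed
  have "(\<integral>\<^sup>+\<omega>. (\<integral>\<^sup>+u. ennreal ((\<Sum>i\<in>S. \<xi> i \<omega> * indicator {a i<..b i} u)\<^sup>2) \<partial>lborel) \<partial>P) =
      (\<integral>\<^sup>+\<omega>. ennreal (\<Sum>i\<in>S. \<Sum>j\<in>S. \<xi> i \<omega> * \<xi> j \<omega> * overlap (a i) (b i) (a j) (b j)) \<partial>P)"
    by (intro nn_integral_cong nn_integral_of_has_bochner_integral[OF 2]) simp
  also have "\<dots> = ennreal v"
    by (rule nn_integral_of_has_bochner_integral[OF 3 nn])
  also have "\<dots> = (\<integral>\<^sup>+\<omega>. ennreal ((\<Sum>i\<in>S. \<xi> i \<omega> * incr (a i) (b i) \<omega>)\<^sup>2) \<partial>P)"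
    by (rule nn_integral_of_has_bochner_integral[OF 1, symmetric]) simp
  finally show ?thesis by simp
qed

text \<open>In the integral up to \<open>t\<close>, the interval of a coefficient with \<open>\<tau> i > t\<close> collapses to the point \<open>t\<close>, at
  which the coefficient is not yet known. Replacing it by 0 keeps the family adapted and does not change
  the integral.\<close>

definition cut :: "real \<Rightarrow> 'a simple_process \<Rightarrow> nat \<Rightarrow> 'a \<Rightarrow> real" where
  "cut t \<phi> i \<omega> = (case \<phi> of (n, \<tau>, \<xi>) \<Rightarrow> if \<tau> i \<le> t then \<xi> i \<omega> else 0)"

lemma simple_process_times:
  assumes "simple_process F (n, \<tau>, \<xi>)" "i \<le> n"
  shows "0 \<le> \<tau> i"
  using assms(2)
proof (induction i)
  case 0 then show ?case using assms(1) by simp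
next
  case (Suc i)
  then have "\<tau> i \<le> \<tau> (Suc i)" using assms(1) by auto
  with Suc show ?case by auto
qed

lemma cut_family:
  assumes \<phi>: "simple_process F (n, \<tau>, \<xi>)" and t: "0 \<le> t" and i: "i < n"
  shows "0 \<le> min t (\<tau> i)" "min t (\<tau> i) \<le> min t (\<tau> (Suc i))"
    "cut t (n, \<tau>, \<xi>) i \<in> borel_measurable (F (min t (\<tau> i)))"
    "\<exists>C. \<forall>\<omega>\<in>space P. \<bar>cut t (n, \<tau>, \<xi>) i \<omega>\<bar> \<le> C"
proof -
  show "0 \<le> min t (\<tau> i)" using simple_process_times[OF \<phi>, of i] i t by simp
  show "min t (\<tau> i) \<le> min t (\<tau> (Suc i))" using \<phi> i by auto
  show "cut t (n, \<tau>, \<xi>) i \<in> borel_measurable (F (min t (\<tau> i)))"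
    using \<phi> i by (cases "\<tau> i \<le> t") (auto simp: cut_def[abs_def] min_def)
  obtain C where "\<forall>\<omega>\<in>space P. \<bar>\<xi> i \<omega>\<bar> \<le> C" using \<phi> i by fastforce
  then have "\<forall>\<omega>\<in>space P. \<bar>cut t (n, \<tau>, \<xi>) i \<omega>\<bar> \<le> max C 0" by (auto simp: cut_def le_max_iff_disj)
  then show "\<exists>C. \<forall>\<omega>\<in>space P. \<bar>cut t (n, \<tau>, \<xi>) i \<omega>\<bar> \<le> C" by blast
qed

lemma simple_integral_cut:
  "simple_integral_wrt W (n, \<tau>, \<xi>) t \<omega> =
    (\<Sum>i<n. cut t (n, \<tau>, \<xi>) i \<omega> * incr (min t (\<tau> i)) (min t (\<tau> (Suc i))) \<omega>)"
  if "simple_process F (n, \<tau>, \<xi>)"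
proof -
  have "\<xi> i \<omega> * (W (min t (\<tau> (Suc i))) \<omega> - W (min t (\<tau> i)) \<omega>) =
    cut t (n, \<tau>, \<xi>) i \<omega> * incr (min t (\<tau> i)) (min t (\<tau> (Suc i))) \<omega>" if "i < n" for i
  proof -
    have "\<tau> i \<le> \<tau> (Suc i)" using \<open>simple_process F (n, \<tau>, \<xi>)\<close> that by auto
    then show ?thesis by (cases "\<tau> i \<le> t") (simp_all add: cut_def incr_def min_def)
  qed
  then show ?thesis unfolding simple_integral_wrt.simps by (intro sum.cong) auto
qed

lemma simple_value_cut:
  assumes "simple_process F (n, \<tau>, \<xi>)"
  shows "simple_value (n, \<tau>, \<xi>) u \<omega> * indicator {0..t} u =
    (\<Sum>i<n. cut t (n, \<tau>, \<xi>) i \<omega> * indicator {min t (\<tau> i)<..min t (\<tau> (Suc i))} u)"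
proof -
  have "\<xi> i \<omega> * indicator {\<tau> i<..\<tau> (Suc i)} u * indicator {0..t} u =
    cut t (n, \<tau>, \<xi>) i \<omega> * (indicator {min t (\<tau> i)<..min t (\<tau> (Suc i))} u :: real)" if "i < n" for i
    using simple_process_times[OF assms, of i] that by (auto simp: cut_def indicator_def min_def)
  then show ?thesis unfolding simple_value.simps sum_distrib_right by (intro sum.cong) auto
qed

lemma simple_isometry:
  assumes \<phi>: "simple_process F \<phi>" and \<psi>: "simple_process F \<psi>" and t: "0 \<le> t"
  shows "(\<integral>\<^sup>+\<omega>. ennreal ((simple_integral_wrt W \<phi> t \<omega> - simple_integral_wrt W \<psi> t \<omega>)\<^sup>2) \<partial>P) =
    (\<integral>\<^sup>+\<omega>. (\<integral>\<^sup>+u\<in>{0..t}. ennreal ((simple_value \<phi> u \<omega> - simple_value \<psi> u \<omega>)\<^sup>2) \<partial>lborel) \<partial>P)"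
proof -
  obtain n \<tau> \<xi> where p: "\<phi> = (n, \<tau>, \<xi>)" by (metis prod_cases3)
  obtain n' \<tau>' \<xi>' where q: "\<psi> = (n', \<tau>', \<xi>')" by (metis prod_cases3)
  note \<phi> = \<phi>[unfolded p] note \<psi> = \<psi>[unfolded q]
  define S where "S = {..<n} <+> {..<n'}"
  define a where "a = case_sum (\<lambda>i. min t (\<tau> i)) (\<lambda>i. min t (\<tau>' i))"
  define b where "b = case_sum (\<lambda>i. min t (\<tau> (Suc i))) (\<lambda>i. min t (\<tau>' (Suc i)))"
  define \<zeta> where "\<zeta> = case_sum (\<lambda>i \<omega>. cut t \<phi> i \<omega>) (\<lambda>i \<omega>. - cut t \<psi> i \<omega>)"
  note defs = S_def a_def b_def \<zeta>_def
  have split: "(\<Sum>i\<in>S. \<zeta> i \<omega> * h (a i) (b i)) =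
      (\<Sum>i<n. cut t \<phi> i \<omega> * h (min t (\<tau> i)) (min t (\<tau> (Suc i)))) -
      (\<Sum>i<n'. cut t \<psi> i \<omega> * h (min t (\<tau>' i)) (min t (\<tau>' (Suc i))))"
    for \<omega> and h :: "real \<Rightarrow> real \<Rightarrow> real"
    by (simp add: defs sum.Plus sum_negf comp_def)
  have I: "simple_integral_wrt W \<phi> t \<omega> - simple_integral_wrt W \<psi> t \<omega> =
      (\<Sum>i\<in>S. \<zeta> i \<omega> * incr (a i) (b i) \<omega>)" for \<omega>
    unfolding split[of \<omega> "\<lambda>a b. incr a b \<omega>"]
    unfolding p q simple_integral_cut[OF \<phi>] simple_integral_cut[OF \<psi>] ..
  have V: "(simple_value \<phi> u \<omega> - simple_value \<psi> u \<omega>) * indicator {0..t} u =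
      (\<Sum>i\<in>S. \<zeta> i \<omega> * indicator {a i<..b i} u)" for u \<omega>
    unfolding split[of \<omega> "\<lambda>a b. indicator {a<..b} u"]
    unfolding p q left_diff_distrib simple_value_cut[OF \<phi>] simple_value_cut[OF \<psi>] ..
  have V2: "ennreal ((simple_value \<phi> u \<omega> - simple_value \<psi> u \<omega>)\<^sup>2) * indicator {0..t} u =
      ennreal ((\<Sum>i\<in>S. \<zeta> i \<omega> * indicator {a i<..b i} u)\<^sup>2)" for u \<omega>
    unfolding V[symmetric] by (auto simp: indicator_def)
  show ?thesis unfolding I V2
  proof (rule isometry)
    fix i assume i: "i \<in> S"
    show "0 \<le> a i" "a i \<le> b i" "\<zeta> i \<in> borel_measurable (F (a i))"
      "\<exists>C. \<forall>\<omega>\<in>space P. \<bar>\<zeta> i \<omega>\<bar> \<le> C"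
      using i cut_family[OF \<phi> t] cut_family[OF \<psi> t] by (auto simp: defs p q)
  qed (simp add: S_def)
qed

end

section \<open>Exponential moments of the stochastic integral\<close>

lemma mono_upto:
  fixes f :: "nat \<Rightarrow> real"
  assumes "\<And>i. i < n \<Longrightarrow> f i \<le> f (Suc i)" "i \<le> j" "j \<le> n"
  shows "f i \<le> f j"
  using assms(2,3)
proof (induction j rule: dec_induct)
  case (step m)
  then have "f i \<le> f m" "f m \<le> f (Suc m)" using assms(1) by auto
  then show ?case by simp
qed simp

lemma square_sum_le: "(x + y)\<^sup>2 \<le> 2 * x\<^sup>2 + 2 * y\<^sup>2" for x y :: real
  using zero_le_power2[of "x - y"] by (simp add: power2_eq_square algebra_simps)

lemma ennreal_square_triangle:
  "ennreal ((x - z)\<^sup>2) \<le> 2 * ennreal ((x - y)\<^sup>2) + 2 * ennreal ((y - z)\<^sup>2)" for x y z :: real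
proof -
  have "(x - z)\<^sup>2 \<le> 2 * (x - y)\<^sup>2 + 2 * (y - z)\<^sup>2" using square_sum_le[of "x - y" "y - z"] by simp
  then have "ennreal ((x - z)\<^sup>2) \<le> ennreal (2 * (x - y)\<^sup>2 + 2 * (y - z)\<^sup>2)" by (rule ennreal_leI)
  also have "\<dots> = 2 * ennreal ((x - y)\<^sup>2) + 2 * ennreal ((y - z)\<^sup>2)"
    by (simp add: ennreal_plus ennreal_mult)
  finally show ?thesis .
qed

lemma nn_integral_square_triangle:
  fixes f g h :: "'a \<Rightarrow> real"
  assumes [measurable]: "f \<in> borel_measurable M" "g \<in> borel_measurable M" "h \<in> borel_measurable M"
  shows "(\<integral>\<^sup>+x. ennreal ((f x - h x)\<^sup>2) \<partial>M) \<le>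
    2 * (\<integral>\<^sup>+x. ennreal ((f x - g x)\<^sup>2) \<partial>M) + 2 * (\<integral>\<^sup>+x. ennreal ((g x - h x)\<^sup>2) \<partial>M)"
proof -
  have "(\<integral>\<^sup>+x. ennreal ((f x - h x)\<^sup>2) \<partial>M) \<le>
      (\<integral>\<^sup>+x. 2 * ennreal ((f x - g x)\<^sup>2) + 2 * ennreal ((g x - h x)\<^sup>2) \<partial>M)"
    by (intro nn_integral_mono ennreal_square_triangle)
  also have "\<dots> = 2 * (\<integral>\<^sup>+x. ennreal ((f x - g x)\<^sup>2) \<partial>M) + 2 * (\<integral>\<^sup>+x. ennreal ((g x - h x)\<^sup>2) \<partial>M)"
    by (simp add: nn_integral_add nn_integral_cmult)
  finally show ?thesis .
qed

lemma L2_limit_AE_subsequence: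
  fixes Z :: "nat \<Rightarrow> 'a \<Rightarrow> real"
  assumes [measurable]: "\<And>k. Z k \<in> borel_measurable M" "Y \<in> borel_measurable M"
    and lim: "(\<lambda>k. \<integral>\<^sup>+x. ennreal ((Z k x - Y x)\<^sup>2) \<partial>M) \<longlonglongrightarrow> 0"
  obtains r :: "nat \<Rightarrow> nat" where "AE x in M. (\<lambda>k. Z (r k) x) \<longlonglongrightarrow> Y x"
proof -
  have "eventually (\<lambda>k. (\<integral>\<^sup>+x. ennreal ((Z k x - Y x)\<^sup>2) \<partial>M) < 1) sequentially"
    using lim by (rule order_tendstoD) simp
  then obtain N where N: "\<And>k. k \<ge> N \<Longrightarrow> (\<integral>\<^sup>+x. ennreal ((Z k x - Y x)\<^sup>2) \<partial>M) < 1"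
    by (auto simp: eventually_sequentially)
  define u where "u k x = (Z (k + N) x - Y x)\<^sup>2" for k x
  have ui: "integrable M (u k)" for k
  proof (rule integrableI_bounded)
    show "u k \<in> borel_measurable M" unfolding u_def by measurable
    have "(\<integral>\<^sup>+x. ennreal (norm (u k x)) \<partial>M) < 1" using N[of "k + N"] by (simp add: u_def)
    then show "(\<integral>\<^sup>+x. ennreal (norm (u k x)) \<partial>M) < \<infinity>" by (rule order.strict_trans) simp
  qed
  have "(\<lambda>k. enn2real (\<integral>\<^sup>+x. ennreal ((Z (k + N) x - Y x)\<^sup>2) \<partial>M)) \<longlonglongrightarrow> enn2real 0"
    using lim by (intro tendsto_enn2real LIMSEQ_ignore_initial_segment) auto
  moreover have "enn2real (\<integral>\<^sup>+x. ennreal ((Z (k + N) x - Y x)\<^sup>2) \<partial>M) = (\<integral>x. norm (u k x) \<partial>M)" for k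
    using ui[of k] by (subst integral_eq_nn_integral) (auto simp: u_def)
  ultimately have "(\<lambda>k. \<integral>x. norm (u k x) \<partial>M) \<longlonglongrightarrow> 0" by simp
  from tendsto_L1_AE_subseq[OF ui this] obtain r where
    r: "AE x in M. (\<lambda>k. u (r k) x) \<longlonglongrightarrow> 0" by blast
  have "AE x in M. (\<lambda>k. Z (r k + N) x) \<longlonglongrightarrow> Y x"
  proof (rule AE_mp[OF r], rule AE_I2, rule impI)
    fix x assume "(\<lambda>k. u (r k) x) \<longlonglongrightarrow> 0"
    then have "(\<lambda>k. sqrt (u (r k) x)) \<longlonglongrightarrow> sqrt 0" by (rule tendsto_real_sqrt)
    then have "(\<lambda>k. Z (r k + N) x - Y x) \<longlonglongrightarrow> 0" by (simp add: u_def tendsto_rabs_zero_iff)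
    then show "(\<lambda>k. Z (r k + N) x) \<longlonglongrightarrow> Y x" by (rule LIM_zero_cancel)
  qed
  then show ?thesis by (rule that)
qed

definition clamp_real :: "real \<Rightarrow> real \<Rightarrow> real" where
  "clamp_real M x = max (- M) (min M x)"

lemma clamp_real_closer: "\<bar>y\<bar> \<le> M \<Longrightarrow> (clamp_real M x - y)\<^sup>2 \<le> (x - y)\<^sup>2"
  by (rule abs_le_square_iff[THEN iffD1]) (auto simp: clamp_real_def)

fun clip :: "real \<Rightarrow> 'a simple_process \<Rightarrow> 'a simple_process" where
  "clip M (n, \<tau>, \<xi>) = (n, \<tau>, \<lambda>i \<omega>. clamp_real M (\<xi> i \<omega>))"

fun coeffs_bounded :: "'a set \<Rightarrow> real \<Rightarrow> 'a simple_process \<Rightarrow> bool" where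
  "coeffs_bounded \<Omega> M (n, \<tau>, \<xi>) \<longleftrightarrow> (\<forall>i<n. \<forall>\<omega>\<in>\<Omega>. \<bar>\<xi> i \<omega>\<bar> \<le> M)"

lemma simple_process_clip:
  assumes "M \<ge> 0" "simple_process F \<phi>" shows "simple_process F (clip M \<phi>)" "coeffs_bounded \<Omega> M (clip M \<phi>)"
proof -
  obtain n \<tau> \<xi> where p: "\<phi> = (n, \<tau>, \<xi>)" by (metis prod_cases3)
  have b: "\<bar>clamp_real M x\<bar> \<le> M" for x using assms(1) by (auto simp: clamp_real_def)
  then show "coeffs_bounded \<Omega> M (clip M \<phi>)" by (simp add: p)
  have "(\<lambda>\<omega>. clamp_real M (\<xi> i \<omega>)) \<in> borel_measurable (F (\<tau> i))" if "i < n" for i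
    using assms(2) that unfolding clamp_real_def by (intro borel_measurable_max borel_measurable_min) (auto simp: p)
  then show "simple_process F (clip M \<phi>)" using assms(2) b by (auto simp: p)
qed

text \<open>The intervals of a simple process are disjoint, so at most one coefficient is active at a
  time.\<close>

lemma simple_value_clip:
  assumes M: "M \<ge> 0" and \<phi>: "simple_process F \<phi>"
  shows "simple_value (clip M \<phi>) u \<omega> = clamp_real M (simple_value \<phi> u \<omega>)"
proof -
  obtain n \<tau> \<xi> where p: "\<phi> = (n, \<tau>, \<xi>)" by (metis prod_cases3)
  have 0: "clamp_real M 0 = 0" using M by (simp add: clamp_real_def)
  have st: "\<tau> i \<le> \<tau> (Suc i)" if "i < n" for i using \<phi> that by (auto simp: p)
  have mono: "i \<le> j \<Longrightarrow> j \<le> n \<Longrightarrow> \<tau> i \<le> \<tau> j" for i j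
    by (rule mono_upto[where f = \<tau> and n = n, OF st])
  have "m \<le> n \<Longrightarrow> (\<Sum>i<m. clamp_real M (\<xi> i \<omega>) * indicator {\<tau> i<..\<tau> (Suc i)} u) =
    clamp_real M (\<Sum>i<m. \<xi> i \<omega> * indicator {\<tau> i<..\<tau> (Suc i)} u)" for m
  proof (induction m)
    case 0 then show ?case by (simp add: \<open>clamp_real M 0 = 0\<close>)
  next
    case (Suc m)
    show ?case
    proof (cases "u \<le> \<tau> m")
      case True
      then show ?thesis using Suc by (simp add: indicator_def)
    next
      case False
      have z: "c i * indicator {\<tau> i<..\<tau> (Suc i)} u = 0" if "i < m" for i and c :: "nat \<Rightarrow> real"
        using mono[of "Suc i" m] that Suc.prems False by (auto simp: indicator_def)
      have "(\<Sum>i<m. c i * indicator {\<tau> i<..\<tau> (Suc i)} u) = 0" for c :: "nat \<Rightarrow> real"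
        by (rule sum.neutral) (use z in blast)
      then show ?thesis by (cases "u \<le> \<tau> (Suc m)") (simp_all add: indicator_def 0 False del: sum_mult_indicator)
    qed
  qed
  from this[of n] show ?thesis by (simp add: p)
qed

context brownian_filtration
begin

lemma simple_integral_measurable:
  assumes "simple_process F \<phi>" "0 \<le> t"
  shows "simple_integral_wrt W \<phi> t \<in> borel_measurable P"
proof -
  obtain n \<tau> \<xi> where p: "\<phi> = (n, \<tau>, \<xi>)" by (metis prod_cases3)
  note \<phi> = assms(1)[unfolded p]
  note c = cut_family[OF \<phi> assms(2)]
  show ?thesis unfolding p simple_integral_cut[OF \<phi>, abs_def]
    by (intro borel_measurable_sum borel_measurable_times measurable_F_P[OF c(3)] incr_measurable_P c(1,2)) auto
qed

text \<open>Restricting the partition to \<open>[s, t]\<close> gives the times \<open>c i\<close>; the bound follows by integrating out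
  one increment after the other with \<open>exponential_step\<close>.\<close>

lemma simple_integral_exponential_moment:
  assumes \<phi>: "simple_process F \<phi>" and bd: "coeffs_bounded (space P) M \<phi>" and M: "0 \<le> M"
    and st: "0 \<le> s" "s \<le> t"
  shows "(\<integral>\<^sup>+\<omega>. ennreal (exp (l * (simple_integral_wrt W \<phi> t \<omega> - simple_integral_wrt W \<phi> s \<omega>))) \<partial>P)
    \<le> ennreal (exp (l\<^sup>2 * M\<^sup>2 * (t - s) / 2))"
proof -
  obtain n \<tau> \<xi> where p: "\<phi> = (n, \<tau>, \<xi>)" by (metis prod_cases3)
  note \<phi> = \<phi>[unfolded p] note bd = bd[unfolded p]
  define c where "c i = max s (min t (\<tau> i))" for i
  have step: "\<tau> i \<le> \<tau> (Suc i)" if "i < n" for i using \<phi> that by auto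
  have cs: "c i \<le> c (Suc i)" if "i < n" for i using step[OF that] by (auto simp: c_def)
  have cb: "s \<le> c i" "c i \<le> t" for i using st by (auto simp: c_def)
  have c0: "0 \<le> c i" for i using cb(1)[of i] st by simp
  have cm: "i \<le> j \<Longrightarrow> j \<le> n \<Longrightarrow> c i \<le> c j" for i j
    by (rule mono_upto[where f = c and n = n, OF cs])
  define \<zeta> where "\<zeta> = cut t (n, \<tau>, \<xi>)"
  have \<zeta>m: "\<zeta> i \<in> borel_measurable (F (c i))" if "i < n" for i
  proof (rule measurable_F_mono[of _ "min t (\<tau> i)"])
    show "\<zeta> i \<in> borel_measurable (F (min t (\<tau> i)))"
      unfolding \<zeta>_def using st by (intro cut_family(3)[OF \<phi> _ that]) simp
  qed (simp add: c_def)
  have \<zeta>b: "\<bar>\<zeta> i \<omega>\<bar> \<le> M" if "i < n" "\<omega> \<in> space P" for i \<omega>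
    using bd that M by (auto simp: \<zeta>_def cut_def)
  have term_eq: "\<xi> i \<omega> * (W (min t (\<tau> (Suc i))) \<omega> - W (min t (\<tau> i)) \<omega>) -
      \<xi> i \<omega> * (W (min s (\<tau> (Suc i))) \<omega> - W (min s (\<tau> i)) \<omega>) = \<zeta> i \<omega> * incr (c i) (c (Suc i)) \<omega>"
    if "i < n" for i \<omega>
  proof -
    \<comment> \<open>These are the possible positions of \<open>s\<close> and \<open>t\<close> relative to the interval; the two sides agree in each.\<close>
    consider "\<tau> (Suc i) \<le> s" | "\<tau> i \<le> s" "s < \<tau> (Suc i)" | "s < \<tau> i" "\<tau> i \<le> t" | "t < \<tau> i"
      by linarith
    then show ?thesis
      by cases (use step[OF that] st in \<open>simp_all add: \<zeta>_def cut_def incr_def c_def min_def max_def algebra_simps\<close>)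
  qed
  have eq: "simple_integral_wrt W \<phi> t \<omega> - simple_integral_wrt W \<phi> s \<omega> =
      (\<Sum>i<n. \<zeta> i \<omega> * incr (c i) (c (Suc i)) \<omega>)" for \<omega>
    unfolding p simple_integral_wrt.simps sum_subtractf[symmetric]
    by (rule sum.cong) (use term_eq in auto)
  have "m \<le> n \<Longrightarrow> (\<integral>\<^sup>+\<omega>. ennreal (exp (l * (\<Sum>i<m. \<zeta> i \<omega> * incr (c i) (c (Suc i)) \<omega>))) \<partial>P)
      \<le> ennreal (exp (l\<^sup>2 * M\<^sup>2 * (c m - c 0) / 2))" for m
  proof (induction m)
    case 0 then show ?case by (simp add: emeasure_space_1)
  next
    case (Suc m)
    then have mn: "m < n" by simp
    let ?U = "\<lambda>\<omega>. ennreal (exp (l * (\<Sum>i<m. \<zeta> i \<omega> * incr (c i) (c (Suc i)) \<omega>)))"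
    have "(\<lambda>\<omega>. \<Sum>i<m. \<zeta> i \<omega> * incr (c i) (c (Suc i)) \<omega>) \<in> borel_measurable (F (c m))"
    proof (intro borel_measurable_sum borel_measurable_times)
      fix i assume "i \<in> {..<m}"
      then have i: "i < m" by simp
      show "\<zeta> i \<in> borel_measurable (F (c m))"
        by (rule measurable_F_mono[OF \<zeta>m]) (use i mn cm in auto)
      show "incr (c i) (c (Suc i)) \<in> borel_measurable (F (c m))"
        by (rule measurable_F_mono[OF incr_measurable]) (use i mn cm c0 cs in auto)
    qed
    then have U: "?U \<in> borel_measurable (F (c m))" by measurable
    have L: "(\<lambda>\<omega>. l * \<zeta> m \<omega>) \<in> borel_measurable (F (c m))" using \<zeta>m[OF mn] by measurable
    have Lb: "\<bar>l * \<zeta> m \<omega>\<bar> \<le> \<bar>l\<bar> * M" if "\<omega> \<in> space P" for \<omega>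
      using \<zeta>b[OF mn that] by (simp add: abs_mult mult_left_mono)
    have "(\<integral>\<^sup>+\<omega>. ennreal (exp (l * (\<Sum>i<Suc m. \<zeta> i \<omega> * incr (c i) (c (Suc i)) \<omega>))) \<partial>P) =
      (\<integral>\<^sup>+\<omega>. ?U \<omega> * ennreal (exp (l * \<zeta> m \<omega> * incr (c m) (c (Suc m)) \<omega>)) \<partial>P)"
      by (intro nn_integral_cong) (simp add: distrib_left exp_add ennreal_mult mult.assoc)
    also have "\<dots> \<le> (\<integral>\<^sup>+\<omega>. ?U \<omega> \<partial>P) * ennreal (exp ((\<bar>l\<bar> * M)\<^sup>2 * (c (Suc m) - c m) / 2))"
      by (rule exponential_step[OF c0 cs[OF mn] U L Lb])
    also have "\<dots> \<le> ennreal (exp (l\<^sup>2 * M\<^sup>2 * (c m - c 0) / 2)) * ennreal (exp ((\<bar>l\<bar> * M)\<^sup>2 * (c (Suc m) - c m) / 2))"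
      by (intro mult_right_mono) (use Suc in auto)
    also have "\<dots> = ennreal (exp (l\<^sup>2 * M\<^sup>2 * (c m - c 0) / 2 + (\<bar>l\<bar> * M)\<^sup>2 * (c (Suc m) - c m) / 2))"
      by (simp add: exp_add ennreal_mult)
    also have "l\<^sup>2 * M\<^sup>2 * (c m - c 0) / 2 + (\<bar>l\<bar> * M)\<^sup>2 * (c (Suc m) - c m) / 2 = l\<^sup>2 * M\<^sup>2 * (c (Suc m) - c 0) / 2"
      by (simp add: power_mult_distrib field_simps)
    finally show ?case .
  qed
  from this[of n] have "(\<integral>\<^sup>+\<omega>. ennreal (exp (l * (simple_integral_wrt W \<phi> t \<omega> - simple_integral_wrt W \<phi> s \<omega>))) \<partial>P)
      \<le> ennreal (exp (l\<^sup>2 * M\<^sup>2 * (c n - c 0) / 2))" by (simp add: eq)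
  also have "\<dots> \<le> ennreal (exp (l\<^sup>2 * M\<^sup>2 * (t - s) / 2))"
    using cb(2)[of n] cb(1)[of 0] by (intro ennreal_leI) (simp add: mult_left_mono)
  finally show ?thesis .
qed

end

locale bounded_ito_integral = brownian_filtration +
  fixes \<sigma> I :: "real \<Rightarrow> 'a \<Rightarrow> real" and M :: real
  assumes predictable: "predictable P F \<sigma>"
    and M_nonneg: "0 \<le> M"
    and bounded: "\<And>t. 0 \<le> t \<Longrightarrow> AE \<omega> in P. \<bar>\<sigma> t \<omega>\<bar> \<le> M"
    and ito: "ito_integral P F W \<sigma> I"
begin

text \<open>The generators of the predictable sets are measurable rectangles. The indicator is needed because
  predictability says nothing about negative times.\<close>

lemma joint_measurable: "(\<lambda>(u, \<omega>). \<sigma> u \<omega> * indicator {0..} u) \<in> borel_measurable (borel \<Otimes>\<^sub>M P)"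
proof -
  let ?R = "restrict_space (borel \<Otimes>\<^sub>M P) ({0..} \<times> space P)"
  let ?G = "{{0} \<times> A | A. A \<in> sets (F 0)} \<union> {{s<..t} \<times> A | s t A. 0 \<le> s \<and> s < t \<and> A \<in> sets (F s)}"
  have S: "{0::real..} \<times> space P \<in> sets (borel \<Otimes>\<^sub>M P)" by simp
  have sub: "A \<in> sets P" "A \<subseteq> space P" if "A \<in> sets (F s)" for A s
    using that subalgebra_F[of s] sets.sets_into_space[OF that] by (auto simp: subalgebra_def)
  have G: "y \<in> sets (borel \<Otimes>\<^sub>M P) \<and> y \<subseteq> {0..} \<times> space P" if "y \<in> ?G" for y
    using that by (auto intro!: pair_measureI sub(1) dest: sub(2))
  have "(\<lambda>x. x) \<in> ?R \<rightarrow>\<^sub>M predictable_algebra (space P) F"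
    unfolding predictable_algebra_def
  proof (rule measurable_measure_of)
    show "?G \<subseteq> Pow ({0..} \<times> space P)" using G by blast
    show "(\<lambda>x. x) \<in> space ?R \<rightarrow> {0..} \<times> space P" by (auto simp: space_restrict_space)
    fix y assume y: "y \<in> ?G"
    have "(\<lambda>x. x) -` y \<inter> space ?R = y" using G[OF y] sets.sets_into_space by (auto simp: space_restrict_space)
    then show "(\<lambda>x. x) -` y \<inter> space ?R \<in> sets ?R"
      using G[OF y] S by (simp add: sets_restrict_space_iff)
  qed
  from measurable_compose[OF this predictable[unfolded predictable_def]]
  have "(\<lambda>(u, \<omega>). \<sigma> u \<omega>) \<in> borel_measurable ?R" by simp
  then have "(\<lambda>x. indicator ({0..} \<times> space P) x *\<^sub>R (case x of (u, \<omega>) \<Rightarrow> \<sigma> u \<omega>)) \<in> borel_measurable (borel \<Otimes>\<^sub>M P)"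
    using S by (subst (asm) borel_measurable_restrict_space_iff) auto
  also have "?this \<longleftrightarrow> ?thesis"
    by (intro measurable_cong) (auto simp: indicator_def space_pair_measure)
  finally show ?thesis .
qed

definition mean_square_error :: "'a simple_process \<Rightarrow> real \<Rightarrow> ennreal" where
  "mean_square_error \<phi> t = (\<integral>\<^sup>+\<omega>. (\<integral>\<^sup>+u\<in>{0..t}. ennreal ((simple_value \<phi> u \<omega> - \<sigma> u \<omega>)\<^sup>2) \<partial>lborel) \<partial>P)"

lemma simple_value_measurable:
  assumes "simple_process F \<phi>"
  shows "(\<lambda>(u, \<omega>). simple_value \<phi> u \<omega>) \<in> borel_measurable (borel \<Otimes>\<^sub>M P)"
proof -
  obtain n \<tau> \<xi> where p: "\<phi> = (n, \<tau>, \<xi>)" by (metis prod_cases3)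
  have "\<xi> i \<in> borel_measurable P" if "i < n" for i
    using assms that by (auto simp: p intro: measurable_F_P)
  then show ?thesis unfolding p simple_value.simps case_prod_beta
    by (intro borel_measurable_sum borel_measurable_times) (auto intro: measurable_compose[OF measurable_snd])
qed

lemma mean_square_error_integrand_measurable:
  assumes "simple_process F \<phi>"
  shows "(\<lambda>(u, \<omega>). ennreal ((simple_value \<phi> u \<omega> - \<sigma> u \<omega>)\<^sup>2) * indicator {0..t} u) \<in> borel_measurable (lborel \<Otimes>\<^sub>M P)"
proof -
  note [measurable] = joint_measurable simple_value_measurable[OF assms]
  have "(\<lambda>(u, \<omega>). ennreal ((simple_value \<phi> u \<omega> - \<sigma> u \<omega> * indicator {0..} u)\<^sup>2) * indicator {0..t} u) \<in> borel_measurable (borel \<Otimes>\<^sub>M P)"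
    by measurable
  moreover have "ennreal ((simple_value \<phi> u \<omega> - \<sigma> u \<omega> * indicator {0..} u)\<^sup>2) * indicator {0..t} u =
    ennreal ((simple_value \<phi> u \<omega> - \<sigma> u \<omega>)\<^sup>2) * indicator {0..t} u" for u \<omega>
    by (auto simp: indicator_def)
  ultimately show ?thesis by (simp cong: measurable_cong_sets add: sets_pair_measure_cong[OF sets_lborel refl])
qed

text \<open>Truncation at \<open>M\<close> never increases the distance to a number in \<open>[- M, M]\<close>. The bound on \<open>\<sigma>\<close> holds
  almost surely at each fixed time, hence the integral over \<open>\<omega>\<close> is taken first.\<close>

lemma mean_square_error_clip_le:
  assumes \<phi>: "simple_process F \<phi>"
  shows "mean_square_error (clip M \<phi>) t \<le> mean_square_error \<phi> t"
proof -
  interpret pair_sigma_finite lborel P ..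
  note c = simple_process_clip(1)[OF M_nonneg \<phi>]
  have swap: "mean_square_error \<psi> t = (\<integral>\<^sup>+u. (\<integral>\<^sup>+\<omega>. ennreal ((simple_value \<psi> u \<omega> - \<sigma> u \<omega>)\<^sup>2) * indicator {0..t} u \<partial>P) \<partial>lborel)"
    if "simple_process F \<psi>" for \<psi>
    unfolding mean_square_error_def using Fubini[OF mean_square_error_integrand_measurable[OF that, of t]] by simp
  show ?thesis unfolding swap[OF \<phi>] swap[OF c]
  proof (rule nn_integral_mono)
    fix u :: real
    show "(\<integral>\<^sup>+\<omega>. ennreal ((simple_value (clip M \<phi>) u \<omega> - \<sigma> u \<omega>)\<^sup>2) * indicator {0..t} u \<partial>P) \<le>
      (\<integral>\<^sup>+\<omega>. ennreal ((simple_value \<phi> u \<omega> - \<sigma> u \<omega>)\<^sup>2) * indicator {0..t} u \<partial>P)"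
    proof (cases "u \<in> {0..t}")
      case True
      then have "AE \<omega> in P. \<bar>\<sigma> u \<omega>\<bar> \<le> M" using bounded by simp
      then show ?thesis
        by (intro nn_integral_mono_AE)
          (auto elim!: eventually_mono intro!: mult_right_mono ennreal_leI clamp_real_closer
            simp: simple_value_clip[OF M_nonneg \<phi>])
    qed simp
  qed
qed

lemma mean_square_error_mono: "r \<le> t \<Longrightarrow> mean_square_error \<phi> r \<le> mean_square_error \<phi> t"
  unfolding mean_square_error_def by (intro nn_integral_mono mult_left_mono) (auto simp: indicator_def)

lemma simple_integral_distance_le:
  assumes \<phi>: "simple_process F \<phi>" and \<psi>: "simple_process F \<psi>" and t: "0 \<le> t"
  shows "(\<integral>\<^sup>+\<omega>. ennreal ((simple_integral_wrt W \<phi> t \<omega> - simple_integral_wrt W \<psi> t \<omega>)\<^sup>2) \<partial>P) \<le>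
    2 * mean_square_error \<phi> t + 2 * mean_square_error \<psi> t"
proof -
  interpret pair_sigma_finite lborel P ..
  let ?f = "\<lambda>\<phi> u \<omega>. ennreal ((simple_value \<phi> u \<omega> - \<sigma> u \<omega>)\<^sup>2) * indicator {0..t} u"
  have m: "(\<lambda>(u, \<omega>). ?f \<phi> u \<omega>) \<in> borel_measurable (lborel \<Otimes>\<^sub>M P)"
    "(\<lambda>(u, \<omega>). ?f \<psi> u \<omega>) \<in> borel_measurable (lborel \<Otimes>\<^sub>M P)"
    by (intro mean_square_error_integrand_measurable \<phi> \<psi>)+
  have m1: "(\<lambda>u. ?f \<phi> u \<omega>) \<in> borel_measurable lborel" "(\<lambda>u. ?f \<psi> u \<omega>) \<in> borel_measurable lborel"
    if "\<omega> \<in> space P" for \<omega>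
    using measurable_compose[OF measurable_Pair2'[OF that] m(1)] measurable_compose[OF measurable_Pair2'[OF that] m(2)]
    by simp_all
  have m2: "(\<lambda>\<omega>. \<integral>\<^sup>+u. ?f \<phi> u \<omega> \<partial>lborel) \<in> borel_measurable P" "(\<lambda>\<omega>. \<integral>\<^sup>+u. ?f \<psi> u \<omega> \<partial>lborel) \<in> borel_measurable P"
    using lborel.borel_measurable_nn_integral_fst[OF measurable_pair_swap[OF m(1)]]
      lborel.borel_measurable_nn_integral_fst[OF measurable_pair_swap[OF m(2)]] by simp_all
  have "(\<integral>\<^sup>+\<omega>. ennreal ((simple_integral_wrt W \<phi> t \<omega> - simple_integral_wrt W \<psi> t \<omega>)\<^sup>2) \<partial>P) =
    (\<integral>\<^sup>+\<omega>. (\<integral>\<^sup>+u\<in>{0..t}. ennreal ((simple_value \<phi> u \<omega> - simple_value \<psi> u \<omega>)\<^sup>2) \<partial>lborel) \<partial>P)"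
    by (rule simple_isometry[OF \<phi> \<psi> t])
  also have "\<dots> \<le> (\<integral>\<^sup>+\<omega>. (\<integral>\<^sup>+u. 2 * ?f \<phi> u \<omega> + 2 * ?f \<psi> u \<omega> \<partial>lborel) \<partial>P)"
  proof (intro nn_integral_mono)
    fix \<omega> u
    show "ennreal ((simple_value \<phi> u \<omega> - simple_value \<psi> u \<omega>)\<^sup>2) * indicator {0..t} u \<le> 2 * ?f \<phi> u \<omega> + 2 * ?f \<psi> u \<omega>"
      using ennreal_square_triangle[of "simple_value \<phi> u \<omega>" "simple_value \<psi> u \<omega>" "\<sigma> u \<omega>"]
      by (auto simp: indicator_def power2_commute[of "\<sigma> u \<omega>"])
  qed
  also have "\<dots> = (\<integral>\<^sup>+\<omega>. 2 * (\<integral>\<^sup>+u. ?f \<phi> u \<omega> \<partial>lborel) + 2 * (\<integral>\<^sup>+u. ?f \<psi> u \<omega> \<partial>lborel) \<partial>P)"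
  proof (rule nn_integral_cong)
    fix \<omega> assume \<omega>: "\<omega> \<in> space P"
    have "(\<integral>\<^sup>+u. 2 * ?f \<phi> u \<omega> + 2 * ?f \<psi> u \<omega> \<partial>lborel) =
      (\<integral>\<^sup>+u. 2 * ?f \<phi> u \<omega> \<partial>lborel) + (\<integral>\<^sup>+u. 2 * ?f \<psi> u \<omega> \<partial>lborel)"
      by (rule nn_integral_add) (use m1[OF \<omega>] in measurable)
    then show "(\<integral>\<^sup>+u. 2 * ?f \<phi> u \<omega> + 2 * ?f \<psi> u \<omega> \<partial>lborel) =
      2 * (\<integral>\<^sup>+u. ?f \<phi> u \<omega> \<partial>lborel) + 2 * (\<integral>\<^sup>+u. ?f \<psi> u \<omega> \<partial>lborel)"
      by (simp only: nn_integral_cmult[OF m1(1)[OF \<omega>]] nn_integral_cmult[OF m1(2)[OF \<omega>]])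
  qed
  also have "\<dots> = (\<integral>\<^sup>+\<omega>. 2 * (\<integral>\<^sup>+u. ?f \<phi> u \<omega> \<partial>lborel) \<partial>P) + (\<integral>\<^sup>+\<omega>. 2 * (\<integral>\<^sup>+u. ?f \<psi> u \<omega> \<partial>lborel) \<partial>P)"
    by (rule nn_integral_add) (use m2 in measurable)
  also have "\<dots> = 2 * mean_square_error \<phi> t + 2 * mean_square_error \<psi> t"
    unfolding mean_square_error_def by (simp only: nn_integral_cmult[OF m2(1)] nn_integral_cmult[OF m2(2)])
  finally show ?thesis .
qed

lemma I_measurable: "0 \<le> t \<Longrightarrow> I t \<in> borel_measurable P"
  using ito by (auto simp: ito_integral_def)

lemma ito_approx:
  assumes "0 \<le> t"
  obtains \<phi> where "\<And>k. simple_process F (\<phi> k)" "(\<lambda>k. mean_square_error (\<phi> k) t) \<longlonglongrightarrow> 0"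
    "(\<lambda>k. \<integral>\<^sup>+\<omega>. ennreal ((simple_integral_wrt W (\<phi> k) t \<omega> - I t \<omega>)\<^sup>2) \<partial>P) \<longlonglongrightarrow> 0"
  using ito assms unfolding ito_integral_def mean_square_error_def by blast

text \<open>The definition of the stochastic integral provides a separate approximating sequence for each time.
  By the isometry, the truncation of the sequence for \<open>t\<close> also approximates the integral at every earlier
  time \<open>r\<close>: its integral up to \<open>r\<close> is close to that of the sequence for \<open>r\<close>, because both integrands are
  close to \<open>\<sigma>\<close> on \<open>[0, r]\<close>. A common sequence is what allows for increments.\<close>

lemma bounded_simple_approx:
  assumes t: "0 \<le> t"
  obtains \<psi> where "\<And>k. simple_process F (\<psi> k)" "\<And>k. coeffs_bounded (space P) M (\<psi> k)"
    "\<And>r. 0 \<le> r \<Longrightarrow> r \<le> t \<Longrightarrow>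
      (\<lambda>k. \<integral>\<^sup>+\<omega>. ennreal ((simple_integral_wrt W (\<psi> k) r \<omega> - I r \<omega>)\<^sup>2) \<partial>P) \<longlonglongrightarrow> 0"
proof -
  obtain \<phi> where \<phi>: "\<And>k. simple_process F (\<phi> k)" "(\<lambda>k. mean_square_error (\<phi> k) t) \<longlonglongrightarrow> 0"
    using ito_approx[OF t] by blast
  define \<psi> where "\<psi> k = clip M (\<phi> k)" for k
  have \<psi>: "simple_process F (\<psi> k)" "coeffs_bounded (space P) M (\<psi> k)" for k
    unfolding \<psi>_def by (rule simple_process_clip[OF M_nonneg \<phi>(1)])+
  have lim: "(\<lambda>k. \<integral>\<^sup>+\<omega>. ennreal ((simple_integral_wrt W (\<psi> k) r \<omega> - I r \<omega>)\<^sup>2) \<partial>P) \<longlonglongrightarrow> 0"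
    if r: "0 \<le> r" "r \<le> t" for r
  proof -
    obtain \<theta> where \<theta>: "\<And>k. simple_process F (\<theta> k)" "(\<lambda>k. mean_square_error (\<theta> k) r) \<longlonglongrightarrow> 0"
      "(\<lambda>k. \<integral>\<^sup>+\<omega>. ennreal ((simple_integral_wrt W (\<theta> k) r \<omega> - I r \<omega>)\<^sup>2) \<partial>P) \<longlonglongrightarrow> 0"
      using ito_approx[OF r(1)] by blast
    let ?e = "\<lambda>k. 2 * (2 * mean_square_error (\<phi> k) t + 2 * mean_square_error (\<theta> k) r) +
      2 * (\<integral>\<^sup>+\<omega>. ennreal ((simple_integral_wrt W (\<theta> k) r \<omega> - I r \<omega>)\<^sup>2) \<partial>P)"
    have le: "(\<integral>\<^sup>+\<omega>. ennreal ((simple_integral_wrt W (\<psi> k) r \<omega> - I r \<omega>)\<^sup>2) \<partial>P) \<le> ?e k" for k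
    proof -
      have "mean_square_error (\<psi> k) r \<le> mean_square_error (\<phi> k) t"
        unfolding \<psi>_def using mean_square_error_mono[OF r(2)] mean_square_error_clip_le[OF \<phi>(1)] order.trans by blast
      then have "2 * mean_square_error (\<psi> k) r + 2 * mean_square_error (\<theta> k) r \<le> 2 * mean_square_error (\<phi> k) t + 2 * mean_square_error (\<theta> k) r"
        by (intro add_mono mult_left_mono) auto
      then have "(\<integral>\<^sup>+\<omega>. ennreal ((simple_integral_wrt W (\<psi> k) r \<omega> - simple_integral_wrt W (\<theta> k) r \<omega>)\<^sup>2) \<partial>P) \<le>
        2 * mean_square_error (\<phi> k) t + 2 * mean_square_error (\<theta> k) r"
        using simple_integral_distance_le[OF \<psi>(1)[of k] \<theta>(1)[of k] r(1)] by (rule order.trans[rotated])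
      then have "2 * (\<integral>\<^sup>+\<omega>. ennreal ((simple_integral_wrt W (\<psi> k) r \<omega> - simple_integral_wrt W (\<theta> k) r \<omega>)\<^sup>2) \<partial>P)
        + 2 * (\<integral>\<^sup>+\<omega>. ennreal ((simple_integral_wrt W (\<theta> k) r \<omega> - I r \<omega>)\<^sup>2) \<partial>P) \<le> ?e k"
        by (intro add_mono mult_left_mono) auto
      with nn_integral_square_triangle[OF simple_integral_measurable[OF \<psi>(1) r(1)]
          simple_integral_measurable[OF \<theta>(1) r(1)] I_measurable[OF r(1)], of k k]
      show ?thesis by (rule order.trans)
    qed
    have "?e \<longlonglongrightarrow> 2 * (2 * 0 + 2 * 0) + 2 * 0"
      by (intro tendsto_add ennreal_tendsto_cmult \<theta> \<phi>) auto
    then have "?e \<longlonglongrightarrow> 0" by simp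
    then show ?thesis
      by (rule tendsto_sandwich[OF always_eventually[OF allI[OF zero_le]] always_eventually[OF allI[OF le]] tendsto_const])
  qed
  show ?thesis
  proof (rule that[of \<psi>])
    show "simple_process F (\<psi> k)" "coeffs_bounded (space P) M (\<psi> k)" for k by (rule \<psi>)+
    show "(\<lambda>k. \<integral>\<^sup>+\<omega>. ennreal ((simple_integral_wrt W (\<psi> k) r \<omega> - I r \<omega>)\<^sup>2) \<partial>P) \<longlonglongrightarrow> 0"
      if "0 \<le> r" "r \<le> t" for r using that by (rule lim)
  qed
qed

lemma increment_exponential_moment:
  assumes st: "0 \<le> s" "s \<le> t"
  shows "(\<integral>\<^sup>+\<omega>. ennreal (exp (l * (I t \<omega> - I s \<omega>))) \<partial>P) \<le> ennreal (exp (l\<^sup>2 * M\<^sup>2 * (t - s) / 2))"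
proof -
  have t: "0 \<le> t" using st by simp
  obtain \<psi> where \<psi>: "\<And>k. simple_process F (\<psi> k)" "\<And>k. coeffs_bounded (space P) M (\<psi> k)"
    and lim: "\<And>r. 0 \<le> r \<Longrightarrow> r \<le> t \<Longrightarrow>
      (\<lambda>k. \<integral>\<^sup>+\<omega>. ennreal ((simple_integral_wrt W (\<psi> k) r \<omega> - I r \<omega>)\<^sup>2) \<partial>P) \<longlonglongrightarrow> 0"
    using bounded_simple_approx[OF t] by blast
  note [measurable] = I_measurable[OF t] I_measurable[OF st(1)]
    simple_integral_measurable[OF \<psi>(1) t] simple_integral_measurable[OF \<psi>(1) st(1)]
  have "(\<lambda>k. \<integral>\<^sup>+\<omega>. ennreal (((simple_integral_wrt W (\<psi> k) t \<omega> - simple_integral_wrt W (\<psi> k) s \<omega>) - (I t \<omega> - I s \<omega>))\<^sup>2) \<partial>P) \<longlonglongrightarrow> 0"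
  proof (rule tendsto_sandwich[OF _ _ tendsto_const])
    let ?e = "\<lambda>k. 2 * (\<integral>\<^sup>+\<omega>. ennreal ((simple_integral_wrt W (\<psi> k) t \<omega> - I t \<omega>)\<^sup>2) \<partial>P) +
      2 * (\<integral>\<^sup>+\<omega>. ennreal ((simple_integral_wrt W (\<psi> k) s \<omega> - I s \<omega>)\<^sup>2) \<partial>P)"
    have "?e \<longlonglongrightarrow> 2 * 0 + 2 * 0"
      by (intro tendsto_add ennreal_tendsto_cmult lim) (use st in auto)
    then show "?e \<longlonglongrightarrow> 0" by simp
    show "\<forall>\<^sub>F k in sequentially. (\<integral>\<^sup>+\<omega>. ennreal (((simple_integral_wrt W (\<psi> k) t \<omega> - simple_integral_wrt W (\<psi> k) s \<omega>) - (I t \<omega> - I s \<omega>))\<^sup>2) \<partial>P) \<le> ?e k"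
    proof (rule always_eventually, rule allI)
      fix k
      have "(\<integral>\<^sup>+\<omega>. ennreal (((simple_integral_wrt W (\<psi> k) t \<omega> - simple_integral_wrt W (\<psi> k) s \<omega>) - (I t \<omega> - I s \<omega>))\<^sup>2) \<partial>P) \<le>
        (\<integral>\<^sup>+\<omega>. 2 * ennreal ((simple_integral_wrt W (\<psi> k) t \<omega> - I t \<omega>)\<^sup>2) + 2 * ennreal ((simple_integral_wrt W (\<psi> k) s \<omega> - I s \<omega>)\<^sup>2) \<partial>P)"
      proof (intro nn_integral_mono)
        fix \<omega>
        show "ennreal (((simple_integral_wrt W (\<psi> k) t \<omega> - simple_integral_wrt W (\<psi> k) s \<omega>) - (I t \<omega> - I s \<omega>))\<^sup>2) \<le>
          2 * ennreal ((simple_integral_wrt W (\<psi> k) t \<omega> - I t \<omega>)\<^sup>2) + 2 * ennreal ((simple_integral_wrt W (\<psi> k) s \<omega> - I s \<omega>)\<^sup>2)"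
          using ennreal_square_triangle[where x = "simple_integral_wrt W (\<psi> k) t \<omega> - I t \<omega>" and y = 0
            and z = "simple_integral_wrt W (\<psi> k) s \<omega> - I s \<omega>"]
          by (simp add: algebra_simps power2_commute[of "I s \<omega>" "simple_integral_wrt W (\<psi> k) s \<omega>"])
      qed
      also have "\<dots> = ?e k" by (simp add: nn_integral_add nn_integral_cmult)
      finally show "(\<integral>\<^sup>+\<omega>. ennreal (((simple_integral_wrt W (\<psi> k) t \<omega> - simple_integral_wrt W (\<psi> k) s \<omega>) - (I t \<omega> - I s \<omega>))\<^sup>2) \<partial>P) \<le> ?e k" .
    qed
  qed auto
  then obtain r where r: "AE \<omega> in P. (\<lambda>k. simple_integral_wrt W (\<psi> (r k)) t \<omega> - simple_integral_wrt W (\<psi> (r k)) s \<omega>) \<longlonglongrightarrow> I t \<omega> - I s \<omega>"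
    by (rule L2_limit_AE_subsequence[rotated 2]) auto
  show ?thesis
  proof (rule nn_integral_limit_le)
    show "AE \<omega> in P. (\<lambda>k. ennreal (exp (l * (simple_integral_wrt W (\<psi> (r k)) t \<omega> - simple_integral_wrt W (\<psi> (r k)) s \<omega>))))
        \<longlonglongrightarrow> ennreal (exp (l * (I t \<omega> - I s \<omega>)))"
      using r by (auto elim!: eventually_mono intro!: tendsto_ennrealI tendsto_exp tendsto_mult_left)
  qed (measurable, intro simple_integral_exponential_moment \<psi> M_nonneg st)
qed

end

section \<open>The pathwise solution and Riemann sums\<close>

lemma left_riemann_sums_tendsto:
  fixes g :: "real \<Rightarrow> real"
  assumes t: "0 < t" and g: "continuous_on {0..t} g"
  shows "(\<lambda>n::nat. \<Sum>j<n. t / real n * g (real j * (t / real n))) \<longlonglongrightarrow> integral {0..t} g"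
proof (rule LIMSEQ_I)
  fix r :: real assume r: "0 < r"
  define e where "e = r / (2 * t)"
  have e: "e > 0" using r t by (simp add: e_def)
  have "uniformly_continuous_on {0..t} g" by (rule compact_uniformly_continuous[OF g]) simp
  then obtain d where d: "d > 0" "\<And>x y. x \<in> {0..t} \<Longrightarrow> y \<in> {0..t} \<Longrightarrow> \<bar>x - y\<bar> < d \<Longrightarrow> \<bar>g x - g y\<bar> < e"
    using e unfolding uniformly_continuous_on_def dist_real_def by metis
  obtain N where N: "t / d < real N" using reals_Archimedean2 by blast
  have N0: "0 < N" using N d t by (metis divide_pos_pos gr0I less_asym of_nat_0)
  show "\<exists>no. \<forall>n\<ge>no. norm ((\<Sum>j<n. t / real n * g (real j * (t / real n))) - integral {0..t} g) < r"
  proof (intro exI allI impI)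
    fix n assume n: "N \<le> n"
    define h where "h = t / real n"
    have n0: "0 < n" using N0 n by simp
    have h: "0 < h" "real n * h = t" using n0 t by (auto simp: h_def)
    have "t / d < real n" using N n by linarith
    then have hd: "h < d" using d n0 by (simp add: h_def field_simps)
    have le: "j \<le> n \<Longrightarrow> real j * h \<le> t" for j
      using h by (metis mult_right_mono of_nat_le_iff order_less_imp_le)
    have cell: "\<bar>integral {real j * h..real (Suc j) * h} g - h * g (real j * h)\<bar> \<le> e * h" if "j < n" for j
    proof -
      have sub: "{real j * h..real (Suc j) * h} \<subseteq> {0..t}" using le[of "Suc j"] that h by auto
      have c: "continuous_on {real j * h..real (Suc j) * h} g" by (rule continuous_on_subset[OF g sub])
      have jj: "real j * h \<le> real (Suc j) * h" using h by (simp add: algebra_simps)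
      have gi: "g integrable_on {real j * h..real (Suc j) * h}" by (rule integrable_continuous_real[OF c])
      have "norm (integral {real j * h..real (Suc j) * h} (\<lambda>x. g x - g (real j * h))) \<le> e * (real (Suc j) * h - real j * h)"
      proof (rule integral_bound[OF jj])
        show "continuous_on {real j * h..real (Suc j) * h} (\<lambda>x. g x - g (real j * h))" by (intro continuous_intros c)
        fix x assume x: "x \<in> {real j * h..real (Suc j) * h}"
        have "real j * h \<in> {real j * h..real (Suc j) * h}" using jj by simp
        moreover have "\<bar>x - real j * h\<bar> < d" using x hd by (simp add: algebra_simps)
        ultimately show "norm (g x - g (real j * h)) \<le> e" using d(2)[of x "real j * h"] x sub by fastforce
      qed
      moreover have "integral {real j * h..real (Suc j) * h} (\<lambda>x. g x - g (real j * h)) = integral {real j * h..real (Suc j) * h} g - h * g (real j * h)"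
        using gi jj by (subst integral_diff) (auto simp: algebra_simps)
      ultimately show ?thesis by (simp add: algebra_simps)
    qed
    have split: "m \<le> n \<Longrightarrow> integral {0..real m * h} g = (\<Sum>j<m. integral {real j * h..real (Suc j) * h} g)" for m
    proof (induction m)
      case (Suc m)
      have "g integrable_on {0..real (Suc m) * h}"
        by (rule integrable_continuous_real[OF continuous_on_subset[OF g]]) (use le[OF Suc.prems] in auto)
      then have "integral {0..real m * h} g + integral {real m * h..real (Suc m) * h} g = integral {0..real (Suc m) * h} g"
        using h by (intro Henstock_Kurzweil_Integration.integral_combine) (auto simp: algebra_simps)
      then show ?case using Suc by simp
    qed simp
    have "integral {0..t} g = (\<Sum>j<n. integral {real j * h..real (Suc j) * h} g)" using split[of n] h by simp
    then have "\<bar>(\<Sum>j<n. h * g (real j * h)) - integral {0..t} g\<bar> = \<bar>\<Sum>j<n. integral {real j * h..real (Suc j) * h} g - h * g (real j * h)\<bar>"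
      by (simp add: sum_subtractf abs_minus_commute)
    also have "\<dots> \<le> (\<Sum>j<n. \<bar>integral {real j * h..real (Suc j) * h} g - h * g (real j * h)\<bar>)" by (rule sum_abs)
    also have "\<dots> \<le> (\<Sum>j<n. e * h)" by (intro sum_mono cell) simp
    also have "\<dots> = e * t" using h by simp
    also have "\<dots> < r" using r t by (simp add: e_def)
    finally show "norm ((\<Sum>j<n. t / real n * g (real j * (t / real n))) - integral {0..t} g) < r" by (simp add: h_def)
  qed
qed

text \<open>Let \<open>A s\<close> be the integral of \<open>x\<close> over \<open>[0, s]\<close>. The equation shows that \<open>x\<close> is continuous, so
  \<open>A' = x\<close>, and \<open>s \<mapsto> exp (\<kappa> s) A s\<close> has derivative \<open>exp (\<kappa> s) (x 0 + i s)\<close>. This determines \<open>A t\<close>, and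
  hence \<open>x t\<close>. The form of the result is chosen so that only increments of \<open>i\<close> occur; at \<open>t = 0\<close> the
  equation gives \<open>i 0 = 0\<close>.\<close>

lemma linear_equation_solution:
  fixes x i :: "real \<Rightarrow> real"
  assumes i: "continuous_on {0..} i"
    and xi: "\<And>t. 0 \<le> t \<Longrightarrow> set_integrable lborel {0..t} x"
    and eq: "\<And>t. 0 \<le> t \<Longrightarrow> x t = x 0 + (LINT s:{0..t}|lborel. - \<kappa> * x s) + i t"
    and t: "0 \<le> t"
  shows "x t = exp (- \<kappa> * t) * x 0 + exp (- \<kappa> * t) * (i t - i 0) +
    integral {0..t} (\<lambda>s. \<kappa> * exp (- \<kappa> * (t - s)) * (i t - i s))"
proof -
  have "x integrable_on {0..s} \<and> (LINT u:{0..s}|lborel. x u) = integral {0..s} x" if "0 \<le> s" for s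
    using set_borel_integral_eq_integral[OF xi[OF that]] by blast
  then have HK: "x integrable_on {0..s}" "(LINT u:{0..s}|lborel. - \<kappa> * x u) = - \<kappa> * integral {0..s} x"
    if "0 \<le> s" for s
    using that by (simp_all only: set_integral_mult_right)
  define A where "A s = integral {0..s} x" for s
  have xs: "x s = x 0 - \<kappa> * A s + i s" if "0 \<le> s" for s
    using eq[OF that] HK(2)[OF that] by (simp add: A_def)
  have i0: "i 0 = 0" using xs[of 0] by (simp add: A_def)
  have ci: "continuous_on {0..t} i" using i by (rule continuous_on_subset) auto
  have "continuous_on {0..t} A" unfolding A_def by (rule indefinite_integral_continuous_1[OF HK(1)[OF t]])
  then have "continuous_on {0..t} (\<lambda>s. x 0 - \<kappa> * A s + i s)" by (intro continuous_intros ci)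
  then have cx: "continuous_on {0..t} x" by (subst continuous_on_cong[OF refl xs]) auto
  have dA: "(A has_real_derivative x s) (at s within {0..t})" if "s \<in> {0..t}" for s
    unfolding A_def by (rule integral_has_real_derivative[OF cx that])
  have 1: "((\<lambda>s. exp (\<kappa> * s) * (x 0 + i s)) has_integral exp (\<kappa> * t) * A t - exp (\<kappa> * 0) * A 0) {0..t}"
  proof (rule fundamental_theorem_of_calculus[OF t])
    fix s assume s: "s \<in> {0..t}"
    have "((\<lambda>s. exp (\<kappa> * s) * A s) has_real_derivative \<kappa> * exp (\<kappa> * s) * A s + x s * exp (\<kappa> * s)) (at s within {0..t})"
      using dA[OF s] by (auto intro!: derivative_eq_intros)
    moreover have "\<kappa> * exp (\<kappa> * s) * A s + x s * exp (\<kappa> * s) = exp (\<kappa> * s) * (x s + \<kappa> * A s)"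
      by (simp add: algebra_simps)
    moreover have "x s + \<kappa> * A s = x 0 + i s" using xs[of s] s by simp
    ultimately show "((\<lambda>s. exp (\<kappa> * s) * A s) has_vector_derivative exp (\<kappa> * s) * (x 0 + i s)) (at s within {0..t})"
      by (simp add: has_real_derivative_iff_has_vector_derivative)
  qed
  have 2: "((\<lambda>s. \<kappa> * exp (\<kappa> * s)) has_integral exp (\<kappa> * t) - exp (\<kappa> * 0)) {0..t}"
    by (rule fundamental_theorem_of_calculus[OF t])
      (auto intro!: derivative_eq_intros simp flip: has_real_derivative_iff_has_vector_derivative)
  have A0: "A 0 = 0" by (simp add: A_def)
  have "((\<lambda>s. exp (- \<kappa> * t) * ((x 0 + i t) * (\<kappa> * exp (\<kappa> * s)) - \<kappa> * (exp (\<kappa> * s) * (x 0 + i s)))) has_integral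
      exp (- \<kappa> * t) * ((x 0 + i t) * (exp (\<kappa> * t) - exp (\<kappa> * 0)) - \<kappa> * (exp (\<kappa> * t) * A t - exp (\<kappa> * 0) * A 0))) {0..t}"
    by (intro has_integral_mult_right has_integral_diff 1 2)
  moreover have "exp (- \<kappa> * t) * ((x 0 + i t) * (\<kappa> * exp (\<kappa> * s)) - \<kappa> * (exp (\<kappa> * s) * (x 0 + i s))) =
      \<kappa> * exp (- \<kappa> * (t - s)) * (i t - i s)" for s
  proof -
    have "- \<kappa> * (t - s) = - \<kappa> * t + \<kappa> * s" by (simp add: algebra_simps)
    then have "exp (- \<kappa> * (t - s)) = exp (- \<kappa> * t) * exp (\<kappa> * s)" by (simp only: exp_add)
    then show ?thesis by (simp only:) (simp add: algebra_simps)
  qed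
  moreover have "exp (- \<kappa> * t) * ((x 0 + i t) * (exp (\<kappa> * t) - exp (\<kappa> * 0)) - \<kappa> * (exp (\<kappa> * t) * A t - exp (\<kappa> * 0) * A 0))
      = (x 0 + i t) - exp (- \<kappa> * t) * (x 0 + i t) - \<kappa> * A t"
  proof -
    define a b where "a = exp (- \<kappa> * t)" and "b = exp (\<kappa> * t)"
    have "a * b = 1" by (simp add: a_def b_def flip: exp_add)
    moreover have "a * ((x 0 + i t) * (b - 1) - \<kappa> * (b * A t)) = (a * b) * (x 0 + i t) - a * (x 0 + i t) - \<kappa> * ((a * b) * A t)"
      by (simp add: algebra_simps)
    ultimately show ?thesis unfolding a_def[symmetric] b_def[symmetric] by (simp add: A0)
  qed
  ultimately have "integral {0..t} (\<lambda>s. \<kappa> * exp (- \<kappa> * (t - s)) * (i t - i s)) = (x 0 + i t) - exp (- \<kappa> * t) * (x 0 + i t) - \<kappa> * A t"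
    by (simp add: integral_unique)
  then show ?thesis using xs[OF t] i0 by (simp add: algebra_simps)
qed

text \<open>Convexity of the exponential, with the missing mass put at 0. The proof sums the tangent line
  inequality at the point \<open>m\<close>.\<close>

lemma exp_subconvex:
  fixes w y :: "'i \<Rightarrow> real"
  assumes "\<And>j. j \<in> S \<Longrightarrow> 0 \<le> w j" "sum w S \<le> 1"
  shows "exp (\<Sum>j\<in>S. w j * y j) \<le> (\<Sum>j\<in>S. w j * exp (y j)) + (1 - sum w S)"
proof -
  define m where "m = (\<Sum>j\<in>S. w j * y j)"
  have tangent: "exp m * (1 + z - m) \<le> exp z" for z
  proof -
    have "exp m * (1 + (z - m)) \<le> exp m * exp (z - m)" by (intro mult_left_mono exp_ge_add_one_self) auto
    then show ?thesis by (simp add: algebra_simps flip: exp_add)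
  qed
  have "exp m = (\<Sum>j\<in>S. w j * (exp m * (1 + y j - m))) + (1 - sum w S) * (exp m * (1 + 0 - m))"
  proof -
    have "w j * (exp m * (1 + y j - m)) = exp m * (1 - m) * w j + exp m * (w j * y j)" for j
      by (simp add: algebra_simps)
    then have "(\<Sum>j\<in>S. w j * (exp m * (1 + y j - m))) = exp m * (1 - m) * sum w S + exp m * m"
      by (simp add: sum.distrib m_def flip: sum_distrib_left)
    then show ?thesis by (simp add: algebra_simps)
  qed
  also have "\<dots> \<le> (\<Sum>j\<in>S. w j * exp (y j)) + (1 - sum w S) * exp 0"
    by (intro add_mono sum_mono mult_left_mono tangent) (use assms in auto)
  finally show ?thesis by (simp add: m_def)
qed

lemma exp_sum3_le: "exp (a + b + c) \<le> exp (3 * a) + exp (3 * b) + exp (3 * c)" for a b c :: real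
proof -
  have "a + b + c \<le> 3 * a \<or> a + b + c \<le> 3 * b \<or> a + b + c \<le> 3 * c" by linarith
  then have "exp (a + b + c) \<le> exp (3 * a) \<or> exp (a + b + c) \<le> exp (3 * b) \<or> exp (a + b + c) \<le> exp (3 * c)"
    by simp
  moreover have "0 < exp (3 * a)" "0 < exp (3 * b)" "0 < exp (3 * c)" by simp_all
  ultimately show ?thesis by linarith
qed

text \<open>The left-hand side is a left Riemann sum of an increasing function whose integral over \<open>[0, t]\<close> is
  \<open>1 - exp (- \<kappa> t / 2)\<close>. It is a geometric sum, and \<open>c \<le> exp c - 1\<close> gives the bound.\<close>

lemma geometric_left_sum_le:
  fixes \<kappa> t :: real and n :: nat
  assumes "0 < \<kappa>" "0 < t"
  shows "(\<Sum>j<n. t / real n * (\<kappa> / 2 * exp (- \<kappa> * (t - real j * (t / real n)) / 2))) \<le> 1"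
proof (cases "n = 0")
  case False
  define h where "h = t / real n"
  define c where "c = \<kappa> * h / 2"
  have c: "0 < c" "real n * c = \<kappa> * t / 2" using assms False by (auto simp: c_def h_def)
  have "(\<Sum>j<n. h * (\<kappa> / 2 * exp (- \<kappa> * (t - real j * h) / 2))) = (\<Sum>j<n. exp (- real n * c) * c * exp c ^ j)"
  proof (rule sum.cong[OF refl])
    fix j
    have e: "- \<kappa> * (t - real j * h) / 2 = - real n * c + real j * c" using c(2) by (simp add: c_def field_simps)
    show "h * (\<kappa> / 2 * exp (- \<kappa> * (t - real j * h) / 2)) = exp (- real n * c) * c * exp c ^ j"
      unfolding e exp_add exp_of_nat_mult by (simp add: c_def)
  qed
  also have "\<dots> = exp (- real n * c) * (c * (\<Sum>j<n. exp c ^ j))" by (simp add: sum_distrib_left mult.assoc)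
  also have "\<dots> \<le> exp (- real n * c) * ((exp c - 1) * (\<Sum>j<n. exp c ^ j))"
  proof -
    have "c \<le> exp c - 1" using exp_ge_add_one_self[of c] by linarith
    then show ?thesis by (intro mult_left_mono mult_right_mono sum_nonneg) auto
  qed
  also have "(exp c - 1) * (\<Sum>j<n. exp c ^ j) = exp c ^ n - 1" by (rule power_diff_1_eq[symmetric])
  also have "exp (- real n * c) * (exp c ^ n - 1) = 1 - exp (- real n * c)"
  proof -
    have "exp (- real n * c) * exp (real n * c) = 1" by (simp flip: exp_add)
    then show ?thesis by (simp only: right_diff_distrib exp_of_nat_mult[symmetric] mult_1_right)
  qed
  also have "\<dots> \<le> 1" by simp
  finally show ?thesis by (simp add: h_def)
qed simp

context bounded_ito_integral
begin

text \<open>The kernel is split as \<open>p q\<close> into a weight \<open>p\<close>, whose Riemann sums are at most 1, and a factor \<open>q\<close>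
  that multiplies the increments.\<close>

lemma weighted_integral_exponential_moment:
  assumes t: "0 < t"
    and p: "\<And>s. s \<in> {0..t} \<Longrightarrow> 0 \<le> p s" "\<And>n::nat. (\<Sum>j<n. t / real n * p (real j * (t / real n))) \<le> 1"
    and pq: "continuous_on {0..t} (\<lambda>s. p s * q s)"
    and K: "1 \<le> K" "\<And>s. s \<in> {0..t} \<Longrightarrow> (q s)\<^sup>2 * M\<^sup>2 * (t - s) / 2 \<le> ln K"
  shows "(\<integral>\<^sup>+\<omega>. ennreal (exp (integral {0..t} (\<lambda>s. p s * q s * (I t \<omega> - I s \<omega>)))) \<partial>P) \<le> ennreal K"
proof -
  define s where "s n j = real j * (t / real n)" for n j
  have s: "s n j \<in> {0..t}" if "j < n" for n j
  proof -
    have "s n j \<le> real n * (t / real n)" unfolding s_def using that t by (intro mult_right_mono) auto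
    then show ?thesis using that t by (auto simp: s_def)
  qed
  define w where "w n j = t / real n * p (s n j)" for n j
  have w: "0 \<le> w n j" if "j < n" for n j using p(1)[OF s[OF that]] t by (simp add: w_def)
  have w1: "sum (w n) {..<n} \<le> 1" for n using p(2)[of n] by (simp add: w_def[abs_def] s_def)
  define y where "y n j \<omega> = q (s n j) * (I t \<omega> - I (s n j) \<omega>)" for n j \<omega>
  have It: "I t \<in> borel_measurable P" using t by (intro I_measurable) simp
  have ym: "y n j \<in> borel_measurable P" if "j < n" for n j
    unfolding y_def using s[OF that] by (intro borel_measurable_times borel_measurable_diff It I_measurable) auto
  have ey: "(\<integral>\<^sup>+\<omega>. ennreal (exp (y n j \<omega>)) \<partial>P) \<le> ennreal K" if "j < n" for n j
  proof -
    have "(\<integral>\<^sup>+\<omega>. ennreal (exp (y n j \<omega>)) \<partial>P) \<le> ennreal (exp ((q (s n j))\<^sup>2 * M\<^sup>2 * (t - s n j) / 2))"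
      unfolding y_def by (rule increment_exponential_moment) (use s[OF that] in auto)
    also have "\<dots> \<le> ennreal (exp (ln K))" using K(2)[OF s[OF that]] by (intro ennreal_leI) simp
    finally show ?thesis using K(1) by simp
  qed
  show ?thesis
  proof (rule nn_integral_limit_le)
    show "(\<lambda>\<omega>. ennreal (exp (\<Sum>j<n. w n j * y n j \<omega>))) \<in> borel_measurable P" for n
      by (intro measurable_compose[OF _ measurable_ennreal] measurable_compose[OF _ borel_measurable_exp]
        borel_measurable_sum borel_measurable_times ym) auto
    have "AE \<omega> in P. continuous_on {0..} (\<lambda>t. I t \<omega>)" using ito by (simp add: ito_integral_def)
    then show "AE \<omega> in P. (\<lambda>n. ennreal (exp (\<Sum>j<n. w n j * y n j \<omega>))) \<longlonglongrightarrow>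
      ennreal (exp (integral {0..t} (\<lambda>s. p s * q s * (I t \<omega> - I s \<omega>))))"
    proof eventually_elim
      case (elim \<omega>)
      then have "continuous_on {0..t} (\<lambda>s. I s \<omega>)" by (rule continuous_on_subset) auto
      then have "continuous_on {0..t} (\<lambda>s. p s * q s * (I t \<omega> - I s \<omega>))" by (intro continuous_intros pq)
      from left_riemann_sums_tendsto[OF t this]
      show ?case by (intro tendsto_ennrealI tendsto_exp) (simp add: w_def y_def s_def mult.assoc)
    qed
    fix n
    have "(\<integral>\<^sup>+\<omega>. ennreal (exp (\<Sum>j<n. w n j * y n j \<omega>)) \<partial>P) \<le>
      (\<integral>\<^sup>+\<omega>. (\<Sum>j<n. ennreal (w n j) * ennreal (exp (y n j \<omega>))) + ennreal (1 - sum (w n) {..<n}) \<partial>P)"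
    proof (intro nn_integral_mono)
      fix \<omega>
      have "ennreal (exp (\<Sum>j<n. w n j * y n j \<omega>)) \<le> ennreal ((\<Sum>j<n. w n j * exp (y n j \<omega>)) + (1 - sum (w n) {..<n}))"
        by (intro ennreal_leI exp_subconvex) (use w w1 in auto)
      also have "\<dots> = (\<Sum>j<n. ennreal (w n j) * ennreal (exp (y n j \<omega>))) + ennreal (1 - sum (w n) {..<n})"
      proof -
        have "(\<Sum>j<n. ennreal (w n j) * ennreal (exp (y n j \<omega>))) = (\<Sum>j<n. ennreal (w n j * exp (y n j \<omega>)))"
          by (rule sum.cong) (use w in \<open>auto simp: ennreal_mult\<close>)
        also have "\<dots> = ennreal (\<Sum>j<n. w n j * exp (y n j \<omega>))" by (rule sum_ennreal) (use w in auto)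
        finally have eq: "(\<Sum>j<n. ennreal (w n j) * ennreal (exp (y n j \<omega>))) = ennreal (\<Sum>j<n. w n j * exp (y n j \<omega>))" .
        have "0 \<le> (\<Sum>j<n. w n j * exp (y n j \<omega>))" by (rule sum_nonneg) (use w in auto)
        then show ?thesis unfolding eq using w1[of n] by (simp add: ennreal_plus)
      qed
      finally show "ennreal (exp (\<Sum>j<n. w n j * y n j \<omega>)) \<le>
        (\<Sum>j<n. ennreal (w n j) * ennreal (exp (y n j \<omega>))) + ennreal (1 - sum (w n) {..<n})" .
    qed
    also have "\<dots> = (\<Sum>j<n. ennreal (w n j) * (\<integral>\<^sup>+\<omega>. ennreal (exp (y n j \<omega>)) \<partial>P)) + ennreal (1 - sum (w n) {..<n})"
    proof -
      have m: "(\<lambda>\<omega>. ennreal (exp (y n j \<omega>))) \<in> borel_measurable P" if "j < n" for j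
        using ym[OF that] by measurable
      have mw: "(\<lambda>\<omega>. ennreal (w n j) * ennreal (exp (y n j \<omega>))) \<in> borel_measurable P" if "j < n" for j
        using m[OF that] by measurable
      have "(\<integral>\<^sup>+\<omega>. (\<Sum>j<n. ennreal (w n j) * ennreal (exp (y n j \<omega>))) + ennreal (1 - sum (w n) {..<n}) \<partial>P) =
        (\<integral>\<^sup>+\<omega>. (\<Sum>j<n. ennreal (w n j) * ennreal (exp (y n j \<omega>))) \<partial>P) + (\<integral>\<^sup>+\<omega>. ennreal (1 - sum (w n) {..<n}) \<partial>P)"
      proof (rule nn_integral_add)
        show "(\<lambda>\<omega>. \<Sum>j<n. ennreal (w n j) * ennreal (exp (y n j \<omega>))) \<in> borel_measurable P"
          by (rule borel_measurable_sum) (use mw in blast)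
      qed simp
      also have "(\<integral>\<^sup>+\<omega>. (\<Sum>j<n. ennreal (w n j) * ennreal (exp (y n j \<omega>))) \<partial>P) =
        (\<Sum>j<n. \<integral>\<^sup>+\<omega>. ennreal (w n j) * ennreal (exp (y n j \<omega>)) \<partial>P)"
        by (rule nn_integral_sum) (use mw in blast)
      also have "\<dots> = (\<Sum>j<n. ennreal (w n j) * (\<integral>\<^sup>+\<omega>. ennreal (exp (y n j \<omega>)) \<partial>P))"
        by (rule sum.cong[OF refl], rule nn_integral_cmult) (use m in blast)
      finally show ?thesis by (simp add: emeasure_space_1)
    qed
    also have "\<dots> \<le> (\<Sum>j<n. ennreal (w n j) * ennreal K) + ennreal (1 - sum (w n) {..<n})"
      by (intro add_mono order.refl sum_mono mult_left_mono) (use ey in auto)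
    also have "\<dots> = ennreal (sum (w n) {..<n} * K + (1 - sum (w n) {..<n}))"
    proof -
      have "(\<Sum>j<n. ennreal (w n j) * ennreal K) = ennreal (sum (w n) {..<n}) * ennreal K"
        by (subst sum_distrib_right[symmetric], subst sum_ennreal) (use w in auto)
      also have "\<dots> = ennreal (sum (w n) {..<n} * K)"
        by (rule ennreal_mult[symmetric]) (use w K(1) in \<open>auto intro: sum_nonneg\<close>)
      finally have eq: "(\<Sum>j<n. ennreal (w n j) * ennreal K) = ennreal (sum (w n) {..<n} * K)" .
      have "0 \<le> sum (w n) {..<n} * K" using w K(1) by (intro mult_nonneg_nonneg sum_nonneg) auto
      then show ?thesis unfolding eq using w1[of n] by (simp add: ennreal_plus)
    qed
    also have "\<dots> \<le> ennreal K"
    proof (rule ennreal_leI)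
      have "0 \<le> (1 - sum (w n) {..<n}) * (K - 1)" using w1[of n] K(1) by simp
      then show "sum (w n) {..<n} * K + (1 - sum (w n) {..<n}) \<le> K" by (simp add: algebra_simps)
    qed
    finally show "(\<integral>\<^sup>+\<omega>. ennreal (exp (\<Sum>j<n. w n j * y n j \<omega>)) \<partial>P) \<le> ennreal K" .
  qed
qed

end

section \<open>Concentration for the solution\<close>

text \<open>The left-hand side of the bound is \<open>ln (\<integral> exp f) - \<integral> f\<close>, and both integrands are bounded and
  continuous.\<close>

lemma GCBS_weak_limit:
  assumes rd: "\<And>n. real_distribution (\<mu> n)" "real_distribution \<nu>"
    and conv: "weak_conv_m \<mu> \<nu>" and gc: "eventually (\<lambda>n. GCBS D (\<mu> n)) sequentially"
  shows "GCBS D \<nu>"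
  unfolding GCBS_def
proof (intro allI impI)
  fix f assume f: "smooth_compact_support f"
  obtain C where C: "\<And>x. \<bar>f x\<bar> \<le> C" using smooth_compact_support_continuous[OF f] by blast
  have fc: "isCont f x" for x by (rule smooth_compact_support_continuous(1)[OF f])
  interpret \<nu>: real_distribution \<nu> by (rule rd)
  have "continuous_on UNIV f" using fc by (simp add: continuous_at_imp_continuous_on)
  then have [measurable]: "f \<in> borel_measurable borel" by (rule borel_measurable_continuous_onI)
  have fle: "- C \<le> f x" "f x \<le> C" for x using C[of x] by (auto simp: abs_le_iff)
  have m: "(\<lambda>n. \<integral>x. f x \<partial>\<mu> n) \<longlonglongrightarrow> (\<integral>x. f x \<partial>\<nu>)"
    by (rule weak_conv_imp_integral_bdd_continuous_conv[OF rd conv fc, of C]) (use C in auto)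
  have e: "(\<lambda>n. \<integral>x. exp (f x) \<partial>\<mu> n) \<longlonglongrightarrow> (\<integral>x. exp (f x) \<partial>\<nu>)"
    by (rule weak_conv_imp_integral_bdd_continuous_conv[OF rd conv, of _ "exp C"]) (use fc fle in auto)
  have "integrable \<nu> (\<lambda>x. exp (f x))"
    by (rule \<nu>.integrable_const_bound[of _ "exp C"]) (use fle in auto)
  then have "(\<integral>x. exp (- C) \<partial>\<nu>) \<le> (\<integral>x. exp (f x) \<partial>\<nu>)"
    by (intro integral_mono) (use fle in auto)
  then have "exp (- C) \<le> (\<integral>x. exp (f x) \<partial>\<nu>)" using \<nu>.prob_space by simp
  then have pos: "0 < (\<integral>x. exp (f x) \<partial>\<nu>)" by (rule less_le_trans[OF exp_gt_zero])
  have split: "(\<integral>x. exp (f x - (\<integral>y. f y \<partial>\<rho>)) \<partial>\<rho>) = (\<integral>x. exp (f x) \<partial>\<rho>) / exp (\<integral>y. f y \<partial>\<rho>)" for \<rho>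
    by (simp add: exp_diff)
  have "(\<lambda>n. ln ((\<integral>x. exp (f x) \<partial>\<mu> n) / exp (\<integral>x. f x \<partial>\<mu> n))) \<longlonglongrightarrow>
      ln ((\<integral>x. exp (f x) \<partial>\<nu>) / exp (\<integral>x. f x \<partial>\<nu>))"
    by (intro tendsto_ln tendsto_divide tendsto_exp m e) (use pos in auto)
  moreover have "eventually (\<lambda>n. ln ((\<integral>x. exp (f x) \<partial>\<mu> n) / exp (\<integral>x. f x \<partial>\<mu> n)) \<le> D * (lip f)\<^sup>2) sequentially"
    using gc by (rule eventually_mono) (use f in \<open>auto simp: GCBS_def split\<close>)
  ultimately show "ln (\<integral>x. exp (f x - (\<integral>y. f y \<partial>\<nu>)) \<partial>\<nu>) \<le> D * (lip f)\<^sup>2"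
    unfolding split by (rule tendsto_upperbound) simp
qed

lemma mult_exp_minus_le: "0 < \<kappa> \<Longrightarrow> u * exp (- \<kappa> * u) \<le> 1 / \<kappa>" for \<kappa> u :: real
proof -
  assume k: "0 < \<kappa>"
  have "\<kappa> * u \<le> exp (\<kappa> * u)" using exp_ge_add_one_self[of "\<kappa> * u"] by linarith
  then have "\<kappa> * u * exp (- \<kappa> * u) \<le> exp (\<kappa> * u) * exp (- \<kappa> * u)" by (intro mult_right_mono) auto
  also have "\<dots> = 1" by (simp flip: exp_add)
  finally show ?thesis using k by (simp add: field_simps)
qed

context bounded_ito_integral
begin

text \<open>The contribution of the past increments to the solution of the linear equation.\<close>

definition memory :: "real \<Rightarrow> real \<Rightarrow> 'a \<Rightarrow> real" where
  "memory \<kappa> t \<omega> = integral {0..t} (\<lambda>s. \<kappa> * exp (- \<kappa> * (t - s)) * (I t \<omega> - I s \<omega>))"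

text \<open>Uniform weights \<open>1 / t\<close> suffice, for every sign of \<open>\<kappa>\<close>, at the price of a constant that depends on
  \<open>t\<close>.\<close>

lemma memory_exponential_moment:
  assumes t: "0 < t"
  shows "(\<integral>\<^sup>+\<omega>. ennreal (exp (l * memory \<kappa> t \<omega>)) \<partial>P) \<le>
    ennreal (exp (t\<^sup>2 * \<kappa>\<^sup>2 * (exp (\<bar>\<kappa>\<bar> * t))\<^sup>2 * M\<^sup>2 * t / 2 * l\<^sup>2))"
proof -
  define C where "C = t\<^sup>2 * \<kappa>\<^sup>2 * (exp (\<bar>\<kappa>\<bar> * t))\<^sup>2 * M\<^sup>2 * t / 2"
  have C: "0 \<le> C" using t by (simp add: C_def)
  define p where "p s = 1 / t" for s :: real
  define q where "q s = l * t * \<kappa> * exp (- \<kappa> * (t - s))" for s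
  have pq: "p s * q s = l * (\<kappa> * exp (- \<kappa> * (t - s)))" for s using t by (simp add: p_def q_def)
  have "(\<integral>\<^sup>+\<omega>. ennreal (exp (integral {0..t} (\<lambda>s. p s * q s * (I t \<omega> - I s \<omega>)))) \<partial>P) \<le> ennreal (exp (C * l\<^sup>2))"
  proof (rule weighted_integral_exponential_moment[OF t])
    show "0 \<le> p s" for s using t by (simp add: p_def)
    show "(\<Sum>j<n. t / real n * p (real j * (t / real n))) \<le> 1" for n :: nat
      using t by (simp add: p_def)
    show "continuous_on {0..t} (\<lambda>s. p s * q s)" unfolding pq by (intro continuous_intros)
    show "1 \<le> exp (C * l\<^sup>2)" using C by simp
    fix s assume s: "s \<in> {0..t}"
    have "- \<kappa> * (t - s) \<le> \<bar>\<kappa>\<bar> * t"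
    proof -
      have "- \<kappa> * (t - s) \<le> \<bar>\<kappa>\<bar> * (t - s)" using s by (intro mult_right_mono) auto
      also have "\<dots> \<le> \<bar>\<kappa>\<bar> * t" using s by (intro mult_left_mono) auto
      finally show ?thesis .
    qed
    then have e: "(exp (- \<kappa> * (t - s)))\<^sup>2 \<le> (exp (\<bar>\<kappa>\<bar> * t))\<^sup>2" by (intro power_mono) auto
    have "(q s)\<^sup>2 * M\<^sup>2 * (t - s) / 2 = l\<^sup>2 * t\<^sup>2 * \<kappa>\<^sup>2 * M\<^sup>2 / 2 * ((exp (- \<kappa> * (t - s)))\<^sup>2 * (t - s))"
      by (simp add: q_def power_mult_distrib)
    also have "\<dots> \<le> l\<^sup>2 * t\<^sup>2 * \<kappa>\<^sup>2 * M\<^sup>2 / 2 * ((exp (\<bar>\<kappa>\<bar> * t))\<^sup>2 * t)"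
      using s by (intro mult_left_mono mult_mono e) auto
    also have "\<dots> = C * l\<^sup>2" by (simp add: C_def)
    finally show "(q s)\<^sup>2 * M\<^sup>2 * (t - s) / 2 \<le> ln (exp (C * l\<^sup>2))" by simp
  qed
  then show ?thesis unfolding pq by (simp add: memory_def C_def mult.assoc)
qed

text \<open>Half of the decay goes into the weight, the other half into the factor \<open>q\<close>. The increment over
  \<open>[s, t]\<close> has variance at most \<open>M\<^sup>2 (t - s)\<close>, and \<open>(t - s) exp (- \<kappa> (t - s))\<close> is at most \<open>1 / \<kappa>\<close>.\<close>

lemma memory_exponential_moment_stable:
  assumes t: "0 < t" and \<kappa>: "0 < \<kappa>"
  shows "(\<integral>\<^sup>+\<omega>. ennreal (exp (l * memory \<kappa> t \<omega>)) \<partial>P) \<le> ennreal (exp (2 * M\<^sup>2 / \<kappa> * l\<^sup>2))"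
proof -
  define p where "p s = \<kappa> / 2 * exp (- \<kappa> * (t - s) / 2)" for s
  define q where "q s = 2 * l * exp (- \<kappa> * (t - s) / 2)" for s
  have sq: "exp (- \<kappa> * (t - s) / 2) * exp (- \<kappa> * (t - s) / 2) = exp (- \<kappa> * (t - s))" for s
    by (simp flip: exp_add)
  have "p s * q s = l * (\<kappa> * (exp (- \<kappa> * (t - s) / 2) * exp (- \<kappa> * (t - s) / 2)))" for s
    by (simp add: p_def q_def)
  then have pq: "p s * q s = l * (\<kappa> * exp (- \<kappa> * (t - s)))" for s unfolding sq .
  have "(\<integral>\<^sup>+\<omega>. ennreal (exp (integral {0..t} (\<lambda>s. p s * q s * (I t \<omega> - I s \<omega>)))) \<partial>P) \<le>
    ennreal (exp (2 * M\<^sup>2 / \<kappa> * l\<^sup>2))"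
  proof (rule weighted_integral_exponential_moment[OF t])
    show "0 \<le> p s" for s using \<kappa> by (simp add: p_def)
    show "(\<Sum>j<n. t / real n * p (real j * (t / real n))) \<le> 1" for n :: nat
      unfolding p_def by (rule geometric_left_sum_le[OF \<kappa> t])
    show "continuous_on {0..t} (\<lambda>s. p s * q s)" unfolding pq by (intro continuous_intros)
    show "1 \<le> exp (2 * M\<^sup>2 / \<kappa> * l\<^sup>2)" using \<kappa> by simp
    fix s assume s: "s \<in> {0..t}"
    have "(q s)\<^sup>2 * M\<^sup>2 * (t - s) / 2 = 2 * l\<^sup>2 * M\<^sup>2 * ((t - s) * (exp (- \<kappa> * (t - s) / 2) * exp (- \<kappa> * (t - s) / 2)))"
      by (simp add: q_def power2_eq_square)
    also have "\<dots> = 2 * l\<^sup>2 * M\<^sup>2 * ((t - s) * exp (- \<kappa> * (t - s)))" unfolding sq ..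
    also have "\<dots> \<le> 2 * l\<^sup>2 * M\<^sup>2 * (1 / \<kappa>)"
      by (intro mult_left_mono mult_exp_minus_le \<kappa>) auto
    finally show "(q s)\<^sup>2 * M\<^sup>2 * (t - s) / 2 \<le> ln (exp (2 * M\<^sup>2 / \<kappa> * l\<^sup>2))" by (simp add: mult_ac)
  qed
  then show ?thesis unfolding pq by (simp add: memory_def mult.assoc)
qed

text \<open>The three parts of the solution may be dependent; \<open>exp_sum3_le\<close> separates them. Tripling the
  argument is the origin of the factor 9 in the bounds.\<close>

lemma solution_subgaussian:
  assumes X: "\<And>t. 0 \<le> t \<Longrightarrow> X t \<in> borel_measurable P"
    and Xi: "AE \<omega> in P. \<forall>t\<ge>0. set_integrable lborel {0..t} (\<lambda>s. X s \<omega>)"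
    and eq: "AE \<omega> in P. \<forall>t\<ge>0. X t \<omega> = X 0 \<omega> + (LINT s:{0..t}|lborel. - \<kappa> * X s \<omega>) + I t \<omega>"
    and init: "subgaussian A B (distr P borel (X 0))" and A: "0 \<le> A"
    and t: "0 < t"
    and mem: "\<And>l. (\<integral>\<^sup>+\<omega>. ennreal (exp (l * memory \<kappa> t \<omega>)) \<partial>P) \<le> ennreal (exp (C * l\<^sup>2))"
    and B': "9 * (B * (exp (- \<kappa> * t))\<^sup>2) \<le> B'" "9 * ((exp (- \<kappa> * t))\<^sup>2 * M\<^sup>2 * t / 2) \<le> B'" "9 * C \<le> B'"
  shows "subgaussian (A + 2) B' (distr P borel (X t))"
  unfolding subgaussian_def
proof
  fix l :: real
  define a where "a = exp (- \<kappa> * t)"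
  have t0: "0 \<le> t" using t by simp
  note [measurable] = X[OF t0] X[OF order.refl] I_measurable[OF t0] I_measurable[OF order.refl]
  \<comment> \<open>\<open>Y\<close> is almost surely \<open>memory \<kappa> t\<close>, but measurable by construction.\<close>
  define Y where "Y \<omega> = X t \<omega> - a * X 0 \<omega> - a * (I t \<omega> - I 0 \<omega>)" for \<omega>
  have [measurable]: "Y \<in> borel_measurable P" unfolding Y_def by measurable
  have "AE \<omega> in P. continuous_on {0..} (\<lambda>t. I t \<omega>)" using ito by (simp add: ito_integral_def)
  with Xi eq have Ym: "AE \<omega> in P. Y \<omega> = memory \<kappa> t \<omega>"
  proof eventually_elim
    case (elim \<omega>)
    from linear_equation_solution[of "\<lambda>t. I t \<omega>" "\<lambda>t. X t \<omega>" \<kappa> t] elim t0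
    have "X t \<omega> = exp (- \<kappa> * t) * X 0 \<omega> + exp (- \<kappa> * t) * (I t \<omega> - I 0 \<omega>) +
      integral {0..t} (\<lambda>s. \<kappa> * exp (- \<kappa> * (t - s)) * (I t \<omega> - I s \<omega>))" by blast
    then show ?case by (simp add: Y_def memory_def a_def)
  qed
  have 1: "(\<integral>\<^sup>+\<omega>. ennreal (exp (3 * (l * a * X 0 \<omega>))) \<partial>P) \<le> ennreal (A * exp (B' * l\<^sup>2))"
  proof -
    have "(\<integral>\<^sup>+\<omega>. ennreal (exp (3 * (l * a * X 0 \<omega>))) \<partial>P) = (\<integral>\<^sup>+x. ennreal (exp ((3 * l * a) * x)) \<partial>distr P borel (X 0))"
      by (subst nn_integral_distr) (simp_all add: mult.assoc)
    also have "\<dots> \<le> ennreal (A * exp (B * (3 * l * a)\<^sup>2))" using init by (simp add: subgaussian_def)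
    also have "B * (3 * l * a)\<^sup>2 = 9 * (B * a\<^sup>2) * l\<^sup>2" by (simp add: power_mult_distrib)
    also have "ennreal (A * exp (9 * (B * a\<^sup>2) * l\<^sup>2)) \<le> ennreal (A * exp (B' * l\<^sup>2))"
      using B'(1) A by (intro ennreal_leI mult_left_mono) (auto simp: a_def intro!: mult_right_mono)
    finally show ?thesis .
  qed
  have 2: "(\<integral>\<^sup>+\<omega>. ennreal (exp (3 * (l * a * (I t \<omega> - I 0 \<omega>)))) \<partial>P) \<le> ennreal (exp (B' * l\<^sup>2))"
  proof -
    have "(\<integral>\<^sup>+\<omega>. ennreal (exp ((3 * l * a) * (I t \<omega> - I 0 \<omega>))) \<partial>P) \<le> ennreal (exp ((3 * l * a)\<^sup>2 * M\<^sup>2 * (t - 0) / 2))"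
      by (rule increment_exponential_moment) (use t in auto)
    also have "(3 * l * a)\<^sup>2 * M\<^sup>2 * (t - 0) / 2 = 9 * (a\<^sup>2 * M\<^sup>2 * t / 2) * l\<^sup>2" by (simp add: power_mult_distrib)
    also have "ennreal (exp (9 * (a\<^sup>2 * M\<^sup>2 * t / 2) * l\<^sup>2)) \<le> ennreal (exp (B' * l\<^sup>2))"
      unfolding a_def by (intro ennreal_leI iffD2[OF exp_le_cancel_iff] mult_right_mono B'(2)) simp
    finally show ?thesis by (simp add: mult.assoc)
  qed
  have 3: "(\<integral>\<^sup>+\<omega>. ennreal (exp (3 * (l * Y \<omega>))) \<partial>P) \<le> ennreal (exp (B' * l\<^sup>2))"
  proof -
    have "(\<integral>\<^sup>+\<omega>. ennreal (exp (3 * (l * Y \<omega>))) \<partial>P) = (\<integral>\<^sup>+\<omega>. ennreal (exp ((3 * l) * memory \<kappa> t \<omega>)) \<partial>P)"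
      by (rule nn_integral_cong_AE) (use Ym in \<open>auto elim!: eventually_mono simp: mult.assoc\<close>)
    also have "\<dots> \<le> ennreal (exp (C * (3 * l)\<^sup>2))" by (rule mem)
    also have "C * (3 * l)\<^sup>2 = 9 * C * l\<^sup>2" by (simp add: power_mult_distrib)
    also have "ennreal (exp (9 * C * l\<^sup>2)) \<le> ennreal (exp (B' * l\<^sup>2))"
      by (intro ennreal_leI iffD2[OF exp_le_cancel_iff] mult_right_mono B'(3)) simp
    finally show ?thesis .
  qed
  have "(\<integral>\<^sup>+x. ennreal (exp (l * x)) \<partial>distr P borel (X t)) = (\<integral>\<^sup>+\<omega>. ennreal (exp (l * X t \<omega>)) \<partial>P)"
    by (subst nn_integral_distr) auto
  also have "\<dots> \<le> (\<integral>\<^sup>+\<omega>. ennreal (exp (3 * (l * a * X 0 \<omega>))) + ennreal (exp (3 * (l * a * (I t \<omega> - I 0 \<omega>)))) +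
      ennreal (exp (3 * (l * Y \<omega>))) \<partial>P)"
  proof (rule nn_integral_mono)
    fix \<omega>
    have "l * X t \<omega> = l * a * X 0 \<omega> + l * a * (I t \<omega> - I 0 \<omega>) + l * Y \<omega>" by (simp add: Y_def algebra_simps)
    then have "exp (l * X t \<omega>) \<le> exp (3 * (l * a * X 0 \<omega>)) + exp (3 * (l * a * (I t \<omega> - I 0 \<omega>))) + exp (3 * (l * Y \<omega>))"
      by (simp only: exp_sum3_le)
    then show "ennreal (exp (l * X t \<omega>)) \<le> ennreal (exp (3 * (l * a * X 0 \<omega>))) +
      ennreal (exp (3 * (l * a * (I t \<omega> - I 0 \<omega>)))) + ennreal (exp (3 * (l * Y \<omega>)))"
      by (simp flip: ennreal_plus add: ennreal_leI)
  qed
  also have "\<dots> = (\<integral>\<^sup>+\<omega>. ennreal (exp (3 * (l * a * X 0 \<omega>))) \<partial>P) +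
      (\<integral>\<^sup>+\<omega>. ennreal (exp (3 * (l * a * (I t \<omega> - I 0 \<omega>)))) \<partial>P) + (\<integral>\<^sup>+\<omega>. ennreal (exp (3 * (l * Y \<omega>))) \<partial>P)"
    by (subst nn_integral_add, measurable)+
  also have "\<dots> \<le> ennreal (A * exp (B' * l\<^sup>2)) + ennreal (exp (B' * l\<^sup>2)) + ennreal (exp (B' * l\<^sup>2))"
    by (intro add_mono 1 2 3)
  also have "\<dots> = ennreal ((A + 2) * exp (B' * l\<^sup>2))"
    using A by (simp flip: ennreal_plus add: algebra_simps)
  finally show "(\<integral>\<^sup>+x. ennreal (exp (l * x)) \<partial>distr P borel (X t)) \<le> ennreal ((A + 2) * exp (B' * l\<^sup>2))" .
qed

end

theorem theorem6p1:
  fixes P :: "'a measure" and F :: "real \<Rightarrow> 'a measure"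
    and W \<sigma> X :: "real \<Rightarrow> 'a \<Rightarrow> real" and \<mu>\<^sub>0 :: "real measure" and \<kappa> M D\<^sub>0 :: real
  assumes "filtered_prob_space P F"
    and "brownian_motion P F W"
    and "predictable P F \<sigma>"
    and "M > 0"
    and "(SUP t\<in>{0..}. esssup P (\<lambda>\<omega>. ereal \<bar>\<sigma> t \<omega>\<bar>)) \<le> ereal M"
    and "solves_sde P F W \<kappa> \<sigma> X"
    and "X 0 \<in> borel_measurable (F 0)"
    and "real_distribution \<mu>\<^sub>0"
    and "distr P borel (X 0) = \<mu>\<^sub>0"
    and "D\<^sub>0 \<ge> 0"
    and "GCBS D\<^sub>0 \<mu>\<^sub>0"
  shows "(\<forall>t>0. \<exists>D>0. GCBS D (distr P borel (X t))) \<and>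
         (\<kappa> > 0 \<longrightarrow> (\<exists>D>0. \<forall>\<nu>. weak_limit_point P X \<nu> \<longrightarrow> GCBS D \<nu>))"
proof -
  obtain I where I: "ito_integral P F W \<sigma> I"
    and eq: "AE \<omega> in P. \<forall>t\<ge>0. X t \<omega> = X 0 \<omega> + (LINT s:{0..t}|lborel. - \<kappa> * X s \<omega>) + I t \<omega>"
    and X: "\<And>t. 0 \<le> t \<Longrightarrow> X t \<in> borel_measurable P"
    and Xi: "AE \<omega> in P. \<forall>t\<ge>0. set_integrable lborel {0..t} (\<lambda>s. X s \<omega>)"
    using assms(6) unfolding solves_sde_def by blast
  interpret prob_space P using assms(1) by (simp add: filtered_prob_space_def)
  have bound: "AE \<omega> in P. \<bar>\<sigma> t \<omega>\<bar> \<le> M" if "0 \<le> t" for t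
  proof -
    have "esssup P (\<lambda>\<omega>. ereal \<bar>\<sigma> t \<omega>\<bar>) \<le> (SUP t\<in>{0..}. esssup P (\<lambda>\<omega>. ereal \<bar>\<sigma> t \<omega>\<bar>))"
      using that by (intro SUP_upper) simp
    also note assms(5)
    finally have le: "esssup P (\<lambda>\<omega>. ereal \<bar>\<sigma> t \<omega>\<bar>) \<le> ereal M" .
    show ?thesis using esssup_AE[of "\<lambda>\<omega>. ereal \<bar>\<sigma> t \<omega>\<bar>" P]
    proof eventually_elim
      case (elim \<omega>)
      then have "ereal \<bar>\<sigma> t \<omega>\<bar> \<le> ereal M" using le by (rule order.trans)
      then show ?case by simp
    qed
  qed
  interpret bounded_ito_integral P F W \<sigma> I M
    by unfold_locales (use assms(1-4) bound I in auto)
  obtain A B where AB: "1 \<le> A" "0 \<le> B" "subgaussian A B (distr P borel (X 0))"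
    using GCBS_imp_subgaussian[OF assms(8,10,11)] assms(9) by metis
  have rd: "real_distribution (distr P borel (X t))" if "0 \<le> t" for t
    by (rule real_distribution_distr) (rule X[OF that])
  note sg = solution_subgaussian[OF X Xi eq AB(3)]
  have A2: "1 \<le> A + 2" "0 \<le> A" using AB by auto
  show ?thesis
  proof (intro conjI allI impI)
    fix t :: real assume t: "0 < t"
    define C where "C = t\<^sup>2 * \<kappa>\<^sup>2 * (exp (\<bar>\<kappa>\<bar> * t))\<^sup>2 * M\<^sup>2 * t / 2"
    define B' where "B' = 9 * (B * (exp (- \<kappa> * t))\<^sup>2) + 9 * ((exp (- \<kappa> * t))\<^sup>2 * M\<^sup>2 * t / 2) + 9 * C"
    have nn: "0 \<le> B * (exp (- \<kappa> * t))\<^sup>2" "0 \<le> (exp (- \<kappa> * t))\<^sup>2 * M\<^sup>2 * t / 2" "0 \<le> C"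
      using AB t by (auto simp: C_def)
    have "0 \<le> B'" using nn unfolding B'_def by linarith
    obtain D where D: "0 < D" "\<And>\<mu>. real_distribution \<mu> \<Longrightarrow> subgaussian (A + 2) B' \<mu> \<Longrightarrow> GCBS D \<mu>"
      using subgaussian_imp_GCBS[OF A2(1) \<open>0 \<le> B'\<close>] by blast
    have "subgaussian (A + 2) B' (distr P borel (X t))"
    proof (rule sg[OF _ A2(2) t])
      show "(\<integral>\<^sup>+\<omega>. ennreal (exp (l * memory \<kappa> t \<omega>)) \<partial>P) \<le> ennreal (exp (C * l\<^sup>2))" for l
        unfolding C_def by (rule memory_exponential_moment[OF t])
    qed (use nn in \<open>unfold B'_def, linarith+\<close>)
    then show "\<exists>D>0. GCBS D (distr P borel (X t))" using D rd t by force
  next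
    assume \<kappa>: "0 < \<kappa>"
    \<comment> \<open>With \<open>\<kappa> > 0\<close> each of the three bounds loses its dependence on \<open>t\<close>.\<close>
    define m where "m = M\<^sup>2 / \<kappa>"
    define B' where "B' = 9 * B + 9 * (m / 2) + 9 * (2 * m)"
    have nn: "0 \<le> B" "0 \<le> m" using AB \<kappa> by (auto simp: m_def)
    have "0 \<le> B'" using nn unfolding B'_def by linarith
    obtain D where D: "0 < D" "\<And>\<mu>. real_distribution \<mu> \<Longrightarrow> subgaussian (A + 2) B' \<mu> \<Longrightarrow> GCBS D \<mu>"
      using subgaussian_imp_GCBS[OF A2(1) \<open>0 \<le> B'\<close>] by blast
    have gc: "GCBS D (distr P borel (X t))" if t: "0 < t" for t
    proof (rule D(2))
      show "real_distribution (distr P borel (X t))" using rd t by simp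
      have a: "exp (- \<kappa> * t) \<le> 1" using \<kappa> t by simp
      then have a2: "(exp (- \<kappa> * t))\<^sup>2 \<le> 1" "(exp (- \<kappa> * t))\<^sup>2 \<le> exp (- \<kappa> * t)"
        by (auto simp: power2_eq_square mult_le_one mult_left_le)
      show "subgaussian (A + 2) B' (distr P borel (X t))"
      proof (rule sg[OF _ A2(2) t])
        show "(\<integral>\<^sup>+\<omega>. ennreal (exp (l * memory \<kappa> t \<omega>)) \<partial>P) \<le> ennreal (exp (2 * m * l\<^sup>2))" for l
          using memory_exponential_moment_stable[OF t \<kappa>, of l] by (simp add: m_def)
        have "B * (exp (- \<kappa> * t))\<^sup>2 \<le> B" using a2(1) nn(1) by (simp add: mult_left_le)
        then show "9 * (B * (exp (- \<kappa> * t))\<^sup>2) \<le> B'" using nn unfolding B'_def by linarith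
        have "t * (exp (- \<kappa> * t))\<^sup>2 \<le> t * exp (- \<kappa> * t)" using a2(2) t by (intro mult_left_mono) auto
        also have "\<dots> \<le> 1 / \<kappa>" by (rule mult_exp_minus_le[OF \<kappa>])
        finally have "M\<^sup>2 / 2 * (t * (exp (- \<kappa> * t))\<^sup>2) \<le> M\<^sup>2 / 2 * (1 / \<kappa>)" by (intro mult_left_mono) auto
        then have "(exp (- \<kappa> * t))\<^sup>2 * M\<^sup>2 * t / 2 \<le> m / 2" by (simp add: m_def mult_ac)
        then show "9 * ((exp (- \<kappa> * t))\<^sup>2 * M\<^sup>2 * t / 2) \<le> B'" using nn unfolding B'_def by linarith
        show "9 * (2 * m) \<le> B'" using nn unfolding B'_def by linarith
      qed
    qed
    have "GCBS D \<nu>" if "weak_limit_point P X \<nu>" for \<nu>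
    proof -
      have w: "real_distribution \<nu>" using that by (simp add: weak_limit_point_def)
      have "\<exists>t. (\<forall>n. 0 \<le> t n) \<and> filterlim t at_top sequentially \<and>
          weak_conv_m (\<lambda>n. distr P borel (X (t n))) \<nu>"
        using that unfolding weak_limit_point_def by (elim conjE)
      then obtain t where t0: "\<forall>n. 0 \<le> t n" and t: "filterlim t at_top sequentially"
        and conv: "weak_conv_m (\<lambda>n. distr P borel (X (t n))) \<nu>"
        by (elim exE conjE)
      have "eventually (\<lambda>n. 0 < t n) sequentially" using t by (simp add: filterlim_at_top_dense)
      then have "eventually (\<lambda>n. GCBS D (distr P borel (X (t n)))) sequentially"
        by (rule eventually_mono) (rule gc)
      then show ?thesis using rd t0 by (intro GCBS_weak_limit[OF _ w conv]) auto
    qed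
    then show "\<exists>D>0. \<forall>\<nu>. weak_limit_point P X \<nu> \<longrightarrow> GCBS D \<nu>" using D(1) by blast
  qed
qed

end
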